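(* Let $S:=2\ln 2-1$ and $\epsilon_1:=10^{-19}$. There is a randomized algorithm which, given a 1C-Unique $(\le 3)$-CNF formula $F$ on $n$ variables, runs in expected time $2^{(S-\epsilon_1+o(1))n}$ and outputs the unique satisfying assignment of $F$ with probability at least $2^{-o(n)}$.
   Context: A clause is a finite set of literals over pairwise distinct variables; a CNF formula is a finite set of clauses; a $(\le 3)$-CNF has all clauses of size at most 3. A clause $C$ is critical for a variable $x$ with respect to a satisfying assignment $\alpha$ if $\alpha$ satisfies exactly one literal of $C$ and this literal is over $x$. A 1C-Unique $(\le 3)$-CNF is a uniquely satisfiable $(\le 3)$-CNF in which every variable has at most one critical clause with respect to the unique satisfying assignment. The terms $o(1)$, $o(n)$ depend only on $n$ and satisfy $o(1)\to 0$, $o(n)/n\to 0$ as $n\to\infty$. *)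

theory Defs
  imports "HOL-Probability.SPMF" "HOL-Library.Landau_Symbols"
begin

section \<open>CNF formulas\<close>

text \<open>The literal \<open>(x, b)\<close> is satisfied iff \<open>x\<close> receives the value \<open>b\<close>.\<close>

type_synonym 'v literal = "'v \<times> bool"
type_synonym 'v clause = "'v literal set"
type_synonym 'v cnf = "'v clause set"
type_synonym 'v assignment = "'v \<Rightarrow> bool option"

definition is_clause :: "'v clause \<Rightarrow> bool" where
  "is_clause C \<longleftrightarrow> finite C \<and> inj_on fst C"

definition is_cnf :: "'v cnf \<Rightarrow> bool" where
  "is_cnf F \<longleftrightarrow> finite F \<and> (\<forall>C\<in>F. is_clause C)"

definition is_le3_cnf :: "'v cnf \<Rightarrow> bool" where
  "is_le3_cnf F \<longleftrightarrow> is_cnf F \<and> (\<forall>C\<in>F. card C \<le> 3)"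

definition vars :: "'v cnf \<Rightarrow> 'v set" where
  "vars F = fst ` \<Union>F"

definition sat_literal :: "'v assignment \<Rightarrow> 'v literal \<Rightarrow> bool" where
  "sat_literal \<alpha> l \<longleftrightarrow> \<alpha> (fst l) = Some (snd l)"

definition satisfying_assignment :: "'v cnf \<Rightarrow> 'v assignment \<Rightarrow> bool" where
  "satisfying_assignment F \<alpha> \<longleftrightarrow>
     dom \<alpha> = vars F \<and> (\<forall>C\<in>F. \<exists>l\<in>C. sat_literal \<alpha> l)"

definition critical :: "'v assignment \<Rightarrow> 'v clause \<Rightarrow> 'v \<Rightarrow> bool" where
  "critical \<alpha> C x \<longleftrightarrow> (\<exists>l. {l'\<in>C. sat_literal \<alpha> l'} = {l} \<and> fst l = x)"

definition uniquely_satisfiable :: "'v cnf \<Rightarrow> bool" where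
  "uniquely_satisfiable F \<longleftrightarrow> (\<exists>!\<alpha>. satisfying_assignment F \<alpha>)"

definition the_assignment :: "'v cnf \<Rightarrow> 'v assignment" where
  "the_assignment F = (THE \<alpha>. satisfying_assignment F \<alpha>)"

definition one_critical_unique_le3_cnf :: "'v cnf \<Rightarrow> bool" where
  "one_critical_unique_le3_cnf F \<longleftrightarrow>
     is_le3_cnf F \<and> uniquely_satisfiable F \<and>
     (\<forall>x\<in>vars F. card {C\<in>F. critical (the_assignment F) C x} \<le> 1)"


section \<open>Randomized algorithms\<close>

text \<open>
  Algorithms are programs of Jones' WHILE language over binary trees, extended by a fair coin
  toss. A program uses finitely many registers, each holding a tree; assigning an expression
  costs one unit plus one unit per node of the expression. Since trees can be shared, each unit
  is a constant number of pointer operations. Hence random access machines with logarithmic cost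
  and such programs simulate each other with time overhead polylogarithmic in the running time,
  that is, polynomial in \<open>n\<close> when the running time is \<open>2\<^sup>O\<^sup>(\<^sup>n\<^sup>)\<close>.
\<close>

datatype tree = Leaf | Node tree tree

fun left :: "tree \<Rightarrow> tree" where
  "left Leaf = Leaf"
| "left (Node a b) = a"

fun right :: "tree \<Rightarrow> tree" where
  "right Leaf = Leaf"
| "right (Node a b) = b"

type_synonym register = nat
type_synonym state = "register \<Rightarrow> tree"

datatype exp = Reg register | LeafE | NodeE exp exp | LeftE exp | RightE exp

primrec eval_exp :: "exp \<Rightarrow> state \<Rightarrow> tree" where
  "eval_exp (Reg x) s = s x"
| "eval_exp LeafE s = Leaf"
| "eval_exp (NodeE e1 e2) s = Node (eval_exp e1 s) (eval_exp e2 s)"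
| "eval_exp (LeftE e) s = left (eval_exp e s)"
| "eval_exp (RightE e) s = right (eval_exp e s)"

primrec exp_cost :: "exp \<Rightarrow> nat" where
  "exp_cost (Reg x) = 1"
| "exp_cost LeafE = 1"
| "exp_cost (NodeE e1 e2) = 1 + exp_cost e1 + exp_cost e2"
| "exp_cost (LeftE e) = 1 + exp_cost e"
| "exp_cost (RightE e) = 1 + exp_cost e"

text \<open>In tests, and as truth values, \<open>Leaf\<close> stands for false.\<close>

datatype com =
    Assign register exp
  | Toss register
  | Seq com com
  | Cond exp com com
  | While exp com

fun tree_of_bool :: "bool \<Rightarrow> tree" where
  "tree_of_bool False = Leaf"
| "tree_of_bool True = Node Leaf Leaf"

definition add_cost :: "nat \<Rightarrow> state \<times> nat \<Rightarrow> state \<times> nat" where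
  "add_cost k = (\<lambda>(s, t). (s, k + t))"

text \<open>
  The semantics is the joint sub-distribution of final state and running time; missing mass is
  the probability of divergence.
\<close>

partial_function (spmf) while_loop ::
  "exp \<Rightarrow> (state \<Rightarrow> (state \<times> nat) spmf) \<Rightarrow> state \<Rightarrow> (state \<times> nat) spmf" where
  "while_loop e body s =
     (if eval_exp e s = Leaf then return_spmf (s, 1 + exp_cost e)
      else bind_spmf (body s)
             (\<lambda>(s', t). map_spmf (add_cost (1 + exp_cost e + t)) (while_loop e body s')))"

primrec exec :: "com \<Rightarrow> state \<Rightarrow> (state \<times> nat) spmf" where
  "exec (Assign x e) s = return_spmf (s(x := eval_exp e s), 1 + exp_cost e)"
| "exec (Toss x) s = map_spmf (\<lambda>b. (s(x := tree_of_bool b), 1)) coin_spmf"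
| "exec (Seq c1 c2) s =
     bind_spmf (exec c1 s) (\<lambda>(s', t). map_spmf (add_cost t) (exec c2 s'))"
| "exec (Cond e c1 c2) s =
     map_spmf (add_cost (1 + exp_cost e))
       (if eval_exp e s = Leaf then exec c2 s else exec c1 s)"
| "exec (While e c) s = while_loop e (exec c) s"

text \<open>Register 0 holds the input initially and the output at termination.\<close>

definition run :: "com \<Rightarrow> tree \<Rightarrow> (tree \<times> nat) spmf" where
  "run P inp = map_spmf (\<lambda>(s, t). (s 0, t)) (exec P ((\<lambda>_. Leaf)(0 := inp)))"

definition output_prob :: "com \<Rightarrow> tree \<Rightarrow> tree \<Rightarrow> real" where
  "output_prob P inp out = spmf (map_spmf fst (run P inp)) out"

definition expected_time :: "com \<Rightarrow> tree \<Rightarrow> ennreal" where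
  "expected_time P inp =
     (if lossless_spmf (run P inp)
      then \<integral>\<^sup>+ (y, t). of_nat t \<partial>measure_spmf (run P inp)
      else \<infinity>)"


section \<open>Input and output encoding\<close>

fun tree_of_nat :: "nat \<Rightarrow> tree" where
  "tree_of_nat 0 = Leaf"
| "tree_of_nat (Suc n) = Node Leaf (tree_of_nat n)"

fun tree_of_list :: "('a \<Rightarrow> tree) \<Rightarrow> 'a list \<Rightarrow> tree" where
  "tree_of_list f [] = Leaf"
| "tree_of_list f (x # xs) = Node (f x) (tree_of_list f xs)"

definition tree_of_literal :: "nat \<times> bool \<Rightarrow> tree" where
  "tree_of_literal l = Node (tree_of_nat (fst l)) (tree_of_bool (snd l))"

definition tree_of_clauses :: "(nat \<times> bool) list list \<Rightarrow> tree" where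
  "tree_of_clauses = tree_of_list (tree_of_list tree_of_literal)"

text \<open>
  Variables are presented to the algorithm by their positions in an enumeration \<open>vs\<close>;
  clauses, and literals within a clause, are listed without repetition in arbitrary order.
  Unary positions keep the size of the tree polynomial in the number of variables.
\<close>

definition lists_cnf :: "'v list \<Rightarrow> (nat \<times> bool) list list \<Rightarrow> 'v cnf \<Rightarrow> bool" where
  "lists_cnf vs cls F \<longleftrightarrow>
     distinct vs \<and> set vs = vars F \<and>
     (\<forall>c\<in>set cls. distinct c \<and> (\<forall>l\<in>set c. fst l < length vs)) \<and>
     distinct (map set cls) \<and>
     F = (\<lambda>c. (\<lambda>(i, b). (vs ! i, b)) ` set c) ` set cls"

definition tree_of_assignment :: "'v list \<Rightarrow> 'v assignment \<Rightarrow> tree" where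
  "tree_of_assignment vs \<alpha> = tree_of_list (\<lambda>x. tree_of_bool (the (\<alpha> x))) vs"

end

theory Submission
  imports Defs "HOL-Library.Multiset" "HOL-Real_Asymp.Real_Asymp"
begin

text \<open>
  Every round draws independent uniform times for the variables. It guesses the variables with a time
  in a short initial interval \<open>A\<close>, then those in the next interval \<open>B\<close>, and runs through the others in the
  order of their times, guessing only the values that are not forced by a refutation of bounded
  depth. Harris' inequality, applied to critical clause trees, bounds the expected number of guesses by
  \<open>S n\<close> up to an arbitrarily small multiple of \<open>n\<close> and a term of third order in the length of \<open>A\<close>.

  The gain comes from biasing the guesses in \<open>B\<close> towards the majority of the clauses that the guesses
  in \<open>A\<close> shorten to two literals. A critical clause votes for the right value of its true literal as often as
  for wrong values of its false literals, so the critical clauses cause no loss of first order,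
  and as there are at most \<open>n\<close> of them, the loss of second order is small. A clause with exactly two
  true literals only ever votes for right values. If there are linearly many disjoint pairs of true
  literals of such clauses, then the expected cost drops by a constant multiple of \<open>n\<close>, and by Jensen's
  inequality the success probability rises accordingly. Otherwise a maximal family of disjoint pairs covers few
  variables. Guessing their values satisfies all clauses with exactly two true literals, every remaining clause
  has an odd number of true literals, and Gaussian elimination finds the assignment.
\<close>

section \<open>Polynomial-time programs\<close>

text \<open>The threshold of n/16 variables covered by the disjoint pairs serves both cases. Below
  it, guessing every variable with probability 1/8 succeeds at rate 3/8 < 2 ln 2 - 1. Above it, let
  p = 2^-a be the length of A and of B and \<theta> = 2^-J the bias per vote: the gain is about p^2
  (\<theta>/16 - 32.5 \<theta>^2) n, while guessing A and B blindly costs about 8 p^3 n more than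
  the PPSZ integral. So first \<theta> and then p has to be small; p = 2^-20 and \<theta> = 2^-11
  leave more than 10^-17 n. The number K of bits of a time and the refutation depth D depend only on
  the error allowed in the integral, not on n, so they are constants of the program. Votes depend on
  earlier guesses, yet only right guesses in A have to be considered: for fixed times, the
  favourable guess words contain a product of sets, one per variable, which reduces the success
  probability to a sum of costs. Polynomial time is shown for functions on encodings by closure
  rules. Only the coin tosses and the loop with exponentially many rounds are written out as
  programs and analysed by couplings.\<close>

class enc = fixes enc :: "'a \<Rightarrow> tree"

instantiation bool :: enc begin
definition "enc_bool = tree_of_bool"
instance ..
end

instantiation nat :: enc begin
definition "enc_nat = tree_of_nat"
instance ..
end

instantiation prod :: (enc, enc) enc begin
definition "enc_prod p = Node (enc (fst p)) (enc (snd p))"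
instance ..
end

instantiation list :: (enc) enc begin
definition "enc_list = tree_of_list enc"
instance ..
end

text \<open>The successor counts the leaves of the tree instead of its nodes, so that sizes add up
  exactly on pairs and list cells.\<close>

definition esz :: "'a::enc \<Rightarrow> nat" where
  "esz x = Suc (size (enc x))"

lemma enc_simps [simp]:
  "enc False = Leaf" "enc True = Node Leaf Leaf"
  "enc (0::nat) = Leaf" "enc (Suc n) = Node Leaf (enc n)"
  "enc (a, b) = Node (enc a) (enc b)"
  "enc [] = Leaf" "enc (x # xs) = Node (enc x) (enc xs)"
  by (simp_all add: enc_bool_def enc_nat_def enc_prod_def enc_list_def)

lemma esz_simps [simp]:
  "esz False = 1" "esz True = 2" "esz (a, b) = esz a + esz b"
  "esz [] = 1" "esz (x # xs) = esz x + esz xs"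
  by (simp_all add: esz_def)

lemma esz_nat [simp]: "esz (n::nat) = Suc n"
  by (induction n) (simp_all add: esz_def)

lemma esz_pos [simp]: "0 < esz x"
  by (simp add: esz_def)

lemma esz_ge_1 [simp]: "Suc 0 \<le> esz x"
  by (simp add: esz_def)

lemma esz_append: "esz (xs @ ys) + 1 = esz xs + esz ys"
  by (induction xs) auto

lemma esz_list: "esz xs = 1 + sum_list (map esz xs)"
  by (induction xs) auto

lemma esz_mem: "x \<in> set xs \<Longrightarrow> esz x \<le> esz xs"
  by (induction xs) auto

lemma length_le_esz: "length xs < esz xs"
proof (induction xs)
  case (Cons x xs)
  then show ?case using esz_pos[of x] by (simp del: esz_pos esz_ge_1)
qed simp

lemma esz_list_le: "(\<And>x. x \<in> set xs \<Longrightarrow> esz x \<le> b) \<Longrightarrow> esz xs \<le> 1 + length xs * b"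
proof (induction xs)
  case (Cons x xs)
  then have "esz x \<le> b" "esz xs \<le> 1 + length xs * b" by auto
  then show ?case by simp
qed simp

section \<open>Functions polynomially bounded in the size of the encoding\<close>

definition polybounded :: "('a::enc \<Rightarrow> nat) \<Rightarrow> bool" where
  "polybounded u \<longleftrightarrow> (\<exists>c k. \<forall>x. u x \<le> c * esz x ^ k)"

lemma polyboundedI: "(\<And>x. u x \<le> c * esz x ^ k) \<Longrightarrow> polybounded u"
  unfolding polybounded_def by blast

lemma polybounded_mono: "polybounded v \<Longrightarrow> (\<And>x. u x \<le> v x) \<Longrightarrow> polybounded u"
  unfolding polybounded_def by (meson order_trans)

lemma polybounded_const [simp]: "polybounded (\<lambda>_. c)"
  by (rule polyboundedI[where k = 0 and c = c]) simp

lemma polybounded_esz [simp]: "polybounded esz"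
  by (rule polyboundedI[where k = 1 and c = 1]) simp

lemma polybounded_add:
  assumes "polybounded u" "polybounded v"
  shows "polybounded (\<lambda>x. u x + v x)"
proof -
  obtain c k where u: "\<And>x. u x \<le> c * esz x ^ k"
    using assms(1) by (auto simp: polybounded_def)
  obtain d l where v: "\<And>x. v x \<le> d * esz x ^ l"
    using assms(2) by (auto simp: polybounded_def)
  show ?thesis
  proof (rule polyboundedI)
    fix x :: 'a
    have "u x \<le> c * esz x ^ (k + l)"
      by (rule order_trans[OF u]) (simp add: power_increasing)
    moreover have "v x \<le> d * esz x ^ (k + l)"
      by (rule order_trans[OF v]) (simp add: power_increasing)
    ultimately show "u x + v x \<le> (c + d) * esz x ^ (k + l)"
      by (simp add: algebra_simps)
  qed
qed

lemma polybounded_mult: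
  assumes "polybounded u" "polybounded v"
  shows "polybounded (\<lambda>x. u x * v x)"
proof -
  obtain c k where u: "\<And>x. u x \<le> c * esz x ^ k"
    using assms(1) by (auto simp: polybounded_def)
  obtain d l where v: "\<And>x. v x \<le> d * esz x ^ l"
    using assms(2) by (auto simp: polybounded_def)
  show ?thesis
  proof (rule polyboundedI)
    fix x :: 'a
    show "u x * v x \<le> (c * d) * esz x ^ (k + l)"
      using mult_le_mono[OF u v] by (simp add: algebra_simps power_add)
  qed
qed

lemma polybounded_power: "polybounded u \<Longrightarrow> polybounded (\<lambda>x. u x ^ k)"
  by (induction k) (simp_all add: polybounded_mult)

lemma polybounded_comp_le:
  assumes "polybounded u" "polybounded v" "\<And>x. esz (f x) \<le> v x"
  shows "polybounded (\<lambda>x. u (f x))"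
proof -
  obtain c k where u: "\<And>x. u x \<le> c * esz x ^ k"
    using assms(1) by (auto simp: polybounded_def)
  have "polybounded (\<lambda>x. c * v x ^ k)"
    by (intro polybounded_mult polybounded_power polybounded_const assms(2))
  then show ?thesis
  proof (rule polybounded_mono)
    fix x
    show "u (f x) \<le> c * v x ^ k"
      using u[of "f x"] power_mono[OF assms(3)[of x], of k] by (meson le_trans mult_le_mono order_refl zero_le)
  qed
qed

lemma polybounded_comp:
  "polybounded u \<Longrightarrow> polybounded (\<lambda>x. esz (f x)) \<Longrightarrow> polybounded (\<lambda>x. u (f x))"
  by (rule polybounded_comp_le) auto

section \<open>Deterministic runs and polynomial-time functions\<close>

definition runs :: "com \<Rightarrow> state \<Rightarrow> state \<Rightarrow> nat \<Rightarrow> bool" where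
  "runs P s s' t \<longleftrightarrow> exec P s = return_spmf (s', t)"

lemma runs_Assign:
  "s' = s(x := eval_exp e s) \<Longrightarrow> t = 1 + exp_cost e \<Longrightarrow> runs (Assign x e) s s' t"
  by (simp add: runs_def)

lemma runs_Seq: "runs P s s1 t1 \<Longrightarrow> runs Q s1 s2 t2 \<Longrightarrow> runs (Seq P Q) s s2 (t1 + t2)"
  by (simp add: runs_def add_cost_def)

lemma runs_Cond_True:
  "eval_exp e s \<noteq> Leaf \<Longrightarrow> runs P s s' t \<Longrightarrow> runs (Cond e P Q) s s' (1 + exp_cost e + t)"
  by (simp add: runs_def add_cost_def)

lemma runs_Cond_False:
  "eval_exp e s = Leaf \<Longrightarrow> runs Q s s' t \<Longrightarrow> runs (Cond e P Q) s s' (1 + exp_cost e + t)"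
  by (simp add: runs_def add_cost_def)

lemma runs_While_False:
  "eval_exp e s = Leaf \<Longrightarrow> runs (While e P) s s (1 + exp_cost e)"
  by (simp add: runs_def while_loop.simps)

lemma runs_While_True:
  "eval_exp e s \<noteq> Leaf \<Longrightarrow> runs P s s1 t1 \<Longrightarrow> runs (While e P) s1 s2 t2 \<Longrightarrow>
   runs (While e P) s s2 (1 + exp_cost e + t1 + t2)"
  by (simp add: runs_def while_loop.simps[of e "exec P" s] add_cost_def)

text \<open>Only register 0 is assumed to be set, so a program may leave garbage in the registers
  below \<open>m\<close>; those from \<open>m\<close> on are preserved and can hold values of a
  surrounding program.\<close>

definition computes :: "com \<Rightarrow> nat \<Rightarrow> ('a::enc \<Rightarrow> nat) \<Rightarrow> ('a \<Rightarrow> 'b::enc) \<Rightarrow> bool" where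
  "computes P m u f \<longleftrightarrow> (\<forall>s x. s 0 = enc x \<longrightarrow>
     (\<exists>s' t. runs P s s' t \<and> s' 0 = enc (f x) \<and> (\<forall>r\<ge>m. s' r = s r) \<and> t \<le> u x))"

lemma computesE:
  assumes "computes P m u f" "s 0 = enc x"
  obtains s' t where "runs P s s' t" "s' 0 = enc (f x)" "\<And>r. r \<ge> m \<Longrightarrow> s' r = s r" "t \<le> u x"
  using assms unfolding computes_def by blast

text \<open>The output size needs its own bound: trees are shared, so assigning
  \<open>Node x x\<close> repeatedly doubles a tree at constant cost, and a short run can produce an
  exponentially large tree. Without the bound, compositions would not stay polynomial.\<close>

definition polytime :: "('a::enc \<Rightarrow> 'b::enc) \<Rightarrow> bool" where
  "polytime f \<longleftrightarrow> (\<exists>P m u. computes P m u f \<and> polybounded u) \<and> polybounded (\<lambda>x. esz (f x))"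

lemma polytimeE:
  fixes f :: "'a::enc \<Rightarrow> 'b::enc"
  assumes "polytime f"
  obtains P m u where "computes P m u f" "polybounded u" "0 < m" "polybounded (\<lambda>x. esz (f x))"
proof -
  obtain P m u where *: "computes P m u f" "polybounded u" "polybounded (\<lambda>x. esz (f x))"
    using assms by (auto simp: polytime_def)
  \<comment> \<open>Raising the bound makes it positive, so that the preserved registers never
    include the output register 0.\<close>
  have "computes P (Suc m) u f"
    unfolding computes_def
  proof (intro allI impI)
    fix s :: state and x :: 'a assume "s 0 = enc x"
    then obtain s' t where "runs P s s' t" "s' 0 = enc (f x)" "\<And>r. r \<ge> m \<Longrightarrow> s' r = s r" "t \<le> u x"
      using computesE[OF *(1)] by metis
    then show "\<exists>s' t. runs P s s' t \<and> s' 0 = enc (f x) \<and> (\<forall>r\<ge>Suc m. s' r = s r) \<and> t \<le> u x"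
      by (intro exI[of _ s'] exI[of _ t]) auto
  qed
  with * that show thesis by blast
qed

lemma polytimeI:
  "computes P m u f \<Longrightarrow> polybounded u \<Longrightarrow> polybounded (\<lambda>x. esz (f x)) \<Longrightarrow> polytime f"
  unfolding polytime_def by blast

lemma polytime_esz: "polytime f \<Longrightarrow> polybounded (\<lambda>x. esz (f x))"
  by (simp add: polytime_def)

lemma polytime_exp:
  fixes f :: "'a::enc \<Rightarrow> 'b::enc"
  assumes "\<And>s x. s 0 = enc x \<Longrightarrow> eval_exp e s = enc (f x)" "polybounded (\<lambda>x. esz (f x))"
  shows "polytime f"
proof (rule polytimeI[of "Assign 0 e" 1 "\<lambda>_. 1 + exp_cost e"])
  show "polybounded (\<lambda>x. esz (f x))" by fact
  show "computes (Assign 0 e) 1 (\<lambda>_. 1 + exp_cost e) f"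
    unfolding computes_def
  proof (intro allI impI)
    fix s :: state and x :: 'a assume "s 0 = enc x"
    then show "\<exists>s' t. runs (Assign 0 e) s s' t \<and> s' 0 = enc (f x) \<and> (\<forall>r\<ge>1. s' r = s r)
      \<and> t \<le> 1 + exp_cost e"
      using assms(1) by (intro exI[of _ "s(0 := eval_exp e s)"] exI[of _ "1 + exp_cost e"])
        (auto intro: runs_Assign)
  qed
qed simp

lemma polytime_id [intro!, simp]: "polytime (\<lambda>x. x)"
  by (rule polytime_exp[where e = "Reg 0"]) auto

primrec exp_of_tree :: "tree \<Rightarrow> exp" where
  "exp_of_tree Leaf = LeafE"
| "exp_of_tree (Node a b) = NodeE (exp_of_tree a) (exp_of_tree b)"

lemma eval_exp_of_tree [simp]: "eval_exp (exp_of_tree t) s = t"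
  by (induction t) auto

lemma polytime_const [intro!, simp]: "polytime (\<lambda>_. c)"
  by (rule polytime_exp[where e = "exp_of_tree (enc c)"]) auto

lemma polytime_fst_prim: "polytime fst"
proof (rule polytime_exp[where e = "LeftE (Reg 0)"])
  show "polybounded (\<lambda>x :: 'a \<times> 'b. esz (fst x))"
    by (rule polybounded_mono[OF polybounded_esz]) (auto split: prod.splits)
qed (auto simp: enc_prod_def)

lemma polytime_snd_prim: "polytime snd"
proof (rule polytime_exp[where e = "RightE (Reg 0)"])
  show "polybounded (\<lambda>x :: 'a \<times> 'b. esz (snd x))"
    by (rule polybounded_mono[OF polybounded_esz]) (auto split: prod.splits)
qed (auto simp: enc_prod_def)

lemma polytime_Cons_prim: "polytime (\<lambda>p. fst p # snd p)"
proof (rule polytime_exp[where e = "Reg 0"])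
  show "polybounded (\<lambda>x :: 'a \<times> 'a list. esz (fst x # snd x))"
    by (rule polybounded_mono[OF polybounded_esz]) auto
qed (auto simp: enc_prod_def)

lemma polytime_Suc_prim: "polytime Suc"
proof (rule polytime_exp[where e = "NodeE LeafE (Reg 0)"])
  show "polybounded (\<lambda>x. esz (Suc x))"
    by (rule polybounded_mono[OF polybounded_add[OF polybounded_const[of 1] polybounded_esz]]) auto
qed auto

lemma polytime_pred_prim: "polytime (\<lambda>n::nat. n - 1)"
proof (rule polytime_exp[where e = "RightE (Reg 0)"])
  show "polybounded (\<lambda>x :: nat. esz (x - 1))"
    by (rule polybounded_mono[OF polybounded_esz]) auto
  show "eval_exp (RightE (Reg 0)) s = enc (x - 1)" if "s 0 = enc x" for s and x :: nat
    using that by (cases x) auto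
qed

lemma polytime_comp:
  fixes f :: "'b::enc \<Rightarrow> 'c::enc" and g :: "'a::enc \<Rightarrow> 'b"
  assumes f: "polytime f" and g: "polytime g"
  shows "polytime (\<lambda>x. f (g x))"
proof -
  obtain P m u where P: "computes P m u f" "polybounded u" "polybounded (\<lambda>x. esz (f x))"
    using polytimeE[OF f] by metis
  obtain Q l v where Q: "computes Q l v g" "polybounded v" "polybounded (\<lambda>x. esz (g x))"
    using polytimeE[OF g] by metis
  show ?thesis
  proof (rule polytimeI[of "Seq Q P" "max m l" "\<lambda>x. v x + u (g x)"])
    show "polybounded (\<lambda>x. esz (f (g x)))"
      by (rule polybounded_comp[OF P(3) Q(3)])
    show "polybounded (\<lambda>x. v x + u (g x))"
      by (intro polybounded_add Q(2) polybounded_comp[OF P(2) Q(3)])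
    show "computes (Seq Q P) (max m l) (\<lambda>x. v x + u (g x)) (\<lambda>x. f (g x))"
      unfolding computes_def
    proof (intro allI impI)
      fix s :: state and x :: 'a assume "s 0 = enc x"
      then obtain s1 t1 where 1: "runs Q s s1 t1" "s1 0 = enc (g x)" "\<And>r. r \<ge> l \<Longrightarrow> s1 r = s r" "t1 \<le> v x"
        using computesE[OF Q(1)] by metis
      then obtain s2 t2 where 2: "runs P s1 s2 t2" "s2 0 = enc (f (g x))"
        "\<And>r. r \<ge> m \<Longrightarrow> s2 r = s1 r" "t2 \<le> u (g x)"
        using computesE[OF P(1)] by metis
      show "\<exists>s' t. runs (Seq Q P) s s' t \<and> s' 0 = enc (f (g x)) \<and> (\<forall>r\<ge>max m l. s' r = s r) \<and> t \<le> v x + u (g x)"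
        using 1 2 by (intro exI[of _ s2] exI[of _ "t1 + t2"]) (auto intro: runs_Seq)
    qed
  qed
qed

lemma polytime_Pair [intro!]:
  fixes f :: "'a::enc \<Rightarrow> 'b::enc" and g :: "'a \<Rightarrow> 'c::enc"
  assumes f: "polytime f" and g: "polytime g"
  shows "polytime (\<lambda>x. (f x, g x))"
proof -
  obtain P m u where P: "computes P m u f" "polybounded u" "0 < m" "polybounded (\<lambda>x. esz (f x))"
    using polytimeE[OF f] by metis
  obtain Q l v where Q: "computes Q l v g" "polybounded v" "0 < l" "polybounded (\<lambda>x. esz (g x))"
    using polytimeE[OF g] by metis
  \<comment> \<open>Register \<open>M\<close> keeps the input and \<open>Suc M\<close> the first
    result, out of reach of both programs.\<close>
  define M where "M = max m l"
  have M: "m \<le> M" "l \<le> M" "0 < M" using P(3) by (auto simp: M_def)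
  let ?C = "Seq (Assign M (Reg 0)) (Seq P (Seq (Assign (Suc M) (Reg 0)) (Seq (Assign 0 (Reg M))
    (Seq Q (Assign 0 (NodeE (Reg (Suc M)) (Reg 0)))))))"
  show ?thesis
  proof (rule polytimeI[of ?C "Suc (Suc M)" "\<lambda>x. 10 + (u x + v x)"])
    show "polybounded (\<lambda>x. esz (f x, g x))"
      using polybounded_add[OF P(4) Q(4)] by simp
    show "polybounded (\<lambda>x. 10 + (u x + v x))"
      by (intro polybounded_add P Q polybounded_const)
    show "computes ?C (Suc (Suc M)) (\<lambda>x. 10 + (u x + v x)) (\<lambda>x. (f x, g x))"
      unfolding computes_def
    proof (intro allI impI)
      fix s :: state and x :: 'a assume s: "s 0 = enc x"
      have r0: "runs (Assign M (Reg 0)) s (s(M := s 0)) 2"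
        by (intro runs_Assign) auto
      obtain s1 t1 where 1: "runs P (s(M := s 0)) s1 t1" "s1 0 = enc (f x)"
        "\<And>r. r \<ge> m \<Longrightarrow> s1 r = (s(M := s 0)) r" "t1 \<le> u x"
        using computesE[OF P(1), of "s(M := s 0)" x] M s by auto
      define s2 where "s2 = s1(Suc M := s1 0)"
      have r2: "runs (Assign (Suc M) (Reg 0)) s1 s2 2"
        by (intro runs_Assign) (auto simp: s2_def)
      define s3 where "s3 = s2(0 := s2 M)"
      have r3: "runs (Assign 0 (Reg M)) s2 s3 2"
        by (intro runs_Assign) (auto simp: s3_def)
      have s3: "s3 0 = enc x" using 1(3)[of M] M s by (simp add: s3_def s2_def)
      obtain s4 t4 where 4: "runs Q s3 s4 t4" "s4 0 = enc (g x)"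
        "\<And>r. r \<ge> l \<Longrightarrow> s4 r = s3 r" "t4 \<le> v x"
        using computesE[OF Q(1), of s3 x] s3 by metis
      define s5 where "s5 = s4(0 := Node (s4 (Suc M)) (s4 0))"
      have r5: "runs (Assign 0 (NodeE (Reg (Suc M)) (Reg 0))) s4 s5 4"
        by (intro runs_Assign) (auto simp: s5_def)
      have "runs ?C s s5 (2 + (t1 + (2 + (2 + (t4 + 4)))))"
        by (rule runs_Seq r0 1 r2 r3 4 r5)+
      moreover have "s4 (Suc M) = enc (f x)"
        using 4(3)[of "Suc M"] M 1(2) by (simp add: s3_def s2_def)
      then have "s5 0 = enc (f x, g x)"
        using 4(2) by (simp add: s5_def)
      moreover have "s5 r = s r" if "r \<ge> Suc (Suc M)" for r
        using that M 4(3)[of r] 1(3)[of r] by (simp add: s5_def s3_def s2_def)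
      ultimately show "\<exists>s' t. runs ?C s s' t \<and> s' 0 = enc (f x, g x)
         \<and> (\<forall>r\<ge>Suc (Suc M). s' r = s r) \<and> t \<le> 10 + (u x + v x)"
        using 1(4) 4(4) by (intro exI[of _ s5] exI[of _ "2 + (t1 + (2 + (2 + (t4 + 4))))"]) auto
    qed
  qed
qed

lemma polytime_if_prim:
  fixes f :: "'a::enc \<Rightarrow> 'b::enc" and g :: "'a \<Rightarrow> 'b::enc"
  assumes f: "polytime f" and g: "polytime g"
  shows "polytime (\<lambda>p. if fst p then f (snd p) else g (snd p))"
proof -
  obtain P m u where P: "computes P m u f" "polybounded u" "0 < m" "polybounded (\<lambda>x. esz (f x))"
    using polytimeE[OF f] by metis
  obtain Q l v where Q: "computes Q l v g" "polybounded v" "0 < l" "polybounded (\<lambda>x. esz (g x))"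
    using polytimeE[OF g] by metis
  define M where "M = max m l"
  have M: "m \<le> M" "l \<le> M" "0 < M" using P(3) by (auto simp: M_def)
  let ?C = "Seq (Assign M (LeftE (Reg 0))) (Seq (Assign 0 (RightE (Reg 0))) (Cond (Reg M) P Q))"
  have snd: "polybounded (\<lambda>x :: bool \<times> 'a. esz (snd x))"
    by (rule polytime_esz[OF polytime_snd_prim])
  show ?thesis
  proof (rule polytimeI[of ?C "Suc M" "\<lambda>p. 10 + (u (snd p) + v (snd p))"])
    show "polybounded (\<lambda>p. esz (if fst p then f (snd p) else g (snd p)))"
      by (rule polybounded_mono[OF polybounded_add[OF polybounded_comp[OF P(4) snd] polybounded_comp[OF Q(4) snd]]])
        auto
    show "polybounded (\<lambda>p :: bool \<times> 'a. 10 + (u (snd p) + v (snd p)))"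
      by (intro polybounded_add polybounded_const polybounded_comp[OF P(2) snd] polybounded_comp[OF Q(2) snd])
    show "computes ?C (Suc M) (\<lambda>p. 10 + (u (snd p) + v (snd p))) (\<lambda>p. if fst p then f (snd p) else g (snd p))"
      unfolding computes_def
    proof (intro allI impI)
      fix s :: state and p :: "bool \<times> 'a" assume s: "s 0 = enc p"
      obtain b x where p: "p = (b, x)" by (cases p)
      define s1 where "s1 = s(M := left (s 0))"
      define s2 where "s2 = s1(0 := right (s1 0))"
      have r1: "runs (Assign M (LeftE (Reg 0))) s s1 3"
        by (intro runs_Assign) (auto simp: s1_def)
      have r2: "runs (Assign 0 (RightE (Reg 0))) s1 s2 3"
        by (intro runs_Assign) (auto simp: s2_def)
      have s2: "s2 0 = enc x" "s2 M = enc b"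
        using s M by (auto simp: s2_def s1_def p)
      show "\<exists>s' t. runs ?C s s' t \<and> s' 0 = enc (if fst p then f (snd p) else g (snd p))
         \<and> (\<forall>r\<ge>Suc M. s' r = s r) \<and> t \<le> 10 + (u (snd p) + v (snd p))"
      proof (cases b)
        case True
        obtain s3 t3 where 3: "runs P s2 s3 t3" "s3 0 = enc (f x)"
          "\<And>r. r \<ge> m \<Longrightarrow> s3 r = s2 r" "t3 \<le> u x"
          using computesE[OF P(1), of s2 x] s2 by metis
        have "runs ?C s s3 (3 + (3 + (1 + exp_cost (Reg M) + t3)))"
          by (rule runs_Seq[OF r1 runs_Seq[OF r2 runs_Cond_True[OF _ 3(1)]]]) (use s2 True in simp)
        then show ?thesis using 3 True p M
          by (intro exI[of _ s3] exI[of _ "3 + (3 + (1 + exp_cost (Reg M) + t3))"])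
            (auto simp: s2_def s1_def)
      next
        case False
        obtain s3 t3 where 3: "runs Q s2 s3 t3" "s3 0 = enc (g x)"
          "\<And>r. r \<ge> l \<Longrightarrow> s3 r = s2 r" "t3 \<le> v x"
          using computesE[OF Q(1), of s2 x] s2 by metis
        have "runs ?C s s3 (3 + (3 + (1 + exp_cost (Reg M) + t3)))"
          by (rule runs_Seq[OF r1 runs_Seq[OF r2 runs_Cond_False[OF _ 3(1)]]]) (use s2 False in simp)
        then show ?thesis using 3 False p M
          by (intro exI[of _ s3] exI[of _ "3 + (3 + (1 + exp_cost (Reg M) + t3))"])
            (auto simp: s2_def s1_def)
      qed
    qed
  qed
qed

text \<open>Register 0 holds the accumulator, \<open>M\<close> the rest of the list and
  \<open>Suc M\<close> the environment. As the empty list is encoded by \<open>Leaf\<close>, the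
  list register itself serves as the loop condition.\<close>

lemma runs_foldl_loop:
  assumes P: "computes P m u (\<lambda>(e, x, s). step e x s)" and M: "0 < M" "m \<le> M"
    and "s 0 = enc a" "s M = enc l" "s (Suc M) = enc e"
    and "\<And>i. i < length l \<Longrightarrow> u (e, l ! i, foldl (\<lambda>s x. step e x s) a (take i l)) \<le> B"
  shows "\<exists>s' t. runs (While (Reg M) (Seq (Assign 0 (NodeE (Reg (Suc M)) (NodeE (LeftE (Reg M)) (Reg 0))))
      (Seq P (Assign M (RightE (Reg M)))))) s s' t \<and> s' 0 = enc (foldl (\<lambda>s x. step e x s) a l)
      \<and> (\<forall>r\<ge>M + 2. s' r = s r) \<and> t \<le> (length l + 1) * (B + 15)"
  using assms(4-)
proof (induction l arbitrary: a s)
  case Nil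
  then show ?case
    by (intro exI[of _ s] exI[of _ "1 + exp_cost (Reg M)"]) (auto intro!: runs_While_False[of "Reg M", simplified])
next
  case (Cons x l)
  let ?C = "Seq (Assign 0 (NodeE (Reg (Suc M)) (NodeE (LeftE (Reg M)) (Reg 0)))) (Seq P (Assign M (RightE (Reg M))))"
  define s1 where "s1 = s(0 := Node (s (Suc M)) (Node (left (s M)) (s 0)))"
  have r1: "runs (Assign 0 (NodeE (Reg (Suc M)) (NodeE (LeftE (Reg M)) (Reg 0)))) s s1 7"
    by (intro runs_Assign) (auto simp: s1_def)
  have "s1 0 = enc (e, x, a)" using Cons.prems by (simp add: s1_def)
  then obtain s2 t2 where 2: "runs P s1 s2 t2" "s2 0 = enc (step e x a)"
    "\<And>r. r \<ge> m \<Longrightarrow> s2 r = s1 r" "t2 \<le> u (e, x, a)"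
    using computesE[OF P, of s1 "(e, x, a)"] by auto
  define s3 where "s3 = s2(M := right (s2 M))"
  have r3: "runs (Assign M (RightE (Reg M))) s2 s3 3"
    by (intro runs_Assign) (auto simp: s3_def)
  have body: "runs ?C s s3 (7 + (t2 + 3))"
    by (rule runs_Seq r1 2 r3)+
  have "\<exists>s' t. runs (While (Reg M) ?C) s3 s' t \<and> s' 0 = enc (foldl (\<lambda>s x. step e x s) (step e x a) l)
      \<and> (\<forall>r\<ge>M + 2. s' r = s3 r) \<and> t \<le> (length l + 1) * (B + 15)"
  proof (rule Cons.IH)
    show "s3 0 = enc (step e x a)" using 2 M by (simp add: s3_def)
    show "s3 M = enc l" using 2(3)[of M] M Cons.prems by (simp add: s3_def s1_def)
    show "s3 (Suc M) = enc e" using 2(3)[of "Suc M"] M Cons.prems by (simp add: s3_def s1_def)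
    show "u (e, l ! i, foldl (\<lambda>s x. step e x s) (step e x a) (take i l)) \<le> B" if "i < length l" for i
      using Cons.prems(4)[of "Suc i"] that by simp
  qed
  then obtain s' t where *: "runs (While (Reg M) ?C) s3 s' t"
    "s' 0 = enc (foldl (\<lambda>s x. step e x s) (step e x a) l)"
    "\<And>r. r\<ge>M + 2 \<Longrightarrow> s' r = s3 r" "t \<le> (length l + 1) * (B + 15)" by auto
  have "runs (While (Reg M) ?C) s s' (1 + exp_cost (Reg M) + (7 + (t2 + 3)) + t)"
    using Cons.prems(2) M by (intro runs_While_True[OF _ body *(1)]) simp
  moreover have "t2 \<le> B" using 2(4) Cons.prems(4)[of 0] by simp
  moreover have "s' r = s r" if "r \<ge> M + 2" for r
    using *(3)[OF that] 2(3)[of r] that M by (simp add: s3_def s1_def)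
  ultimately show ?case using * 
    by (intro exI[of _ s'] exI[of _ "1 + exp_cost (Reg M) + (7 + (t2 + 3)) + t"]) auto
qed

text \<open>Iterating a polynomial-time step can blow up the accumulator, so a polynomial bound on
  every intermediate accumulator is demanded; it makes all steps polynomial in the size of the
  environment alone.\<close>

lemma polytime_foldl_bounded:
  fixes init :: "'e::enc \<Rightarrow> 'b::enc" and xs :: "'e \<Rightarrow> 'a::enc list"
  assumes init: "polytime init" and xs: "polytime xs" and step: "polytime (\<lambda>(e, x, s). step e x s)"
    and bd: "polybounded v"
      "\<And>e i. i \<le> length (xs e) \<Longrightarrow> esz (foldl (\<lambda>s x. step e x s) (init e) (take i (xs e))) \<le> v e"
  shows "polytime (\<lambda>e. foldl (\<lambda>s x. step e x s) (init e) (xs e))"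
proof -
  obtain P m u where P: "computes P m u (\<lambda>(e, x, s). step e x s)" "polybounded u" "0 < m"
    using polytimeE[OF step] by metis
  have "polytime (\<lambda>e. (e, xs e, init e))"
    by (intro polytime_Pair polytime_id init xs)
  then obtain Q l w where Q: "computes Q l w (\<lambda>e. (e, xs e, init e))" "polybounded w"
    using polytimeE by metis
  define M where "M = max m l"
  have M: "m \<le> M" "l \<le> M" "0 < M" using P(3) by (auto simp: M_def)
  obtain c k where u: "\<And>x. u x \<le> c * esz x ^ k"
    using P(2) unfolding polybounded_def by blast
  define B where "B e = c * (esz e + (esz (xs e) + v e)) ^ k" for e
  have B: "polybounded B"
    unfolding B_def
    by (intro polybounded_mult polybounded_power polybounded_add polybounded_const polybounded_esz bd polytime_esz[OF xs])
  let ?L = "While (Reg M) (Seq (Assign 0 (NodeE (Reg (Suc M)) (NodeE (LeftE (Reg M)) (Reg 0))))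
      (Seq P (Assign M (RightE (Reg M)))))"
  let ?C = "Seq Q (Seq (Assign (Suc M) (LeftE (Reg 0))) (Seq (Assign M (LeftE (RightE (Reg 0))))
    (Seq (Assign 0 (RightE (RightE (Reg 0)))) ?L)))"
  let ?T = "\<lambda>e. w e + 20 + esz (xs e) * (B e + 15)"
  show ?thesis
  proof (rule polytimeI[of ?C "M + 2" ?T])
    show "polybounded (\<lambda>e. esz (foldl (\<lambda>s x. step e x s) (init e) (xs e)))"
      by (rule polybounded_mono[OF bd(1)]) (metis bd(2) order_refl take_all)
    show "polybounded ?T"
      by (intro polybounded_add polybounded_mult Q B polybounded_const polytime_esz[OF xs])
    show "computes ?C (M + 2) ?T (\<lambda>e. foldl (\<lambda>s x. step e x s) (init e) (xs e))"
      unfolding computes_def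
    proof (intro allI impI)
      fix s :: state and e :: 'e assume "s 0 = enc e"
      then obtain s1 t1 where 1: "runs Q s s1 t1" "s1 0 = enc (e, xs e, init e)"
        "\<And>r. r \<ge> l \<Longrightarrow> s1 r = s r" "t1 \<le> w e"
        using computesE[OF Q(1), of s e] by metis
      define s2 where "s2 = s1(Suc M := left (s1 0))"
      define s3 where "s3 = s2(M := left (right (s2 0)))"
      define s4 where "s4 = s3(0 := right (right (s3 0)))"
      have r2: "runs (Assign (Suc M) (LeftE (Reg 0))) s1 s2 3"
        by (intro runs_Assign) (auto simp: s2_def)
      have r3: "runs (Assign M (LeftE (RightE (Reg 0)))) s2 s3 4"
        by (intro runs_Assign) (auto simp: s3_def)
      have r4: "runs (Assign 0 (RightE (RightE (Reg 0)))) s3 s4 4"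
        by (intro runs_Assign) (auto simp: s4_def)
      have "\<exists>s' t. runs ?L s4 s' t \<and> s' 0 = enc (foldl (\<lambda>s x. step e x s) (init e) (xs e))
         \<and> (\<forall>r\<ge>M + 2. s' r = s4 r) \<and> t \<le> (length (xs e) + 1) * (B e + 15)"
      proof (rule runs_foldl_loop[OF P(1) M(3,1)])
        show "s4 0 = enc (init e)" "s4 M = enc (xs e)" "s4 (Suc M) = enc e"
          using 1(2) M by (auto simp: s4_def s3_def s2_def)
        fix i assume i: "i < length (xs e)"
        let ?a = "foldl (\<lambda>s x. step e x s) (init e) (take i (xs e))"
        have "esz (e, xs e ! i, ?a) \<le> esz e + (esz (xs e) + v e)"
          using bd(2)[of i e] i esz_mem[of "xs e ! i" "xs e"] by simp
        then have "esz (e, xs e ! i, ?a) ^ k \<le> (esz e + (esz (xs e) + v e)) ^ k"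
          by (rule power_mono) simp
        then have "c * esz (e, xs e ! i, ?a) ^ k \<le> B e"
          unfolding B_def by (rule mult_le_mono2)
        then show "u (e, xs e ! i, ?a) \<le> B e"
          using u[of "(e, xs e ! i, ?a)"] by linarith
      qed
      then obtain s5 t5 where 5: "runs ?L s4 s5 t5" "s5 0 = enc (foldl (\<lambda>s x. step e x s) (init e) (xs e))"
        "\<And>r. r\<ge>M + 2 \<Longrightarrow> s5 r = s4 r" "t5 \<le> (length (xs e) + 1) * (B e + 15)"
        by auto
      have "runs ?C s s5 (t1 + (3 + (4 + (4 + t5))))"
        by (rule runs_Seq 1 r2 r3 r4 5)+
      moreover have "s5 r = s r" if "r \<ge> M + 2" for r
        using that M 5(3)[of r] 1(3)[of r] by (simp add: s4_def s3_def s2_def)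
      moreover have "t5 \<le> esz (xs e) * (B e + 15)"
        by (rule order_trans[OF 5(4)], rule mult_le_mono1) (use length_le_esz[of "xs e"] in linarith)
      ultimately show "\<exists>s' t. runs ?C s s' t \<and> s' 0 = enc (foldl (\<lambda>s x. step e x s) (init e) (xs e))
         \<and> (\<forall>r\<ge>M + 2. s' r = s r) \<and> t \<le> ?T e"
        using 1(4) 5(2) by (intro exI[of _ s5] exI[of _ "t1 + (3 + (4 + (4 + t5)))"]) auto
    qed
  qed
qed

section \<open>Closure properties of polynomial-time functions\<close>

named_theorems polytime_intros

text \<open>If each step adds an amount that depends on the environment and the list element only,
  growth is additive and the accumulator stays polynomial throughout.\<close>

lemma polytime_foldl:
  fixes init :: "'e::enc \<Rightarrow> 'b::enc" and xs :: "'e \<Rightarrow> 'a::enc list"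
  assumes init: "polytime init" and xs: "polytime xs"
    and step: "polytime (\<lambda>p. step (fst p) (fst (snd p)) (snd (snd p)))"
    and w: "polybounded w" "\<And>e x s. x \<in> set (xs e) \<Longrightarrow> esz (step e x s) \<le> esz s + w (e, x)"
  shows "polytime (\<lambda>e. foldl (\<lambda>s x. step e x s) (init e) (xs e))"
proof -
  obtain c k where c: "\<And>x. w x \<le> c * esz x ^ k"
    using w(1) unfolding polybounded_def by blast
  define v where "v e = esz (init e) + esz (xs e) * (c * (esz e + esz (xs e)) ^ k)" for e
  show ?thesis
  proof (rule polytime_foldl_bounded)
    show "polytime (\<lambda>(e, x, s). step e x s)"
      using step by (simp add: case_prod_beta')
    show "polybounded v"
      unfolding v_def by (intro polybounded_add polybounded_mult polybounded_power polybounded_const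
          polybounded_esz polytime_esz[OF init] polytime_esz[OF xs])
    fix e i
    have *: "esz (foldl (\<lambda>s x. step e x s) a ys) \<le> esz a + length ys * (c * (esz e + esz (xs e)) ^ k)"
      if "set ys \<subseteq> set (xs e)" for ys a
      using that
    proof (induction ys arbitrary: a)
      case (Cons y ys)
      have "w (e, y) \<le> c * (esz e + esz (xs e)) ^ k"
        using c[of "(e, y)"] esz_mem[of y "xs e"] Cons.prems
          mult_le_mono2[OF power_mono[of "esz e + esz y" "esz e + esz (xs e)" k], of c]
        by (auto simp del: mult_le_cancel1 mult_le_cancel2 intro: order_trans)
      then have "esz (step e y a) \<le> esz a + c * (esz e + esz (xs e)) ^ k"
        using w(2)[of y e a] Cons.prems by auto
      then show ?case using Cons.IH[of "step e y a"] Cons.prems by auto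
    qed simp
    assume i: "i \<le> length (xs e)"
    have "length (take i (xs e)) * (c * (esz e + esz (xs e)) ^ k) \<le> esz (xs e) * (c * (esz e + esz (xs e)) ^ k)"
      by (rule mult_le_mono1) (use length_le_esz[of "xs e"] in simp)
    then show "esz (foldl (\<lambda>s x. step e x s) (init e) (take i (xs e))) \<le> v e"
      using *[of "take i (xs e)" "init e"] set_take_subset[of i "xs e"] unfolding v_def by linarith
  qed (use init xs in auto)
qed

lemma foldl_True: "foldl (\<lambda>s x. True) b ys = (ys \<noteq> [] \<or> b)"
  by (induction ys arbitrary: b) auto

lemma foldl_Cons_rev: "foldl (\<lambda>s x. x # s) zs ys = rev ys @ zs"
  by (induction ys arbitrary: zs) auto

lemma foldl_map: "foldl (\<lambda>s x. g x # s) zs ys = rev (map g ys) @ zs"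
  by (induction ys arbitrary: zs) auto

lemma foldl_filter: "foldl (\<lambda>s x. if g x then x # s else s) zs ys = rev (filter g ys) @ zs"
  by (induction ys arbitrary: zs) auto

lemma foldl_Suc: "foldl (\<lambda>s x. Suc s) n ys = n + length ys"
  by (induction ys arbitrary: n) auto

lemma foldl_tl: "foldl (\<lambda>s x. tl s) xs ys = drop (length ys) xs"
  by (induction ys arbitrary: xs) (auto simp: drop_Suc)

declare polytime_const [polytime_intros] polytime_id [polytime_intros] polytime_Pair [polytime_intros]

lemma polytime_comp_fst:
  "polytime f \<Longrightarrow> polytime (\<lambda>p. f (fst p))"
  by (rule polytime_comp[OF _ polytime_fst_prim])

lemma polytime_fst [polytime_intros]: "polytime f \<Longrightarrow> polytime (\<lambda>x. fst (f x))"
  by (rule polytime_comp[OF polytime_fst_prim])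

lemma polytime_snd [polytime_intros]: "polytime f \<Longrightarrow> polytime (\<lambda>x. snd (f x))"
  by (rule polytime_comp[OF polytime_snd_prim])

lemma polytime_Cons [polytime_intros]:
  "polytime f \<Longrightarrow> polytime g \<Longrightarrow> polytime (\<lambda>x. f x # g x)"
  using polytime_comp[OF polytime_Cons_prim polytime_Pair] by simp

lemma polytime_Suc [polytime_intros]: "polytime f \<Longrightarrow> polytime (\<lambda>x. Suc (f x))"
  by (rule polytime_comp[OF polytime_Suc_prim])

lemma polytime_pred: "polytime f \<Longrightarrow> polytime (\<lambda>x. f x - (1::nat))"
  by (rule polytime_comp[OF polytime_pred_prim])

lemma polytime_if [polytime_intros]:
  "polytime b \<Longrightarrow> polytime f \<Longrightarrow> polytime g \<Longrightarrow> polytime (\<lambda>x. if b x then f x else g x)"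
  using polytime_comp[OF polytime_if_prim[of f g], of "\<lambda>x. (b x, x)"] by (simp add: polytime_Pair cong: if_cong)

lemma polytime_not [polytime_intros]:
  assumes "polytime b"
  shows "polytime (\<lambda>x. \<not> b x)"
proof -
  have "(\<lambda>x. \<not> b x) = (\<lambda>x. if b x then False else True)" by auto
  then show ?thesis using assms by (simp only: polytime_if polytime_const)
qed

lemma polytime_conj [polytime_intros]:
  assumes "polytime a" "polytime b"
  shows "polytime (\<lambda>x. a x \<and> b x)"
proof -
  have "(\<lambda>x. a x \<and> b x) = (\<lambda>x. if a x then b x else False)" by auto
  then show ?thesis using assms by (simp only: polytime_if polytime_const)
qed

lemma polytime_disj [polytime_intros]:
  assumes "polytime a" "polytime b"
  shows "polytime (\<lambda>x. a x \<or> b x)"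
proof -
  have "(\<lambda>x. a x \<or> b x) = (\<lambda>x. if a x then True else b x)" by auto
  then show ?thesis using assms by (simp only: polytime_if polytime_const)
qed

lemma polytime_eq_bool [polytime_intros]:
  "polytime a \<Longrightarrow> polytime b \<Longrightarrow> polytime (\<lambda>x. a x = (b x :: bool))"
proof -
  assume "polytime a" "polytime b"
  then have "polytime (\<lambda>x. if a x then b x else \<not> b x)"
    by (intro polytime_intros)
  moreover have "(\<lambda>x. if a x then b x else \<not> b x) = (\<lambda>x. a x = b x)" by auto
  ultimately show ?thesis by simp
qed

lemma polytime_nonempty [polytime_intros]:
  assumes "polytime xs"
  shows "polytime (\<lambda>e. xs e \<noteq> [])"
proof -
  have "polytime (\<lambda>e. foldl (\<lambda>s x. True) False (xs e))"
    by (rule polytime_foldl[where w = "\<lambda>_. 1"]) (auto intro: assms)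
  then show ?thesis by (simp add: foldl_True)
qed

lemma polytime_rev [polytime_intros]:
  assumes "polytime xs"
  shows "polytime (\<lambda>e. rev (xs e))"
proof -
  have "polytime (\<lambda>e. foldl (\<lambda>s x. x # s) [] (xs e))"
    by (rule polytime_foldl[where w = "\<lambda>p. esz (snd p)"]) (auto intro!: assms polytime_intros polytime_esz)
  then show ?thesis by (simp add: foldl_Cons_rev)
qed

lemma polytime_append [polytime_intros]:
  assumes "polytime xs" "polytime ys"
  shows "polytime (\<lambda>e. xs e @ ys e)"
proof -
  have "polytime (\<lambda>e. foldl (\<lambda>s x. x # s) (ys e) (rev (xs e)))"
    by (rule polytime_foldl[where w = "\<lambda>p. esz (snd p)"]) (auto intro!: assms polytime_intros polytime_esz)
  then show ?thesis by (simp add: foldl_Cons_rev)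
qed

definition hd_or :: "'a \<Rightarrow> 'a list \<Rightarrow> 'a" where
  "hd_or d xs = (case xs of [] \<Rightarrow> d | x # _ \<Rightarrow> x)"

lemma hd_or_simps [simp]: "hd_or d [] = d" "hd_or d (x # xs) = x"
  by (simp_all add: hd_or_def)

lemma foldl_hd_or: "foldl (\<lambda>s x. x) d (rev ys) = hd_or d ys"
  by (induction ys) auto

lemma polytime_hd_or [polytime_intros]:
  assumes "polytime d" "polytime xs"
  shows "polytime (\<lambda>e. hd_or (d e) (xs e))"
proof -
  have "polytime (\<lambda>e. foldl (\<lambda>s x. x) (d e) (rev (xs e)))"
    by (rule polytime_foldl[where w = "\<lambda>p. esz (snd p)"]) (auto intro!: assms polytime_intros polytime_esz)
  then show ?thesis by (simp add: foldl_hd_or)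
qed

lemma polytime_tl [polytime_intros]:
  assumes "polytime xs"
  shows "polytime (\<lambda>e. tl (xs e))"
proof (rule polytime_comp[OF _ assms], rule polytime_exp[where e = "RightE (Reg 0)"])
  show "eval_exp (RightE (Reg 0)) s = enc (tl x)" if "s 0 = enc x" for s and x :: "'b list"
    using that by (cases x) auto
  show "polybounded (\<lambda>x :: 'b list. esz (tl x))"
  proof (rule polybounded_mono[OF polybounded_esz])
    show "esz (tl x) \<le> esz x" for x :: "'b list" by (cases x) auto
  qed
qed

lemma polytime_map [polytime_intros]:
  assumes "polytime xs" "polytime (\<lambda>p. f (fst p) (snd p))"
  shows "polytime (\<lambda>e. map (f e) (xs e))"
proof -
  have "polytime (\<lambda>e. rev (foldl (\<lambda>s x. f e x # s) [] (xs e)))"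
    using polytime_esz[OF assms(2)]
    by (intro polytime_rev polytime_foldl[where w = "\<lambda>p. esz (f (fst p) (snd p))"])
      (auto intro!: assms(1) polytime_comp[OF assms(2), of "\<lambda>p. (fst p, fst (snd p))", simplified] polytime_intros)
  then show ?thesis by (simp add: foldl_map)
qed

lemma polytime_filter [polytime_intros]:
  assumes "polytime xs" "polytime (\<lambda>p. f (fst p) (snd p))"
  shows "polytime (\<lambda>e. filter (f e) (xs e))"
proof -
  have "polytime (\<lambda>e. rev (foldl (\<lambda>s x. if f e x then x # s else s) [] (xs e)))"
    by (intro polytime_rev polytime_foldl[where w = "\<lambda>p. esz (snd p)"])
      (auto intro!: assms(1) polytime_comp[OF assms(2), of "\<lambda>p. (fst p, fst (snd p))", simplified] polytime_intros
        polytime_esz)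
  then show ?thesis by (simp add: foldl_filter)
qed

lemma polytime_Bex [polytime_intros]:
  assumes "polytime xs" "polytime (\<lambda>p. f (fst p) (snd p))"
  shows "polytime (\<lambda>e. \<exists>x\<in>set (xs e). f e x)"
proof -
  have "polytime (\<lambda>e. filter (f e) (xs e) \<noteq> [])"
    by (intro polytime_intros assms)
  then show ?thesis by (simp add: filter_empty_conv)
qed

lemma polytime_Ball [polytime_intros]:
  assumes "polytime xs" "polytime (\<lambda>p. f (fst p) (snd p))"
  shows "polytime (\<lambda>e. \<forall>x\<in>set (xs e). f e x)"
proof -
  have "polytime (\<lambda>e. \<not> (\<exists>x\<in>set (xs e). \<not> f e x))"
    by (intro polytime_intros assms)
  then show ?thesis by simp
qed

lemma polytime_length [polytime_intros]:
  assumes "polytime xs"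
  shows "polytime (\<lambda>e. length (xs e))"
proof -
  have "polytime (\<lambda>e. foldl (\<lambda>s x. Suc s) 0 (xs e))"
    by (rule polytime_foldl[where w = "\<lambda>_. 1"]) (auto intro!: assms polytime_intros)
  then show ?thesis by (simp add: foldl_Suc)
qed

text \<open>A unary number and a list of that many \<open>False\<close> have the same tree, so the
  identity program converts one into the other, and folds over such lists are loops over a
  number.\<close>

lemma polytime_units:
  assumes "polytime f"
  shows "polytime (\<lambda>e. replicate (f e) False)"
proof (rule polytime_comp[OF _ assms], rule polytime_exp[where e = "Reg 0"])
  have eq [simp]: "enc (replicate n False) = enc n" for n by (induction n) auto
  have "esz (replicate n False) = esz n" for n by (simp only: esz_def eq)
  show "eval_exp (Reg 0) s = enc (replicate x False)" if "s 0 = enc x" for s x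
    using that by simp
  show "polybounded (\<lambda>x. esz (replicate x False))"
    using polybounded_esz by (simp only: \<open>\<And>n. esz (replicate n False) = esz n\<close>)
qed

lemma polytime_nat_eq_0 [polytime_intros]:
  "polytime f \<Longrightarrow> polytime (\<lambda>e. f e = (0::nat))"
  using polytime_not[OF polytime_nonempty[OF polytime_units]] by simp

lemma polytime_add [polytime_intros]:
  assumes "polytime f" "polytime g"
  shows "polytime (\<lambda>e. f e + (g e :: nat))"
proof -
  have "polytime (\<lambda>e. foldl (\<lambda>s x. Suc s) (f e) (replicate (g e) False))"
    by (rule polytime_foldl[where w = "\<lambda>_. 1"]) (auto intro!: assms polytime_intros polytime_units)
  then show ?thesis by (simp add: foldl_Suc)
qed

lemma polytime_diff [polytime_intros]:
  assumes "polytime f" "polytime g"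
  shows "polytime (\<lambda>e. f e - (g e :: nat))"
proof -
  have "polytime (\<lambda>e. foldl (\<lambda>s x. s - 1) (f e) (replicate (g e) False))"
    by (rule polytime_foldl[where w = "\<lambda>_. 1"]) (auto intro!: assms polytime_intros polytime_units polytime_pred simp del: One_nat_def)
  moreover have "foldl (\<lambda>s x. s - Suc 0) n ys = n - length ys" for n and ys :: "bool list"
    by (induction ys arbitrary: n) auto
  ultimately show ?thesis by simp
qed

lemma polytime_eq_nat [polytime_intros]:
  assumes "polytime f" "polytime g"
  shows "polytime (\<lambda>e. f e = (g e :: nat))"
proof -
  have "polytime (\<lambda>e. f e - g e = 0 \<and> g e - f e = 0)"
    by (intro polytime_intros assms)
  moreover have "(\<lambda>e. f e - g e = 0 \<and> g e - f e = 0) = (\<lambda>e. f e = g e)" by auto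
  ultimately show ?thesis by simp
qed

lemma polytime_less_nat [polytime_intros]:
  assumes "polytime f" "polytime g"
  shows "polytime (\<lambda>e. f e < (g e :: nat))"
proof -
  have "polytime (\<lambda>e. \<not> (g e - f e = 0))"
    by (intro polytime_intros assms)
  then show ?thesis by (simp add: not_le)
qed

lemma polytime_max_nat [polytime_intros]:
  assumes "polytime f" "polytime g"
  shows "polytime (\<lambda>e. max (f e) (g e :: nat))"
proof -
  have "polytime (\<lambda>e. f e + (g e - f e))"
    by (intro polytime_intros assms)
  moreover have "(\<lambda>e. f e + (g e - f e)) = (\<lambda>e. max (f e) (g e))" by auto
  ultimately show ?thesis by simp
qed

lemma polytime_eq_lit [polytime_intros]:
  assumes "polytime f" "polytime g"
  shows "polytime (\<lambda>e. f e = (g e :: nat \<times> bool))"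
proof -
  have "polytime (\<lambda>e. fst (f e) = fst (g e) \<and> snd (f e) = snd (g e))"
    by (intro polytime_intros assms)
  then show ?thesis by (simp add: prod_eq_iff)
qed

lemma polytime_mem_nat [polytime_intros]:
  assumes "polytime f" "polytime xs"
  shows "polytime (\<lambda>e. (f e :: nat) \<in> set (xs e))"
proof -
  have "polytime (\<lambda>e. \<exists>x\<in>set (xs e). f e = x)"
    by (intro polytime_intros assms polytime_comp_fst[OF assms(1)])
  then show ?thesis by simp
qed

lemma polytime_mem_lit [polytime_intros]:
  assumes "polytime f" "polytime xs"
  shows "polytime (\<lambda>e. (f e :: nat \<times> bool) \<in> set (xs e))"
proof -
  have "polytime (\<lambda>e. \<exists>x\<in>set (xs e). f e = x)"
    by (intro polytime_intros assms polytime_comp_fst[OF assms(1)])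
  then show ?thesis by simp
qed

lemma polytime_upt [polytime_intros]:
  assumes "polytime f"
  shows "polytime (\<lambda>e. [0..<f e])"
proof -
  have eq: "foldl (\<lambda>s x. s @ [length s]) [] ys = [0..<length ys]" for ys :: "bool list"
    by (induction ys rule: rev_induct) auto
  \<comment> \<open>The appended number depends on the accumulator, so growth is not additive in the
    sense of \<open>polytime_foldl\<close>; the prefixes of the result are bounded directly.\<close>
  have "polytime (\<lambda>e. foldl (\<lambda>s x. s @ [length s]) [] (replicate (f e) False))"
  proof (rule polytime_foldl_bounded[where v = "\<lambda>e. 1 + esz (f e) * esz (f e)"])
    show "polybounded (\<lambda>e. 1 + esz (f e) * esz (f e))"
      by (intro polybounded_add polybounded_mult polytime_esz[OF assms] polybounded_const)
    fix e i assume "i \<le> length (replicate (f e) False)"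
    then have "esz [0..<i] \<le> 1 + length [0..<i] * esz (f e)"
      by (intro esz_list_le) auto
    also have "\<dots> \<le> 1 + esz (f e) * esz (f e)"
      using \<open>i \<le> _\<close> by (intro add_left_mono mult_le_mono1) auto
    finally show "esz (foldl (\<lambda>s x. s @ [length s]) [] (take i (replicate (f e) False))) \<le> 1 + esz (f e) * esz (f e)"
      using \<open>i \<le> _\<close> by (simp add: eq)
  qed (auto intro!: polytime_intros polytime_units assms simp: case_prod_beta')
  then show ?thesis by (simp add: eq)
qed

lemma polytime_drop [polytime_intros]:
  assumes "polytime f" "polytime xs"
  shows "polytime (\<lambda>e. drop (f e) (xs e))"
proof -
  have "polytime (\<lambda>e. foldl (\<lambda>s x. tl s) (xs e) (replicate (f e) False))"
  proof (rule polytime_foldl[where w = "\<lambda>_. 1"])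
    show "esz (tl s) \<le> esz s + 1" for s :: "'b list" by (cases s) auto
  qed (auto intro!: assms polytime_intros polytime_units)
  then show ?thesis by (simp add: foldl_tl)
qed

lemma polytime_mult [polytime_intros]:
  assumes "polytime f" "polytime g"
  shows "polytime (\<lambda>e. f e * (g e :: nat))"
proof -
  have "polytime (\<lambda>e. foldl (\<lambda>s x. s + f e) 0 (replicate (g e) False))"
  proof (rule polytime_foldl[where w = "\<lambda>p. esz (f (fst p))"])
    show "polybounded (\<lambda>p. esz (f (fst p)))"
      by (intro polytime_esz polytime_comp_fst assms)
  qed (auto intro!: assms polytime_intros polytime_units polytime_comp_fst)
  moreover have "foldl (\<lambda>s x. s + m) n ys = n + m * length ys" for n m and ys :: "bool list"
    by (induction ys arbitrary: n) auto
  ultimately show ?thesis by simp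
qed

lemma polytime_div_const [polytime_intros]:
  assumes "polytime f" "0 < v"
  shows "polytime (\<lambda>e. f e div (v::nat))"
proof -
  have eq: "foldl (\<lambda>s x. if Suc (snd s) = v then (Suc (fst s), 0) else (fst s, Suc (snd s))) (0, 0) ys
      = (length ys div v, length ys mod v)" for ys :: "bool list"
    using assms(2) by (induction ys rule: rev_induct) (auto simp: div_Suc mod_Suc)
  have "polytime (\<lambda>e. fst (foldl (\<lambda>s x. if Suc (snd s) = v then (Suc (fst s), 0) else (fst s, Suc (snd s))) (0, 0)
      (replicate (f e) False)))"
    by (rule polytime_fst, rule polytime_foldl[where w = "\<lambda>_. 1"])
      (auto intro!: assms polytime_intros polytime_units)
  then show ?thesis by (simp add: eq)
qed

lemma polytime_eq_const_word [polytime_intros]: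
  assumes "polytime f"
  shows "polytime (\<lambda>e. f e = (w :: bool list))"
  using assms
proof (induction w arbitrary: f)
  case Nil
  then show ?case using polytime_not[OF polytime_nonempty] by simp
next
  case (Cons b w)
  have "polytime (\<lambda>e. f e \<noteq> [] \<and> hd_or False (f e) = b \<and> tl (f e) = w)"
    by (intro polytime_intros Cons)
  moreover have "(\<lambda>e. f e \<noteq> [] \<and> hd_or False (f e) = b \<and> tl (f e) = w) = (\<lambda>e. f e = b # w)"
  proof
    show "(f e \<noteq> [] \<and> hd_or False (f e) = b \<and> tl (f e) = w) = (f e = b # w)" for e
      by (cases "f e") auto
  qed
  ultimately show ?case by simp
qed

lemma polytime_take_const [polytime_intros]:
  assumes "polytime f"
  shows "polytime (\<lambda>e. take k (f e :: bool list))"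
  using assms
proof (induction k arbitrary: f)
  case (Suc k)
  have "polytime (\<lambda>e. if f e \<noteq> [] then hd_or False (f e) # take k (tl (f e)) else [])"
    by (intro polytime_intros Suc)
  moreover have "(\<lambda>e. if f e \<noteq> [] then hd_or False (f e) # take k (tl (f e)) else []) = (\<lambda>e. take (Suc k) (f e))"
  proof
    show "(if f e \<noteq> [] then hd_or False (f e) # take k (tl (f e)) else []) = take (Suc k) (f e)" for e
      by (cases "f e") auto
  qed
  ultimately show ?case by simp
qed simp

section \<open>The algorithm\<close>

definition neg :: "nat \<times> bool \<Rightarrow> nat \<times> bool" where
  "neg l = (fst l, \<not> snd l)"

text \<open>A bounded substitute for implication: each level picks a clause and assumes in turn each
  of its literals that is not yet falsified. For a fixed depth this is a nested quantification over
  clauses, hence polynomial, and it can follow a critical clause tree from the root.\<close>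

primrec refutes :: "nat \<Rightarrow> (nat \<times> bool) list list \<Rightarrow> (nat \<times> bool) list \<Rightarrow> bool" where
  "refutes 0 cls \<beta> = (\<exists>c\<in>set cls. \<forall>l\<in>set c. neg l \<in> set \<beta>)"
| "refutes (Suc d) cls \<beta> = (\<exists>c\<in>set cls. \<forall>l\<in>set c. neg l \<in> set \<beta> \<or> refutes d cls (l # \<beta>))"

text \<open>The input does not state the number of variables; since every position occurs in some
  clause, the largest one determines it.\<close>

definition num_vars :: "(nat \<times> bool) list list \<Rightarrow> nat" where
  "num_vars cls = foldl max 0 (map (\<lambda>c. foldl max 0 (map (\<lambda>l. Suc (fst l)) c)) cls)"

text \<open>A variable, its time in \<open>[0, 1)\<close> as a binary fraction, and its guess word: a fair value followed
  by bits that are only used as a biased coin.\<close>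

type_synonym entry = "nat \<times> bool list \<times> bool list"

definition entries :: "nat \<Rightarrow> bool list list \<Rightarrow> bool list list \<Rightarrow> entry list" where
  "entries n ts gs = map (\<lambda>i. (i, hd_or [] (drop i ts), hd_or [] (drop i gs))) [0..<n]"

text \<open>With p = 2^-a, the leading bits of a time place it into A = [0, p), B = [p, 2p), B' =
  [p, p + p^2) or C = [2p, 1).\<close>

definition in_A :: "nat \<Rightarrow> bool list \<Rightarrow> bool" where
  "in_A a w \<longleftrightarrow> take a w = replicate a False"

definition in_B :: "nat \<Rightarrow> bool list \<Rightarrow> bool" where
  "in_B a w \<longleftrightarrow> take a w = replicate (a - 1) False @ [True]"

definition in_B' :: "nat \<Rightarrow> bool list \<Rightarrow> bool" where
  "in_B' a w \<longleftrightarrow> take (2 * a) w = replicate (a - 1) False @ [True] @ replicate a False"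

definition in_C :: "nat \<Rightarrow> bool list \<Rightarrow> bool" where
  "in_C a w \<longleftrightarrow> \<not> in_A a w \<and> \<not> in_B a w"

definition coin :: "bool list \<Rightarrow> bool" where "coin = hd_or False"

definition A_lits :: "nat \<Rightarrow> entry list \<Rightarrow> (nat \<times> bool) list" where
  "A_lits a es = map (\<lambda>en. (fst en, coin (snd (snd en)))) (filter (\<lambda>en. in_A a (fst (snd en))) es)"

definition C_vars :: "nat \<Rightarrow> entry list \<Rightarrow> nat list" where
  "C_vars a es = map fst (filter (\<lambda>en. in_C a (fst (snd en))) es)"

text \<open>The clauses that the guesses on group \<open>A\<close> shorten to \<open>l\<close> and one literal over group \<open>C\<close>. Clauses of size
  two are only taken into account on the subgroup \<open>B'\<close> of \<open>B\<close>: a larger probability to vote would make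
  the second-order loss of the bias exceed its gain.\<close>

definition votes :: "(nat \<times> bool) list list \<Rightarrow> (nat \<times> bool) list \<Rightarrow> nat list \<Rightarrow> bool \<Rightarrow> nat \<times> bool
    \<Rightarrow> (nat \<times> bool) list list" where
  "votes cls \<alpha>s Cs short l = filter (\<lambda>c. l \<in> set c \<and> length (filter (\<lambda>l. fst l \<in> set Cs) c) = 1 \<and>
     (length c = 3 \<and> length (filter (\<lambda>l. neg l \<in> set \<alpha>s) c) = 1 \<or> length c = 2 \<and> short)) cls"

text \<open>With a random word the result is \<open>q < p\<close> with probability \<open>(1 + k / 2 ^ J) / 2\<close>, where \<open>k\<close> is the distance
  of \<open>p\<close> and \<open>q\<close>, truncated to \<open>2\<close>.\<close>

definition biased :: "nat \<Rightarrow> nat \<Rightarrow> nat \<Rightarrow> bool list \<Rightarrow> bool" where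
  "biased J p q w = (if p = q then coin w
     else if p = Suc q \<or> q = Suc p then (if tl w = replicate J True then q < p else coin w)
     else (if take (J - 1) (tl w) = replicate (J - 1) True then q < p else coin w))"

definition B_lits :: "nat \<Rightarrow> nat \<Rightarrow> (nat \<times> bool) list list \<Rightarrow> entry list \<Rightarrow> (nat \<times> bool) list" where
  "B_lits a J cls es = map (\<lambda>en. (fst en, biased J
       (length (votes cls (A_lits a es) (C_vars a es) (in_B' a (fst (snd en))) (fst en, True)))
       (length (votes cls (A_lits a es) (C_vars a es) (in_B' a (fst (snd en))) (fst en, False)))
       (snd (snd en)))) (filter (\<lambda>en. in_B a (fst (snd en))) es)"

definition ppsz_step :: "nat \<Rightarrow> (nat \<times> bool) list list \<Rightarrow> (nat \<times> bool) list \<Rightarrow> entry \<Rightarrow> (nat \<times> bool) list" where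
  "ppsz_step D cls \<beta> en = (fst en,
     if refutes D cls ((fst en, False) # \<beta>) then True
     else if refutes D cls ((fst en, True) # \<beta>) then False
     else coin (snd (snd en))) # \<beta>"

primrec words :: "nat \<Rightarrow> bool list list" where
  "words 0 = [[]]"
| "words (Suc k) = map ((#) False) (words k) @ map ((#) True) (words k)"

text \<open>Going through all \<open>words K\<close> in increasing order sorts the entries by time.
  As \<open>K\<close> is a constant, this list is part of the program and no sorting routine is
  needed; equal times keep the order of the positions.\<close>

definition C_order :: "nat \<Rightarrow> bool list list \<Rightarrow> entry list \<Rightarrow> entry list" where
  "C_order a ws es = concat (map (\<lambda>w. filter (\<lambda>en. in_C a (fst (snd en)) \<and> fst (snd en) = w) es) ws)"

definition ppsz :: "nat \<Rightarrow> nat \<Rightarrow> nat \<Rightarrow> nat \<Rightarrow> (nat \<times> bool) list list \<Rightarrow> entry list \<Rightarrow> (nat \<times> bool) list" where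
  "ppsz a J K D cls es = foldl (\<lambda>\<beta> en. ppsz_step D cls \<beta> en) (A_lits a es @ B_lits a J cls es)
     (C_order a (words K) es)"

text \<open>A linear equation over the field with two elements is given by the list of its variables; the index \<open>n\<close>
  stands for the constant 1.\<close>

definition xor_row :: "nat \<Rightarrow> nat list \<Rightarrow> nat list \<Rightarrow> nat list" where
  "xor_row n r q = filter (\<lambda>i. (i \<in> set r) \<noteq> (i \<in> set q)) [0..<Suc n]"

text \<open>A negative literal is 1 plus its variable. The initial constant 1 makes the sum of the
  row vanish exactly if an odd number of literals is true.\<close>

definition row_of_clause :: "nat \<Rightarrow> (nat \<times> bool) list \<Rightarrow> nat list" where
  "row_of_clause n c = foldl (\<lambda>r l. xor_row n r (if snd l then [fst l] else [fst l, n])) [n] c"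

definition pivot :: "nat \<Rightarrow> nat list list \<Rightarrow> nat list" where
  "pivot j R = hd_or [] (filter (\<lambda>q. j \<in> set q) R)"

definition elim_row :: "nat \<Rightarrow> nat \<Rightarrow> nat list \<Rightarrow> nat list \<Rightarrow> nat list" where
  "elim_row n j r q = (if j \<in> set q then xor_row n q r else q)"

text \<open>Gauss-Jordan elimination: the column is cleared from the finished rows as well. The
  pivot row turns its own copy among the remaining rows into the empty row, so it does not have to
  be deleted.\<close>

definition gauss_step :: "nat \<Rightarrow> nat list list \<times> nat list list \<Rightarrow> nat \<Rightarrow> nat list list \<times> nat list list" where
  "gauss_step n s j = (map (\<lambda>q. elim_row n j (pivot j (snd s)) q) (fst s) @ [pivot j (snd s)],
     map (\<lambda>q. elim_row n j (pivot j (snd s)) q) (snd s))"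

definition gauss :: "nat \<Rightarrow> nat list list \<Rightarrow> nat list list" where
  "gauss n R = fst (foldl (\<lambda>s j. gauss_step n s j) ([], R) [0..<n])"

text \<open>Three control bits select a variable with probability 1/8, so a given variable is
  guessed rightly with probability 1/16 and wrongly with probability 1/16.\<close>

definition guessed :: "entry list \<Rightarrow> (nat \<times> bool) list" where
  "guessed es = map (\<lambda>en. (fst en, coin (snd (snd en))))
     (filter (\<lambda>en. take 3 (tl (snd (snd en))) = [True, True, True]) es)"

definition system :: "nat \<Rightarrow> (nat \<times> bool) list list \<Rightarrow> (nat \<times> bool) list \<Rightarrow> nat list list" where
  "system n cls H = map (\<lambda>c. row_of_clause n c)
     (map (\<lambda>l. [l]) H @ filter (\<lambda>c. \<not> (\<exists>l\<in>set c. l \<in> set H)) cls)"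

definition linear_candidate :: "nat \<Rightarrow> (nat \<times> bool) list list \<Rightarrow> entry list \<Rightarrow> nat list" where
  "linear_candidate n cls es =
     filter (\<lambda>i. n \<in> set (hd_or [] (drop i (gauss n (system n cls (guessed es)))))) [0..<n]"

definition ppsz_candidate :: "nat \<Rightarrow> nat \<Rightarrow> nat \<Rightarrow> nat \<Rightarrow> nat \<Rightarrow> (nat \<times> bool) list list \<Rightarrow> entry list \<Rightarrow> nat list" where
  "ppsz_candidate a J K D n cls es = filter (\<lambda>i. (i, True) \<in> set (ppsz a J K D cls es)) [0..<n]"

definition verifies :: "(nat \<times> bool) list list \<Rightarrow> nat list \<Rightarrow> bool" where
  "verifies cls S \<longleftrightarrow> (\<forall>c\<in>set cls. \<exists>l\<in>set c. (fst l \<in> set S) = snd l)"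

definition characteristic :: "nat \<Rightarrow> nat list \<Rightarrow> bool list" where
  "characteristic n S = map (\<lambda>i. i \<in> set S) [0..<n]"

text \<open>A failed round returns the previous output, and a verified candidate is the unique
  solution; hence a solution once found survives all later rounds.\<close>

definition attempt :: "nat \<Rightarrow> nat \<Rightarrow> nat \<Rightarrow> nat \<Rightarrow> (nat \<times> bool) list list \<Rightarrow> bool list list \<Rightarrow> bool list list
    \<Rightarrow> bool list \<Rightarrow> bool list" where
  "attempt a J K D cls ts gs out =
     (if verifies cls (ppsz_candidate a J K D (num_vars cls) cls (entries (num_vars cls) ts gs))
      then characteristic (num_vars cls) (ppsz_candidate a J K D (num_vars cls) cls (entries (num_vars cls) ts gs))
      else if verifies cls (linear_candidate (num_vars cls) cls (entries (num_vars cls) ts gs))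
      then characteristic (num_vars cls) (linear_candidate (num_vars cls) cls (entries (num_vars cls) ts gs))
      else out)"

section \<open>Polynomial time of a single round\<close>

lemma polytime_compose2:
  "polytime (\<lambda>p. F (fst p) (snd p)) \<Longrightarrow> polytime f \<Longrightarrow> polytime g \<Longrightarrow> polytime (\<lambda>e. F (f e) (g e))"
  using polytime_comp[of "\<lambda>p. F (fst p) (snd p)" "\<lambda>e. (f e, g e)"] by (simp add: polytime_Pair)

lemma polytime_compose3:
  "polytime (\<lambda>p. F (fst p) (fst (snd p)) (snd (snd p))) \<Longrightarrow> polytime f \<Longrightarrow> polytime g \<Longrightarrow> polytime h \<Longrightarrow>
   polytime (\<lambda>e. F (f e) (g e) (h e))"
  using polytime_comp[of "\<lambda>p. F (fst p) (fst (snd p)) (snd (snd p))" "\<lambda>e. (f e, g e, h e)"]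
  by (simp add: polytime_Pair)

lemma polytime_neg [polytime_intros]: "polytime f \<Longrightarrow> polytime (\<lambda>e. neg (f e))"
  unfolding neg_def by (intro polytime_intros)

lemma polytime_refutes [polytime_intros]:
  assumes "polytime f" "polytime g"
  shows "polytime (\<lambda>e. refutes d (f e) (g e))"
proof (rule polytime_compose2[OF _ assms])
  show "polytime (\<lambda>p. refutes d (fst p) (snd p))"
  proof (induction d)
    case 0
    show ?case unfolding refutes.simps by (intro polytime_intros)
  next
    case (Suc d)
    show ?case unfolding refutes.simps by (intro polytime_intros polytime_compose2[OF Suc])
  qed
qed

lemma polytime_foldl_max [polytime_intros]:
  assumes "polytime xs"
  shows "polytime (\<lambda>e. foldl max (0::nat) (xs e))"
proof (rule polytime_foldl[where w = "\<lambda>p. esz (snd p)"])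
  show "polybounded (\<lambda>p :: 'a \<times> nat. esz (snd p))"
    by (intro polytime_esz polytime_intros)
qed (intro polytime_intros assms | simp)+

lemma polytime_num_vars [polytime_intros]:
  "polytime f \<Longrightarrow> polytime (\<lambda>e. num_vars (f e))"
  unfolding num_vars_def by (intro polytime_intros)

lemma polytime_entries [polytime_intros]:
  assumes "polytime f" "polytime g" "polytime h"
  shows "polytime (\<lambda>e. entries (f e) (g e) (h e))"
  by (rule polytime_compose3[OF _ assms]) (unfold entries_def, intro polytime_intros)

lemma polytime_groups [polytime_intros]:
  assumes "polytime f"
  shows "polytime (\<lambda>e. in_A a (f e))" "polytime (\<lambda>e. in_B a (f e))" "polytime (\<lambda>e. in_B' a (f e))"
    "polytime (\<lambda>e. in_C a (f e))"
  unfolding in_C_def in_A_def in_B_def in_B'_def by (intro polytime_intros assms)+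

lemma polytime_coin [polytime_intros]: "polytime f \<Longrightarrow> polytime (\<lambda>e. coin (f e))"
  unfolding coin_def by (intro polytime_intros)

lemma polytime_A_lits [polytime_intros]: "polytime f \<Longrightarrow> polytime (\<lambda>e. A_lits a (f e))"
  unfolding A_lits_def by (intro polytime_intros)

lemma polytime_C_vars [polytime_intros]: "polytime f \<Longrightarrow> polytime (\<lambda>e. C_vars a (f e))"
  unfolding C_vars_def by (intro polytime_intros)

lemma polytime_votes [polytime_intros]:
  assumes "polytime f" "polytime g" "polytime h" "polytime i" "polytime j"
  shows "polytime (\<lambda>e. votes (f e) (g e) (h e) (i e) (j e))"
proof -
  have "polytime (\<lambda>p. votes (fst p) (fst (snd p)) (fst (snd (snd p))) (fst (snd (snd (snd p)))) (snd (snd (snd (snd p)))))"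
    unfolding votes_def by (intro polytime_intros)
  from polytime_comp[OF this, of "\<lambda>e. (f e, g e, h e, i e, j e)"] assms show ?thesis
    by (simp add: polytime_Pair)
qed

lemma polytime_biased [polytime_intros]:
  assumes "polytime f" "polytime g" "polytime h"
  shows "polytime (\<lambda>e. biased J (f e) (g e) (h e))"
  unfolding biased_def by (intro polytime_intros assms)

lemma polytime_B_lits [polytime_intros]:
  assumes "polytime f" "polytime g"
  shows "polytime (\<lambda>e. B_lits a J (f e) (g e))"
  by (rule polytime_compose2[OF _ assms]) (unfold B_lits_def, intro polytime_intros)

lemma polytime_C_order [polytime_intros]:
  assumes "polytime f"
  shows "polytime (\<lambda>e. C_order a ws (f e))"
proof (induction ws)
  case Nil
  then show ?case by (simp add: C_order_def)
next
  case (Cons w ws)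
  have "polytime (\<lambda>e. filter (\<lambda>en. in_C a (fst (snd en)) \<and> fst (snd en) = w) (f e) @ C_order a ws (f e))"
    by (intro polytime_intros assms Cons)
  then show ?case by (simp add: C_order_def)
qed

lemma esz_bool: "esz (b :: bool) \<le> 2"
  by (cases b) auto

lemma polytime_ppsz [polytime_intros]:
  assumes "polytime f" "polytime g"
  shows "polytime (\<lambda>e. ppsz a J K D (f e) (g e))"
proof (rule polytime_compose2[OF _ assms])
  show "polytime (\<lambda>p. ppsz a J K D (fst p) (snd p))"
    unfolding ppsz_def
  proof (rule polytime_foldl[where w = "\<lambda>p. esz (snd p) + 2"])
    show "esz (ppsz_step D (fst e) s x) \<le> esz s + (esz (snd (e, x)) + 2)" for e s x
      using esz_bool[of "coin (snd (snd x))"] by (cases x) (auto simp: ppsz_step_def)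
    show "polybounded (\<lambda>p. esz (snd p) + 2)"
      by (intro polybounded_add polytime_esz polytime_intros polybounded_const)
    show "polytime (\<lambda>p. ppsz_step D (fst (fst p)) (snd (snd p)) (fst (snd p)))"
      unfolding ppsz_step_def by (intro polytime_intros)
  qed (intro polytime_intros)+
qed

lemma polytime_xor_row [polytime_intros]:
  assumes "polytime f" "polytime g" "polytime h"
  shows "polytime (\<lambda>e. xor_row (f e) (g e) (h e))"
  by (rule polytime_compose3[OF _ assms]) (unfold xor_row_def, intro polytime_intros)

lemma esz_filter: "esz (filter P xs) \<le> esz xs"
  by (induction xs) auto

lemma esz_xor_row: "esz (xor_row n r q) \<le> esz [0..<Suc n]"
  unfolding xor_row_def by (rule esz_filter)

lemma esz_row_of_clause: "esz (row_of_clause n c) \<le> esz [0..<Suc n]"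
proof (cases c rule: rev_cases)
  case Nil
  show ?thesis
    using Nil esz_append[of "[0..<n]" "[n]"] esz_pos[of "[0..<n]"]
    by (simp add: row_of_clause_def del: esz_pos esz_ge_1)
next
  case (snoc c' l)
  then show ?thesis by (simp only: row_of_clause_def foldl_append foldl.simps esz_xor_row)
qed

lemma polytime_row_of_clause [polytime_intros]:
  assumes "polytime f" "polytime g"
  shows "polytime (\<lambda>e. row_of_clause (f e) (g e))"
proof (rule polytime_compose2[OF _ assms])
  show "polytime (\<lambda>p. row_of_clause (fst p) (snd p))"
    unfolding row_of_clause_def
  proof (rule polytime_foldl[where w = "\<lambda>p. esz [0..<Suc (fst (fst p))]"])
    show "polybounded (\<lambda>p. esz [0..<Suc (fst (fst p))])"
      by (intro polytime_esz polytime_intros)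
    show "esz (xor_row (fst e) s (if snd x then [fst x] else [fst x, fst e])) \<le> esz s + esz [0..<Suc (fst (fst (e, x)))]"
      for e s x by (rule order_trans[OF esz_xor_row]) simp
  qed (intro polytime_intros)+
qed

lemma polytime_pivot [polytime_intros]:
  assumes "polytime f" "polytime g"
  shows "polytime (\<lambda>e. pivot (f e) (g e))"
  by (rule polytime_compose2[OF _ assms]) (unfold pivot_def, intro polytime_intros)

lemma polytime_elim_row [polytime_intros]:
  assumes "polytime f" "polytime g" "polytime h" "polytime i"
  shows "polytime (\<lambda>e. elim_row (f e) (g e) (h e) (i e))"
  unfolding elim_row_def by (intro polytime_intros assms)

lemma polytime_gauss_step [polytime_intros]:
  assumes "polytime f" "polytime g" "polytime h"
  shows "polytime (\<lambda>e. gauss_step (f e) (g e) (h e))"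
  by (rule polytime_compose3[OF _ assms]) (unfold gauss_step_def, intro polytime_intros)

lemma esz_elim_row: "esz q \<le> W \<Longrightarrow> esz [0..<Suc n] \<le> W \<Longrightarrow> esz (elim_row n j r q) \<le> W"
  unfolding elim_row_def using esz_xor_row[of n q r] by (auto simp del: upt_Suc)

lemma esz_pivot: "(\<And>q. q \<in> set R \<Longrightarrow> esz q \<le> W) \<Longrightarrow> 0 < W \<Longrightarrow> esz (pivot j R) \<le> W"
  unfolding pivot_def by (cases "filter (\<lambda>q. j \<in> set q) R") (auto simp: filter_eq_Cons_iff)

text \<open>Every result of \<open>xor_row\<close> is a sublist of \<open>[0..<Suc n]\<close>, the
  number of remaining rows is constant and one finished row is added per column, so the matrices
  stay polynomial. A step rewrites all rows at once, which is why a bound on the whole state is used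
  instead of additive growth.\<close>

lemma gauss_invariant:
  assumes "\<And>q. q \<in> set R \<Longrightarrow> esz q \<le> W" "esz [0..<Suc n] \<le> W"
  shows "length (fst (foldl (\<lambda>s j. gauss_step n s j) ([], R) js)) = length js \<and>
    length (snd (foldl (\<lambda>s j. gauss_step n s j) ([], R) js)) = length R \<and>
    (\<forall>q\<in>set (fst (foldl (\<lambda>s j. gauss_step n s j) ([], R) js)) \<union> set (snd (foldl (\<lambda>s j. gauss_step n s j) ([], R) js)).
      esz q \<le> W)"
proof (induction js rule: rev_induct)
  case Nil
  then show ?case using assms by simp
next
  case (snoc j js)
  let ?s = "foldl (\<lambda>s j. gauss_step n s j) ([], R) js"
  have "0 < W" using assms(2) esz_pos[of "[0..<Suc n]"] by linarith
  then show ?case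
    using snoc assms(2) by (auto simp: gauss_step_def intro!: esz_elim_row esz_pivot simp del: upt_Suc)
qed

lemma polytime_gauss_system:
  "polytime (\<lambda>p :: nat \<times> (nat \<times> bool) list list \<times> (nat \<times> bool) list. gauss (fst p) (system (fst p) (fst (snd p)) (snd (snd p))))"
proof -
  let ?R = "\<lambda>p :: nat \<times> (nat \<times> bool) list list \<times> (nat \<times> bool) list. system (fst p) (fst (snd p)) (snd (snd p))"
  let ?W = "\<lambda>p :: nat \<times> (nat \<times> bool) list list \<times> (nat \<times> bool) list. esz [0..<Suc (fst p)]"
  have R: "polytime ?R"
    unfolding system_def by (intro polytime_intros)
  have "polytime (\<lambda>p. foldl (\<lambda>s j. gauss_step (fst p) s j) ([], ?R p) [0..<fst p])"
  proof (rule polytime_foldl_bounded[where v = "\<lambda>p. 2 + (esz (fst p) * ?W p + esz (?R p) * ?W p)"])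
    show "polybounded (\<lambda>p. 2 + (esz (fst p) * ?W p + esz (?R p) * ?W p))"
      by (intro polybounded_add polybounded_mult polybounded_const polytime_esz polytime_intros R)
    fix p :: "nat \<times> (nat \<times> bool) list list \<times> (nat \<times> bool) list" and i
    assume i: "i \<le> length [0..<fst p]"
    let ?s = "foldl (\<lambda>s j. gauss_step (fst p) s j) ([], ?R p) (take i [0..<fst p])"
    have inv: "length (fst ?s) = i" "length (snd ?s) = length (?R p)"
      "\<And>q. q \<in> set (fst ?s) \<Longrightarrow> esz q \<le> ?W p" "\<And>q. q \<in> set (snd ?s) \<Longrightarrow> esz q \<le> ?W p"
      using gauss_invariant[of "?R p" "?W p" "fst p" "take i [0..<fst p]"] i esz_row_of_clause
      by (auto simp: system_def simp del: upt_Suc)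
    have "esz (fst ?s) \<le> 1 + i * ?W p"
      using esz_list_le[of "fst ?s" "?W p"] inv by simp
    moreover have "i * ?W p \<le> esz (fst p) * ?W p"
      using i by (intro mult_le_mono1) simp
    moreover have "esz (snd ?s) \<le> 1 + length (?R p) * ?W p"
      using esz_list_le[of "snd ?s" "?W p"] inv by simp
    moreover have "length (?R p) * ?W p \<le> esz (?R p) * ?W p"
      using length_le_esz[of "?R p"] by (intro mult_le_mono1) simp
    moreover have "esz ?s = esz (fst ?s) + esz (snd ?s)"
      by (cases ?s) simp
    ultimately show "esz ?s \<le> 2 + (esz (fst p) * ?W p + esz (?R p) * ?W p)"
      by linarith
  qed (use R in \<open>auto intro!: polytime_intros simp: case_prod_beta'\<close>)
  then show ?thesis
    unfolding gauss_def by (rule polytime_fst)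
qed

lemma polytime_guessed [polytime_intros]: "polytime f \<Longrightarrow> polytime (\<lambda>e. guessed (f e))"
  unfolding guessed_def by (intro polytime_intros)

lemma polytime_linear_candidate [polytime_intros]:
  assumes "polytime f" "polytime g" "polytime h"
  shows "polytime (\<lambda>e. linear_candidate (f e) (g e) (h e))"
proof (rule polytime_compose3[OF _ assms])
  have "polytime (\<lambda>e. gauss (f e) (system (f e) (g e) (h e)))"
    if "polytime f" "polytime g" "polytime h" for f g and h :: "((nat \<times> (nat \<times> bool) list list \<times> entry list) \<times> nat) \<Rightarrow> _"
    using polytime_comp[OF polytime_gauss_system, of "\<lambda>e. (f e, g e, h e)"] that by (simp add: polytime_Pair)
  note [polytime_intros] = this
  show "polytime (\<lambda>p. linear_candidate (fst p) (fst (snd p)) (snd (snd p)))"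
    unfolding linear_candidate_def by (intro polytime_intros)
qed

lemma polytime_ppsz_candidate [polytime_intros]:
  assumes "polytime f" "polytime g" "polytime h"
  shows "polytime (\<lambda>e. ppsz_candidate a J K D (f e) (g e) (h e))"
  by (rule polytime_compose3[OF _ assms]) (unfold ppsz_candidate_def, intro polytime_intros)

lemma polytime_verifies [polytime_intros]:
  assumes "polytime f" "polytime g"
  shows "polytime (\<lambda>e. verifies (f e) (g e))"
  by (rule polytime_compose2[OF _ assms]) (unfold verifies_def, intro polytime_intros)

lemma polytime_characteristic [polytime_intros]:
  assumes "polytime f" "polytime g"
  shows "polytime (\<lambda>e. characteristic (f e) (g e))"
  by (rule polytime_compose2[OF _ assms]) (unfold characteristic_def, intro polytime_intros)

lemma polytime_attempt:
  "polytime (\<lambda>p. attempt a J K D (fst p) (fst (snd p)) (fst (snd (snd p))) (snd (snd (snd p))))"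
  unfolding attempt_def by (intro polytime_intros)

section \<open>The linear candidate\<close>

lemma even_card_sym_diff:
  assumes "finite A" "finite B"
  shows "even (card ((A - B) \<union> (B - A))) \<longleftrightarrow> (even (card A) \<longleftrightarrow> even (card B))"
proof -
  have "card A = card (A - B) + card (A \<inter> B)"
    using assms card_Int_Diff[of A B] by simp
  moreover have "card B = card (B - A) + card (A \<inter> B)"
    using assms card_Int_Diff[of B A] by (simp add: Int_commute)
  moreover have "card ((A - B) \<union> (B - A)) = card (A - B) + card (B - A)"
    using assms by (intro card_Un_disjoint) auto
  ultimately show ?thesis by presburger
qed

text \<open>Index \<open>n\<close> counts as a variable of value 1; the row stands for the equation
  that its sum over the field with two elements is 0.\<close>

definition sat_row :: "nat \<Rightarrow> (nat \<Rightarrow> bool) \<Rightarrow> nat list \<Rightarrow> bool" where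
  "sat_row n \<beta> r \<longleftrightarrow> even (card (set r \<inter> {i. i = n \<or> i < n \<and> \<beta> i}))"

lemma set_xor_row:
  "set r \<subseteq> {..n} \<Longrightarrow> set q \<subseteq> {..n} \<Longrightarrow> set (xor_row n r q) = (set r - set q) \<union> (set q - set r)"
  unfolding xor_row_def by (auto simp del: upt_Suc)

lemma sat_xor_row:
  assumes "set r \<subseteq> {..n}" "set q \<subseteq> {..n}"
  shows "sat_row n \<beta> (xor_row n r q) \<longleftrightarrow> (sat_row n \<beta> r \<longleftrightarrow> sat_row n \<beta> q)"
proof -
  let ?X = "{i. i = n \<or> i < n \<and> \<beta> i}"
  have "((set r - set q) \<union> (set q - set r)) \<inter> ?X = (set r \<inter> ?X - set q \<inter> ?X) \<union> (set q \<inter> ?X - set r \<inter> ?X)"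
    by auto
  then show ?thesis
    unfolding sat_row_def set_xor_row[OF assms] by (simp add: even_card_sym_diff)
qed

lemma set_row_of_clause:
  "(\<And>l. l \<in> set c \<Longrightarrow> fst l < n) \<Longrightarrow> set (row_of_clause n c) \<subseteq> {..n}"
  by (induction c rule: rev_induct) (auto simp: row_of_clause_def xor_row_def simp del: upt_Suc)

lemma sat_row_of_clause:
  assumes "\<And>l. l \<in> set c \<Longrightarrow> fst l < n"
  shows "sat_row n \<beta> (row_of_clause n c) \<longleftrightarrow> odd (length (filter (\<lambda>l. \<beta> (fst l) = snd l) c))"
  using assms
proof (induction c rule: rev_induct)
  case Nil
  have "{n} \<inter> {i. i = n \<or> i < n \<and> \<beta> i} = {n}" by auto
  then show ?case by (simp add: row_of_clause_def sat_row_def)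
next
  case (snoc l c)
  let ?q = "if snd l then [fst l] else [fst l, n]"
  have "row_of_clause n (c @ [l]) = xor_row n (row_of_clause n c) ?q"
    by (simp add: row_of_clause_def)
  moreover have "set (row_of_clause n c) \<subseteq> {..n}" by (rule set_row_of_clause) (use snoc in auto)
  moreover have "set ?q \<subseteq> {..n}" using snoc.prems[of l] by auto
  moreover have "sat_row n \<beta> ?q \<longleftrightarrow> \<beta> (fst l) \<noteq> snd l"
  proof -
    have "fst l < n" using snoc.prems by auto
    then have "set ?q \<inter> {i. i = n \<or> i < n \<and> \<beta> i} =
      (if snd l then {} else {n}) \<union> (if \<beta> (fst l) then {fst l} else {})" by auto
    then show ?thesis using \<open>fst l < n\<close> unfolding sat_row_def by auto
  qed
  ultimately show ?case using snoc.IH snoc.prems by (auto simp: sat_xor_row)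
qed

text \<open>Reduced echelon form on the first \<open>j\<close> columns: the finished rows form an
  identity matrix there, the remaining rows vanish, and the solution set is that of
  \<open>R0\<close>.\<close>

definition gauss_inv :: "nat \<Rightarrow> nat list list \<Rightarrow> nat \<Rightarrow> nat list list \<times> nat list list \<Rightarrow> bool" where
  "gauss_inv n R0 j s \<longleftrightarrow> length (fst s) = j \<and>
     (\<forall>r\<in>set (fst s) \<union> set (snd s). set r \<subseteq> {..n}) \<and>
     (\<forall>\<beta>. (\<forall>r\<in>set (fst s) \<union> set (snd s). sat_row n \<beta> r) \<longleftrightarrow> (\<forall>r\<in>set R0. sat_row n \<beta> r)) \<and>
     (\<forall>i<j. \<forall>i'<j. i \<in> set (fst s ! i') \<longleftrightarrow> i = i') \<and>
     (\<forall>i<j. \<forall>r\<in>set (snd s). i \<notin> set r)"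

text \<open>
  A column without a pivot would be a free variable: toggling it, together with the pivot variables
  of the rows it occurs in, gives another solution.
\<close>

lemma gauss_pivot_exists:
  assumes inv: "gauss_inv n R0 j (D, R)" and j: "j < n"
    and sol: "\<And>r. r \<in> set R0 \<Longrightarrow> sat_row n \<alpha> r"
    and uniq: "\<And>\<beta>. (\<And>r. r \<in> set R0 \<Longrightarrow> sat_row n \<beta> r) \<Longrightarrow> \<beta> j = \<alpha> j"
  shows "\<exists>q\<in>set R. j \<in> set q"
proof (rule ccontr)
  assume no: "\<not> ?thesis"
  define \<beta> where "\<beta> i = (if i = j then \<not> \<alpha> j else if i < j \<and> j \<in> set (D ! i) then \<not> \<alpha> i else \<alpha> i)" for i
  let ?X = "\<lambda>\<beta>. {i. i = n \<or> i < n \<and> \<beta> i}"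
  have sat: "\<And>r. r \<in> set D \<union> set R \<Longrightarrow> sat_row n \<alpha> r"
    using inv sol unfolding gauss_inv_def by auto
  have "sat_row n \<beta> r" if "r \<in> set R" for r
  proof -
    have "\<And>i. i \<in> set r \<Longrightarrow> i > j"
      using inv no that unfolding gauss_inv_def by (metis linorder_neqE_nat sndI)
    then have "set r \<inter> ?X \<beta> = set r \<inter> ?X \<alpha>" by (force simp: \<beta>_def)
    then show ?thesis using sat[of r] that unfolding sat_row_def by simp
  qed
  moreover have "sat_row n \<beta> (D ! i)" if i: "i < j" for i
  proof -
    have len: "length D = j" using inv by (simp add: gauss_inv_def)
    have only: "\<And>i'. i' < j \<Longrightarrow> i' \<in> set (D ! i) \<longleftrightarrow> i' = i"
      using inv i unfolding gauss_inv_def by auto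
    have sat_i: "even (card (set (D ! i) \<inter> ?X \<alpha>))"
      using sat[of "D ! i"] i len by (auto simp: sat_row_def)
    show ?thesis
    proof (cases "j \<in> set (D ! i)")
      case True
      have "set (D ! i) \<inter> ?X \<beta> = (set (D ! i) \<inter> ?X \<alpha> - {i, j}) \<union> ({i, j} - set (D ! i) \<inter> ?X \<alpha>)"
        using True only[OF i] only i j by (auto simp: \<beta>_def)
      then show ?thesis using even_card_sym_diff[of "set (D ! i) \<inter> ?X \<alpha>" "{i, j}"] sat_i i
        unfolding sat_row_def by simp
    next
      case False
      have "set (D ! i) \<inter> ?X \<beta> = set (D ! i) \<inter> ?X \<alpha>"
        using False only by (auto simp: \<beta>_def)
      then show ?thesis using sat_i unfolding sat_row_def by simp
    qed
  qed
  then have "sat_row n \<beta> r" if "r \<in> set D" for r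
    using inv that by (auto simp: in_set_conv_nth gauss_inv_def)
  ultimately have "\<And>r. r \<in> set R0 \<Longrightarrow> sat_row n \<beta> r"
    using inv unfolding gauss_inv_def by (metis UnE fst_conv snd_conv)
  then have "\<beta> j = \<alpha> j" by (rule uniq)
  then show False by (simp add: \<beta>_def)
qed

lemma gauss_inv_step:
  assumes inv: "gauss_inv n R0 j (D, R)" and j: "j < n" and ex: "\<exists>q\<in>set R. j \<in> set q"
  shows "gauss_inv n R0 (Suc j) (gauss_step n (D, R) j)"
proof -
  define r where "r = pivot j R"
  have r: "r \<in> set R" "j \<in> set r"
  proof -
    from ex have "filter (\<lambda>q. j \<in> set q) R \<noteq> []" by (auto simp: filter_empty_conv)
    then obtain q qs where q: "filter (\<lambda>q. j \<in> set q) R = q # qs" by (cases "filter (\<lambda>q. j \<in> set q) R") auto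
    then have "q \<in> set (filter (\<lambda>q. j \<in> set q) R)" by (metis list.set_intros(1))
    moreover have "r = q" using q by (simp add: r_def pivot_def)
    ultimately show "r \<in> set R" "j \<in> set r" by auto
  qed
  let ?e = "elim_row n j r"
  have len: "length D = j" and sub: "\<And>q. q \<in> set D \<union> set R \<Longrightarrow> set q \<subseteq> {..n}"
    and D: "\<And>i i'. i < j \<Longrightarrow> i' < j \<Longrightarrow> i \<in> set (D ! i') \<longleftrightarrow> i = i'"
    and R: "\<And>i q. i < j \<Longrightarrow> q \<in> set R \<Longrightarrow> i \<notin> set q"
    and eqv: "\<And>\<beta>. (\<forall>r\<in>set D \<union> set R. sat_row n \<beta> r) \<longleftrightarrow> (\<forall>r\<in>set R0. sat_row n \<beta> r)"
    using inv unfolding gauss_inv_def by auto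
  have subr: "set r \<subseteq> {..n}" using sub r by auto
  have mem: "set (?e q) = (if j \<in> set q then (set q - set r) \<union> (set r - set q) else set q)" if "q \<in> set D \<union> set R" for q
    using sub[OF that] subr by (simp add: elim_row_def set_xor_row)
  have sat: "sat_row n \<beta> (?e q) \<longleftrightarrow> sat_row n \<beta> q" if "sat_row n \<beta> r" "q \<in> set D \<union> set R" for \<beta> q
    using that sub[OF that(2)] subr by (auto simp: elim_row_def sat_xor_row)
  have step: "gauss_step n (D, R) j = (map ?e D @ [r], map ?e R)"
    by (simp add: gauss_step_def r_def)
  show ?thesis
    unfolding gauss_inv_def step fst_conv snd_conv
  proof (intro conjI allI impI ballI)
    show "length (map ?e D @ [r]) = Suc j" using len by simp
  next
    fix q assume q: "q \<in> set (map ?e D @ [r]) \<union> set (map ?e R)"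
    have "set (?e q) \<subseteq> {..n}" if "q \<in> set D \<union> set R" for q
      using mem[OF that] sub[OF that] subr by (auto split: if_splits)
    then show "set q \<subseteq> {..n}" using q subr by auto
  next
    fix \<beta>
    have "(\<forall>q\<in>set (map ?e D @ [r]) \<union> set (map ?e R). sat_row n \<beta> q) \<longleftrightarrow> (\<forall>q\<in>set D \<union> set R. sat_row n \<beta> q)"
      using sat[of \<beta>] r by auto
    then show "(\<forall>q\<in>set (map ?e D @ [r]) \<union> set (map ?e R). sat_row n \<beta> q) \<longleftrightarrow> (\<forall>q\<in>set R0. sat_row n \<beta> q)"
      using eqv by simp
  next
    fix i i' assume i: "i < Suc j" "i' < Suc j"
    show "i \<in> set ((map ?e D @ [r]) ! i') \<longleftrightarrow> i = i'"
    proof (cases "i' = j")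
      case True
      then show ?thesis using i len R r by (auto simp: nth_append less_Suc_eq)
    next
      case False
      then have i': "i' < j" using i by auto
      then have "D ! i' \<in> set D" using len by auto
      then show ?thesis using i i' len mem[of "D ! i'"] D r R[of i r] by (auto simp: nth_append less_Suc_eq)
    qed
  next
    fix i q assume i: "i < Suc j" and "q \<in> set (map ?e R)"
    then obtain q' where "q' \<in> set R" "q = ?e q'" by auto
    then show "i \<notin> set q" using i mem[of q'] R[of i q'] R[of i r] r by (auto simp: less_Suc_eq)
  qed
qed

text \<open>After \<open>n\<close> columns, row \<open>i\<close> contains no variable but
  \<open>i\<close>, so its equation says that the value of \<open>i\<close> is 1 exactly if the
  constant occurs. Uniqueness of the solution guarantees a pivot for every column.\<close>

lemma gauss_correct:
  assumes sub: "\<And>r. r \<in> set R \<Longrightarrow> set r \<subseteq> {..n}"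
    and sol: "\<And>r. r \<in> set R \<Longrightarrow> sat_row n \<alpha> r"
    and uniq: "\<And>\<beta> i. (\<And>r. r \<in> set R \<Longrightarrow> sat_row n \<beta> r) \<Longrightarrow> i < n \<Longrightarrow> \<beta> i = \<alpha> i"
    and i: "i < n"
  shows "n \<in> set (hd_or [] (drop i (gauss n R))) \<longleftrightarrow> \<alpha> i"
proof -
  have "gauss_inv n R j (foldl (\<lambda>s j. gauss_step n s j) ([], R) [0..<j])" if "j \<le> n" for j
    using that
  proof (induction j)
    case 0
    then show ?case using sub by (auto simp: gauss_inv_def)
  next
    case (Suc j)
    obtain D R' where s: "foldl (\<lambda>s j. gauss_step n s j) ([], R) [0..<j] = (D, R')" by fastforce
    then have inv: "gauss_inv n R j (D, R')" using Suc by simp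
    have "\<exists>q\<in>set R'. j \<in> set q"
      by (rule gauss_pivot_exists[OF inv _ sol]) (use Suc.prems uniq in auto)
    then show ?case using gauss_inv_step[OF inv] Suc.prems s by simp
  qed
  from this[of n] have inv: "gauss_inv n R n (foldl (\<lambda>s j. gauss_step n s j) ([], R) [0..<n])" by simp
  let ?D = "gauss n R"
  have len: "length ?D = n" and subD: "\<And>r. r \<in> set ?D \<Longrightarrow> set r \<subseteq> {..n}"
    and D: "\<And>i i'. i < n \<Longrightarrow> i' < n \<Longrightarrow> i \<in> set (?D ! i') \<longleftrightarrow> i = i'"
    and sat: "\<And>r. r \<in> set ?D \<Longrightarrow> sat_row n \<alpha> r"
    using inv sol unfolding gauss_inv_def gauss_def by auto
  have mem: "?D ! i \<in> set ?D" using i len by simp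
  have "set (?D ! i) = (if n \<in> set (?D ! i) then {i, n} else {i})"
  proof (rule set_eqI)
    fix x show "x \<in> set (?D ! i) \<longleftrightarrow> x \<in> (if n \<in> set (?D ! i) then {i, n} else {i})"
      using subD[OF mem] D[OF _ i, of x] i D[OF i i] by (cases "x < n"; cases "x = n") auto
  qed
  moreover have "even (card (set (?D ! i) \<inter> {i. i = n \<or> i < n \<and> \<alpha> i}))"
    using sat[OF mem] by (simp add: sat_row_def)
  moreover have "{i, n} \<inter> {i. i = n \<or> i < n \<and> \<alpha> i} = (if \<alpha> i then {i, n} else {n})"
    "{i} \<inter> {i. i = n \<or> i < n \<and> \<alpha> i} = (if \<alpha> i then {i} else {})"
    using i by auto
  ultimately have "n \<in> set (?D ! i) \<longleftrightarrow> \<alpha> i" using i by (auto split: if_splits)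
  moreover have "hd_or [] (drop i ?D) = ?D ! i"
    using i len by (simp add: Cons_nth_drop_Suc[symmetric])
  ultimately show ?thesis by simp
qed

section \<open>Uniquely satisfiable formulas over variable positions\<close>

locale unique_cnf =
  fixes cls :: "(nat \<times> bool) list list" and n :: nat and \<alpha> :: "nat \<Rightarrow> bool"
  assumes distinct_vars: "c \<in> set cls \<Longrightarrow> distinct (map fst c)"
    and vars_less: "c \<in> set cls \<Longrightarrow> l \<in> set c \<Longrightarrow> fst l < n"
    and vars_occur: "i < n \<Longrightarrow> \<exists>c\<in>set cls. \<exists>l\<in>set c. fst l = i"
    and le3: "c \<in> set cls \<Longrightarrow> length c \<le> 3"
    and distinct_cls: "distinct cls"
    and sat: "c \<in> set cls \<Longrightarrow> \<exists>l\<in>set c. \<alpha> (fst l) = snd l"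
    and unique: "(\<And>c. c \<in> set cls \<Longrightarrow> \<exists>l\<in>set c. \<beta> (fst l) = snd l) \<Longrightarrow> i < n \<Longrightarrow> \<beta> i = \<alpha> i"
begin

definition tlits :: "(nat \<times> bool) list \<Rightarrow> (nat \<times> bool) list" where
  "tlits c = filter (\<lambda>l. \<alpha> (fst l) = snd l) c"

lemma num_vars_eq: "num_vars cls = n"
proof -
  have le: "foldl max a xs \<le> b \<longleftrightarrow> a \<le> b \<and> (\<forall>x\<in>set xs. x \<le> b)" for a b :: nat and xs
    by (induction xs arbitrary: a) auto
  have *: "num_vars cls \<le> b \<longleftrightarrow> (\<forall>c\<in>set cls. \<forall>l\<in>set c. Suc (fst l) \<le> b)" for b
    unfolding num_vars_def by (auto simp: le)
  have "num_vars cls \<le> n" using * vars_less by (auto simp: Suc_le_eq)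
  moreover have "n \<le> num_vars cls"
  proof (rule ccontr)
    assume "\<not> n \<le> num_vars cls"
    then obtain c l where "c \<in> set cls" "l \<in> set c" "fst l = num_vars cls"
      using vars_occur[of "num_vars cls"] by auto
    then have "Suc (num_vars cls) \<le> num_vars cls" using *[of "num_vars cls"] by (metis order_refl)
    then show False by simp
  qed
  ultimately show ?thesis by simp
qed

lemma length_tlits:
  assumes "c \<in> set cls"
  shows "0 < length (tlits c)" "length (tlits c) \<le> 3"
  using sat[OF assms] order_trans[OF length_filter_le le3[OF assms]]
  by (auto simp: tlits_def filter_empty_conv)

text \<open>Once the clauses with two true literals are out of the way, exactly one or three literals of
  each remaining clause are true.\<close>

lemma linear_candidate_correct:
  assumes H: "\<And>l. l \<in> set (guessed es) \<Longrightarrow> fst l < n \<and> \<alpha> (fst l) = snd l"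
    and hit: "\<And>c. c \<in> set cls \<Longrightarrow> length (tlits c) = 2 \<Longrightarrow> \<exists>l\<in>set c. l \<in> set (guessed es)"
  shows "linear_candidate n cls es = filter \<alpha> [0..<n]"
  unfolding linear_candidate_def
proof (rule filter_cong[OF refl])
  fix i assume "i \<in> set [0..<n]"
  then have i: "i < n" by simp
  let ?H = "guessed es"
  define G where "G = map (\<lambda>l. [l]) ?H @ filter (\<lambda>c. \<not> (\<exists>l\<in>set c. l \<in> set ?H)) cls"
  have G: "fst l < n" if "c \<in> set G" "l \<in> set c" for c l
    using that H vars_less[of c l] by (auto simp: G_def)
  have sys: "set (system n cls ?H) = row_of_clause n ` set G"
    by (auto simp: system_def G_def)
  have satG: "sat_row n \<beta> (row_of_clause n c) \<longleftrightarrow> odd (length (filter (\<lambda>l. \<beta> (fst l) = snd l) c))"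
    if "c \<in> set G" for \<beta> c by (rule sat_row_of_clause) (use G that in auto)
  show "n \<in> set (hd_or [] (drop i (gauss n (system n cls ?H)))) \<longleftrightarrow> \<alpha> i"
  proof (rule gauss_correct[OF _ _ _ i])
    show "set r \<subseteq> {..n}" if "r \<in> set (system n cls ?H)" for r
      using that set_row_of_clause G unfolding sys by blast
    show "sat_row n \<alpha> r" if "r \<in> set (system n cls ?H)" for r
    proof -
      obtain c where c: "c \<in> set G" "r = row_of_clause n c" using \<open>r \<in> _\<close> unfolding sys by auto
      have "odd (length (filter (\<lambda>l. \<alpha> (fst l) = snd l) c))"
      proof (cases "c \<in> set cls \<and> \<not> (\<exists>l\<in>set c. l \<in> set ?H)")
        case True
        then have "length (tlits c) \<noteq> 2" using hit by auto
        moreover have "0 < length (tlits c)" "length (tlits c) \<le> 3" using length_tlits True by auto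
        ultimately have "length (tlits c) = 1 \<or> length (tlits c) = 3" by arith
        then show ?thesis by (auto simp: tlits_def)
      next
        case False
        then obtain l where "l \<in> set ?H" "c = [l]" using c by (auto simp: G_def)
        then show ?thesis using H by auto
      qed
      then show ?thesis using satG c by auto
    qed
    fix \<beta> j
    assume \<beta>: "\<And>r. r \<in> set (system n cls ?H) \<Longrightarrow> sat_row n \<beta> r" and j: "j < n"
    have odd: "odd (length (filter (\<lambda>l. \<beta> (fst l) = snd l) c))" if "c \<in> set G" for c
      using \<beta>[of "row_of_clause n c"] satG that by (auto simp: sys)
    show "\<beta> j = \<alpha> j"
    proof (rule unique[OF _ j])
      fix c assume c: "c \<in> set cls"
      show "\<exists>l\<in>set c. \<beta> (fst l) = snd l"
      proof (cases "\<exists>l\<in>set c. l \<in> set ?H")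
        case True
        then obtain l where l: "l \<in> set c" "l \<in> set ?H" by auto
        then have "[l] \<in> set G" by (auto simp: G_def)
        then have "\<beta> (fst l) = snd l" using odd[of "[l]"] by (auto split: if_splits)
        then show ?thesis using l by auto
      next
        case False
        then have "c \<in> set G" using c by (auto simp: G_def)
        then have "filter (\<lambda>l. \<beta> (fst l) = snd l) c \<noteq> []" using odd[of c] by auto
        then show ?thesis by (auto simp: filter_empty_conv)
      qed
    qed
  qed
qed

lemma verifies_iff:
  "verifies cls S \<longleftrightarrow> (\<forall>i<n. i \<in> set S \<longleftrightarrow> \<alpha> i)"
proof
  assume "verifies cls S"
  then show "\<forall>i<n. i \<in> set S \<longleftrightarrow> \<alpha> i"
    using unique[of "\<lambda>i. i \<in> set S"] by (auto simp: verifies_def)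
next
  assume *: "\<forall>i<n. i \<in> set S \<longleftrightarrow> \<alpha> i"
  show "verifies cls S"
    unfolding verifies_def
  proof
    fix c assume c: "c \<in> set cls"
    from sat[OF c] obtain l where "l \<in> set c" "\<alpha> (fst l) = snd l" by auto
    then show "\<exists>l\<in>set c. (fst l \<in> set S) = snd l" using * vars_less[OF c] by auto
  qed
qed

lemma attempt_cases:
  "attempt a J K D cls ts gs out \<in> {map \<alpha> [0..<n], out}"
proof -
  have "characteristic n S = map \<alpha> [0..<n]" if "verifies cls S" for S
    using that by (auto simp: verifies_iff characteristic_def)
  then show ?thesis unfolding attempt_def num_vars_eq by auto
qed

lemma attempt_correct:
  assumes "ppsz_candidate a J K D n cls (entries n ts gs) = filter \<alpha> [0..<n] \<or>
    linear_candidate n cls (entries n ts gs) = filter \<alpha> [0..<n]"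
  shows "attempt a J K D cls ts gs out = map \<alpha> [0..<n]"
proof -
  have "characteristic n S = map \<alpha> [0..<n]" if "verifies cls S" for S
    using that by (auto simp: verifies_iff characteristic_def)
  moreover have "verifies cls (filter \<alpha> [0..<n])" by (auto simp: verifies_iff)
  ultimately show ?thesis using assms unfolding attempt_def num_vars_eq by metis
qed

text \<open>The clause \<open>falsified W\<close> witnesses that flipping \<open>W\<close> in \<open>\<alpha>\<close> is not satisfying; the
  variables outside of \<open>W\<close> are the children of the node with path \<open>W\<close> in a critical clause tree.\<close>

definition falsified :: "nat set \<Rightarrow> (nat \<times> bool) list" where
  "falsified W = (SOME c. c \<in> set cls \<and> (\<forall>l\<in>set c. \<alpha> (fst l) = snd l \<longleftrightarrow> fst l \<in> W))"

definition children :: "nat set \<Rightarrow> nat set" where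
  "children W = fst ` set (falsified W) - W"

text \<open>Flipping \<open>W\<close> changes the value of \<open>x\<close>, so by uniqueness some
  clause fails under the flipped assignment; precisely its literals over \<open>W\<close> were true
  before.\<close>

lemma falsified:
  assumes "x \<in> W" "x < n"
  shows "falsified W \<in> set cls" "l \<in> set (falsified W) \<Longrightarrow> \<alpha> (fst l) = snd l \<longleftrightarrow> fst l \<in> W"
proof -
  have "\<exists>c. c \<in> set cls \<and> (\<forall>l\<in>set c. \<alpha> (fst l) = snd l \<longleftrightarrow> fst l \<in> W)"
  proof (rule ccontr)
    assume *: "\<not> ?thesis"
    have "(\<lambda>i. \<alpha> i = (i \<notin> W)) x = \<alpha> x"
    proof (rule unique)
      fix c assume "c \<in> set cls"
      with * obtain l where "l \<in> set c" "(\<alpha> (fst l) = snd l) \<noteq> (fst l \<in> W)" by blast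
      then show "\<exists>l\<in>set c. (\<alpha> (fst l) = (fst l \<notin> W)) = snd l" by (intro bexI[of _ l]) auto
    qed (rule assms)
    with assms show False by auto
  qed
  from someI_ex[OF this] show "falsified W \<in> set cls" "l \<in> set (falsified W) \<Longrightarrow> \<alpha> (fst l) = snd l \<longleftrightarrow> fst l \<in> W"
    unfolding falsified_def by auto
qed

text \<open>A clause has at most three literals, and one that is true under \<alpha> lies over
  \<open>W\<close>, which leaves at most two children.\<close>

lemma children:
  assumes "x \<in> W" "x < n"
  shows "finite (children W)" "card (children W) \<le> 2" "children W \<subseteq> {..<n}" "children W \<inter> W = {}"
proof -
  let ?c = "falsified W"
  have c: "?c \<in> set cls" by (rule falsified[OF assms])
  obtain l where l: "l \<in> set ?c" "fst l \<in> W" using sat[OF c] falsified(2)[OF assms] by auto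
  have "card (children W) < card (fst ` set ?c)"
    by (rule psubset_card_mono) (use l in \<open>auto simp: children_def\<close>)
  also have "\<dots> \<le> length ?c" by (metis card_length list.set_map length_map)
  also have "\<dots> \<le> 3" by (rule le3[OF c])
  finally show "card (children W) \<le> 2" by simp
  show "children W \<subseteq> {..<n}" using vars_less[OF c] by (auto simp: children_def)
qed (auto simp: children_def)

text \<open>\<open>S\<close> is the set of variables known in advance. Every branch below the path
  \<open>W\<close>, in the tree with \<open>d + 1\<close> levels of children, has to meet
  \<open>S\<close>.\<close>

primrec cut :: "nat \<Rightarrow> nat set \<Rightarrow> nat set \<Rightarrow> bool" where
  "cut 0 W S = (children W \<subseteq> S)"
| "cut (Suc d) W S = (\<forall>y\<in>children W. y \<in> S \<or> cut d (insert y W) S)"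

text \<open>The search assumes wrong values along the path. They falsify the literals of
  \<open>falsified W\<close> over \<open>W\<close>, right values falsify those over
  \<open>S\<close>, and any other literal gives its variable the wrong value when it is assumed
  next, which extends the path by that child.\<close>

lemma cut_imp_refutes:
  assumes "cut d W S" "W \<noteq> {}" "W \<subseteq> {..<n}"
    and "\<And>w. w \<in> W \<Longrightarrow> (w, \<not> \<alpha> w) \<in> set \<beta>" "\<And>y. y \<in> S - W \<Longrightarrow> (y, \<alpha> y) \<in> set \<beta>"
  shows "refutes d cls \<beta>"
  using assms
proof (induction d arbitrary: W \<beta>)
  case 0
  obtain x where x: "x \<in> W" "x < n" using 0 by auto
  have "neg l \<in> set \<beta>" if l: "l \<in> set (falsified W)" for l
  proof (cases "fst l \<in> W")
    case True
    then have "neg l = (fst l, \<not> \<alpha> (fst l))" using falsified(2)[OF x l] by (simp add: neg_def)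
    then show ?thesis using 0 True by auto
  next
    case False
    then have "neg l = (fst l, \<alpha> (fst l))" using falsified(2)[OF x l] by (auto simp: neg_def)
    moreover have "fst l \<in> S" using 0 False l by (auto simp: children_def)
    ultimately show ?thesis using 0 False by auto
  qed
  then show ?case using falsified(1)[OF x] unfolding refutes.simps by blast
next
  case (Suc d)
  obtain x where x: "x \<in> W" "x < n" using Suc.prems by auto
  have "neg l \<in> set \<beta> \<or> refutes d cls (l # \<beta>)" if l: "l \<in> set (falsified W)" for l
  proof (cases "fst l \<in> W")
    case True
    then have "neg l = (fst l, \<not> \<alpha> (fst l))" using falsified(2)[OF x l] by (simp add: neg_def)
    then show ?thesis using Suc.prems True by auto
  next
    case False
    then have eq: "neg l = (fst l, \<alpha> (fst l))" "l = (fst l, \<not> \<alpha> (fst l))"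
      using falsified(2)[OF x l] by (auto simp: neg_def prod_eq_iff)
    have ch: "fst l \<in> children W" using l False by (auto simp: children_def)
    show ?thesis
    proof (cases "fst l \<in> S")
      case True
      then show ?thesis using Suc.prems(5)[of "fst l"] False eq by auto
    next
      case False2: False
      have "refutes d cls (l # \<beta>)"
      proof (rule Suc.IH[of "insert (fst l) W"])
        show "cut d (insert (fst l) W) S" using Suc.prems(1) ch False2 by auto
        show "insert (fst l) W \<subseteq> {..<n}" using Suc.prems(3) ch children(3)[OF x] by auto
        show "(w, \<not> \<alpha> w) \<in> set (l # \<beta>)" if "w \<in> insert (fst l) W" for w
          using that Suc.prems(4) eq by auto
        show "(y, \<alpha> y) \<in> set (l # \<beta>)" if "y \<in> S - insert (fst l) W" for y
          using that Suc.prems(5) by auto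
      qed simp
      then show ?thesis by simp
    qed
  qed
  then show ?case using falsified(1)[OF x] unfolding refutes.simps by blast
qed

text \<open>Some literal of each clause is true under \<alpha>: its negation is not among the
  assumptions, and adding it keeps them true, so the recursion never closes.\<close>

lemma refutes_sound:
  assumes "\<And>l. l \<in> set \<beta> \<Longrightarrow> \<alpha> (fst l) = snd l"
  shows "\<not> refutes d cls \<beta>"
  using assms
proof (induction d arbitrary: \<beta>)
  case 0
  show ?case
  proof
    assume "refutes 0 cls \<beta>"
    then obtain c where c: "c \<in> set cls" "\<forall>l\<in>set c. neg l \<in> set \<beta>" by auto
    from sat[OF c(1)] obtain l where "l \<in> set c" "\<alpha> (fst l) = snd l" by auto
    then show False using c(2) 0[of "neg l"] by (auto simp: neg_def)
  qed
next
  case (Suc d)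
  show ?case
  proof
    assume "refutes (Suc d) cls \<beta>"
    then obtain c where c: "c \<in> set cls" "\<forall>l\<in>set c. neg l \<in> set \<beta> \<or> refutes d cls (l # \<beta>)" by auto
    from sat[OF c(1)] obtain l where l: "l \<in> set c" "\<alpha> (fst l) = snd l" by auto
    then have "refutes d cls (l # \<beta>)" using c(2) Suc.prems[of "neg l"] by (auto simp: neg_def)
    moreover have "\<not> refutes d cls (l # \<beta>)" by (rule Suc.IH) (use Suc.prems l in auto)
    ultimately show False by simp
  qed
qed

end

section \<open>The PPSZ candidate\<close>

fun val :: "bool list \<Rightarrow> nat" where
  "val [] = 0"
| "val (b # w) = (if b then 2 ^ length w else 0) + val w"

lemma val_less: "val w < 2 ^ length w"
  by (induction w) auto

lemma length_words: "w \<in> set (words k) \<Longrightarrow> length w = k"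
  by (induction k arbitrary: w) auto

lemma map_val_words: "map val (words k) = [0..<2 ^ k]"
proof (induction k)
  case (Suc k)
  have *: "[2 ^ k..<2 ^ Suc k] = map ((+) (2 ^ k)) [0..<2 ^ k]"
    by (rule nth_equalityI) auto
  have "map (val \<circ> (#) True) (words k) = map ((+) (2 ^ k) \<circ> val) (words k)"
    by (rule map_cong) (auto dest: length_words)
  also have "\<dots> = [2 ^ k..<2 ^ Suc k]"
    unfolding map_map[symmetric] Suc * ..
  finally have "map val (words (Suc k)) = [0..<2 ^ k] @ [2 ^ k..<2 ^ Suc k]"
    using Suc by (simp add: comp_def)
  also have "\<dots> = [0..<2 ^ Suc k]"
    using upt_add_eq_append[of 0 "2 ^ k" "2 ^ k"] by (simp add: mult_2)
  finally show ?case .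
qed simp

lemma length_words_list: "length (words k) = 2 ^ k"
  using arg_cong[OF map_val_words[of k], of length] by simp

lemma val_words_nth: "v < 2 ^ k \<Longrightarrow> val (words k ! v) = v"
  using arg_cong[OF map_val_words[of k], of "\<lambda>xs. xs ! v"] by (simp add: length_words_list)

lemma inj_val: "length w = length w' \<Longrightarrow> val w = val w' \<Longrightarrow> w = w'"
proof (induction w w' rule: list_induct2)
  case (Cons b w b' w')
  then show ?case using val_less[of w] val_less[of w'] by (auto split: if_splits)
qed simp

lemma nth_words_val: "words (length w) ! val w = w"
  using val_words_nth[OF val_less, of w] val_less[of w] length_words[OF nth_mem, of "val w" "length w"]
  by (intro inj_val) (auto simp: length_words_list)

lemma val_split: "val (u @ v) = val u * 2 ^ length v + val v"
  by (induction u) (auto simp: power_add algebra_simps)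

lemma val_take: "a \<le> length w \<Longrightarrow> val (take a w) = val w div 2 ^ (length w - a)"
  using val_split[of "take a w" "drop a w"] val_less[of "drop a w"] by simp

lemma val_replicate_False [simp]: "val (replicate k False) = 0"
  by (induction k) auto

lemma in_A_iff: "a \<le> length w \<Longrightarrow> in_A a w \<longleftrightarrow> val w < 2 ^ (length w - a)"
proof -
  assume a: "a \<le> length w"
  have "in_A a w \<longleftrightarrow> val (take a w) = val (replicate a False)"
    unfolding in_A_def using a by (metis inj_val length_replicate length_take min.absorb2)
  also have "\<dots> \<longleftrightarrow> val w < 2 ^ (length w - a)"
    using a by (simp add: val_take div_eq_0_iff)
  finally show ?thesis .
qed

lemma div_eq_iff_bounds:
  assumes "0 < (m::nat)"
  shows "v div m = k \<longleftrightarrow> k * m \<le> v \<and> v < k * m + m"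
proof
  assume "v div m = k"
  then show "k * m \<le> v \<and> v < k * m + m"
    using div_mult_mod_eq[of v m] mod_less_divisor[OF assms, of v] by auto
next
  assume "k * m \<le> v \<and> v < k * m + m"
  then show "v div m = k" by (intro div_nat_eqI) (auto simp: algebra_simps)
qed

lemma in_B_iff:
  assumes "0 < a" "a \<le> length w"
  shows "in_B a w \<longleftrightarrow> 2 ^ (length w - a) \<le> val w \<and> val w < 2 * 2 ^ (length w - a)"
proof -
  have "in_B a w \<longleftrightarrow> val (take a w) = val (replicate (a - 1) False @ [True])"
    unfolding in_B_def using assms inj_val[of "take a w" "replicate (a - 1) False @ [True]"] by auto
  then show ?thesis
    using assms by (auto simp: val_take val_split div_eq_iff_bounds)
qed

lemma in_B'_iff:
  assumes "0 < a" "2 * a \<le> length w"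
  shows "in_B' a w \<longleftrightarrow> 2 ^ (length w - a) \<le> val w \<and> val w < 2 ^ (length w - a) + 2 ^ (length w - 2 * a)"
proof -
  have len: "length (take (2 * a) w) = length (replicate (a - 1) False @ [True] @ replicate a False)"
    using assms by simp
  have pow: "(2::nat) ^ a * 2 ^ (length w - 2 * a) = 2 ^ (length w - a)"
    using assms by (simp add: power_add[symmetric])
  have "in_B' a w \<longleftrightarrow> val (take (2 * a) w) = val (replicate (a - 1) False @ [True] @ replicate a False)"
    unfolding in_B'_def using inj_val[OF len] by auto
  also have "\<dots> \<longleftrightarrow> val w div 2 ^ (length w - 2 * a) = 2 ^ a"
    using assms by (simp add: val_take val_split)
  also have "\<dots> \<longleftrightarrow> 2 ^ (length w - a) \<le> val w \<and> val w < 2 ^ (length w - a) + 2 ^ (length w - 2 * a)"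
    using pow by (subst div_eq_iff_bounds) auto
  finally show ?thesis .
qed

section \<open>Correctness of the PPSZ run under right guesses\<close>

context unique_cnf
begin

definition true_lits :: "nat set \<Rightarrow> (nat \<times> bool) set" where
  "true_lits S = (\<lambda>y. (y, \<alpha> y)) ` S"

text \<open>While all earlier values are right, the right value cannot be refuted, and the wrong
  value is refuted whenever the tree is cut by \<open>S\<close>. The coin can matter only in the
  uncut case.\<close>

lemma ppsz_step_correct:
  assumes i: "fst en < n" and \<beta>: "true_lits S \<subseteq> set \<beta>" "set \<beta> \<subseteq> true_lits {..<n}"
    and coin: "\<not> cut D {fst en} S \<Longrightarrow> coin (snd (snd en)) = \<alpha> (fst en)"
  shows "ppsz_step D cls \<beta> en = (fst en, \<alpha> (fst en)) # \<beta>"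
proof -
  let ?i = "fst en"
  have sound: "\<not> refutes D cls ((?i, \<alpha> ?i) # \<beta>)"
    by (rule refutes_sound) (use \<beta>(2) in \<open>auto simp: true_lits_def\<close>)
  have "refutes D cls ((?i, \<not> \<alpha> ?i) # \<beta>)" if "cut D {?i} S"
    by (rule cut_imp_refutes[OF that]) (use i \<beta>(1) in \<open>auto simp: true_lits_def\<close>)
  then show ?thesis
    using sound coin unfolding ppsz_step_def by (cases "\<alpha> ?i") auto
qed

lemma ppsz_foldl_correct:
  assumes "\<And>en. en \<in> set es \<Longrightarrow> fst en < n \<and> (\<not> cut D {fst en} S \<longrightarrow> coin (snd (snd en)) = \<alpha> (fst en))"
    and "true_lits S \<subseteq> set \<beta>" "set \<beta> \<subseteq> true_lits {..<n}"
  shows "set (foldl (\<lambda>\<beta> en. ppsz_step D cls \<beta> en) \<beta> es) = set \<beta> \<union> true_lits (fst ` set es)"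
  using assms
proof (induction es arbitrary: \<beta>)
  case Nil
  then show ?case by (simp add: true_lits_def)
next
  case (Cons en es)
  have step: "ppsz_step D cls \<beta> en = (fst en, \<alpha> (fst en)) # \<beta>"
    by (rule ppsz_step_correct[OF _ Cons.prems(2,3)]) (use Cons.prems(1)[of en] in auto)
  have "set (foldl (\<lambda>\<beta> en. ppsz_step D cls \<beta> en) ((fst en, \<alpha> (fst en)) # \<beta>) es)
     = set ((fst en, \<alpha> (fst en)) # \<beta>) \<union> true_lits (fst ` set es)"
    by (rule Cons.IH) (use Cons.prems Cons.prems(1)[of en] in \<open>auto simp: true_lits_def\<close>)
  then show ?case unfolding foldl.simps step by (auto simp: true_lits_def)
qed

lemma ppsz_correct:
  assumes K: "0 < a" "a \<le> K" and ts: "length ts = n" "\<And>w. w \<in> set ts \<Longrightarrow> length w = K" and gs: "length gs = n"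
    and init: "set (A_lits a (entries n ts gs)) \<union> set (B_lits a J cls (entries n ts gs))
        = true_lits {y. y < n \<and> \<not> in_C a (ts ! y)}"
    and C: "\<And>i. i < n \<Longrightarrow> in_C a (ts ! i) \<Longrightarrow> \<not> cut D {i} {y. y < n \<and> val (ts ! y) < val (ts ! i)} \<Longrightarrow>
        coin (gs ! i) = \<alpha> i"
  shows "ppsz_candidate a J K D n cls (entries n ts gs) = filter \<alpha> [0..<n]"
proof -
  let ?es = "entries n ts gs"
  let ?init = "A_lits a ?es @ B_lits a J cls ?es"
  let ?f = "foldl (\<lambda>\<beta> en. ppsz_step D cls \<beta> en)"
  have es: "?es = map (\<lambda>i. (i, ts ! i, gs ! i)) [0..<n]"
    unfolding entries_def using ts gs by (auto simp: Cons_nth_drop_Suc[symmetric])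
  \<comment> \<open>After the words of value below \<open>v\<close>, exactly the groups A and B and
    the variables of C with a time below \<open>v\<close> are assigned.\<close>
  let ?S = "\<lambda>v. {y. y < n \<and> (in_C a (ts ! y) \<longrightarrow> val (ts ! y) < v)}"
  have inv: "set (?f ?init (C_order a (take v (words K)) ?es)) = true_lits (?S v)" if "v \<le> 2 ^ K" for v
    using that
  proof (induction v)
    case 0
    then show ?case using init by (auto simp: C_order_def)
  next
    case (Suc v)
    then have v: "v < 2 ^ K" by simp
    define w where "w = words K ! v"
    have w: "val w = v" "length w = K"
      using v length_words[of w K] by (auto simp: w_def val_words_nth length_words_list)
    let ?xs = "filter (\<lambda>en. in_C a (fst (snd en)) \<and> fst (snd en) = w) ?es"
    let ?\<beta> = "?f ?init (C_order a (take v (words K)) ?es)"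
    have "C_order a (take (Suc v) (words K)) ?es = C_order a (take v (words K)) ?es @ ?xs"
      using v by (simp add: take_Suc_conv_app_nth length_words_list C_order_def w_def)
    then have "set (?f ?init (C_order a (take (Suc v) (words K)) ?es)) = set (?f ?\<beta> ?xs)"
      by (simp only: foldl_append)
    also have "\<dots> = set ?\<beta> \<union> true_lits (fst ` set ?xs)"
    \<comment> \<open>Only strictly earlier variables are used for the cut, so the order among
      variables with the same time does not matter.\<close>
    proof (rule ppsz_foldl_correct[where S = "{y. y < n \<and> val (ts ! y) < v}"])
      show "true_lits {y. y < n \<and> val (ts ! y) < v} \<subseteq> set ?\<beta>" "set ?\<beta> \<subseteq> true_lits {..<n}"
        using Suc by (auto simp: true_lits_def)
      show "fst en < n \<and> (\<not> cut D {fst en} {y. y < n \<and> val (ts ! y) < v} \<longrightarrow> coin (snd (snd en)) = \<alpha> (fst en))"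
        if "en \<in> set ?xs" for en
        using that C w unfolding es by auto
    qed
    also have "fst ` set ?xs = {y. y < n \<and> in_C a (ts ! y) \<and> val (ts ! y) = v}"
    proof -
      have "ts ! y = w \<longleftrightarrow> val (ts ! y) = v" if "y < n" for y
        using inj_val[of "ts ! y" w] w ts that by auto
      then show ?thesis unfolding es by force
    qed
    also have "set ?\<beta> \<union> true_lits {y. y < n \<and> in_C a (ts ! y) \<and> val (ts ! y) = v} = true_lits (?S (Suc v))"
      using Suc by (auto simp: true_lits_def less_Suc_eq)
    finally show ?case .
  qed
  have "?S (2 ^ K) = {..<n}" using val_less ts by (auto, metis nth_mem)
  then have "set (ppsz a J K D cls ?es) = true_lits {..<n}"
    using inv[of "2 ^ K"] by (simp add: ppsz_def length_words_list)
  then show ?thesis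
    unfolding ppsz_candidate_def by (intro filter_cong) (auto simp: true_lits_def)
qed

end

section \<open>Random times\<close>

text \<open>Expectation over independent times uniform in \<open>{..<N}\<close>; as a finite
  average, it can be split coordinate by coordinate without measure theory.\<close>

definition av :: "'a set \<Rightarrow> nat \<Rightarrow> (('a \<Rightarrow> nat) \<Rightarrow> real) \<Rightarrow> real" where
  "av V N g = (\<Sum>\<tau>\<in>PiE V (\<lambda>_. {..<N}). g \<tau>) / real N ^ card V"

lemma av_insert:
  assumes "finite V" "x \<notin> V"
  shows "av (insert x V) N g = (\<Sum>v<N. av V N (\<lambda>\<tau>. g (\<tau>(x := v)))) / real N"
proof -
  have "(\<Sum>\<tau>\<in>PiE (insert x V) (\<lambda>_. {..<N}). g \<tau>) = (\<Sum>(v, \<tau>)\<in>{..<N} \<times> PiE V (\<lambda>_. {..<N}). g (\<tau>(x := v)))"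
    unfolding PiE_insert_eq
    using sum.reindex[OF inj_combinator[OF assms(2), of "\<lambda>_. {..<N}"], of g]
    by (simp add: case_prod_beta' comp_def)
  also have "\<dots> = (\<Sum>v<N. \<Sum>\<tau>\<in>PiE V (\<lambda>_. {..<N}). g (\<tau>(x := v)))"
    by (rule sum.cartesian_product[symmetric])
  finally show ?thesis
    using assms unfolding av_def by (simp add: sum_divide_distrib[symmetric] mult.commute)
qed

lemma av_remove:
  assumes "finite V" "x \<in> V"
  shows "av V N g = (\<Sum>v<N. av (V - {x}) N (\<lambda>\<tau>. g (\<tau>(x := v)))) / real N"
  using av_insert[of "V - {x}" x N g] assms by (simp add: insert_absorb)

lemma av_add: "av V N (\<lambda>\<tau>. f \<tau> + g \<tau>) = av V N f + av V N g"
  by (simp add: av_def sum.distrib add_divide_distrib)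

lemma av_diff: "av V N (\<lambda>\<tau>. f \<tau> - g \<tau>) = av V N f - av V N g"
  by (simp add: av_def sum_subtractf diff_divide_distrib)

lemma av_cmult: "av V N (\<lambda>\<tau>. c * f \<tau>) = c * av V N f"
  by (simp add: av_def sum_distrib_left[symmetric])

lemma av_sum: "av V N (\<lambda>\<tau>. \<Sum>i\<in>I. f i \<tau>) = (\<Sum>i\<in>I. av V N (f i))"
  by (simp add: av_def sum.swap[of _ I] sum_divide_distrib)

lemma av_mono:
  "(\<And>\<tau>. \<tau> \<in> PiE V (\<lambda>_. {..<N}) \<Longrightarrow> f \<tau> \<le> g \<tau>) \<Longrightarrow> av V N f \<le> av V N g"
  unfolding av_def by (intro divide_right_mono sum_mono) auto

lemma av_cong:
  "(\<And>\<tau>. \<tau> \<in> PiE V (\<lambda>_. {..<N}) \<Longrightarrow> f \<tau> = g \<tau>) \<Longrightarrow> av V N f = av V N g"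
  unfolding av_def by (intro arg_cong2[of _ _ _ _ "(/)"] sum.cong) auto

lemma av_const: "finite V \<Longrightarrow> 0 < N \<Longrightarrow> av V N (\<lambda>_. c) = c"
  by (simp add: av_def card_PiE)

text \<open>Jensen's inequality for the convex function 2^(-t), by averaging its tangent at the
  mean.\<close>

lemma av_powr_ge:
  assumes "finite V" "0 < N"
  shows "2 powr (- av V N f) \<le> av V N (\<lambda>\<tau>. 2 powr (- f \<tau>))"
proof -
  let ?m = "av V N f"
  have "2 powr (- ?m) = av V N (\<lambda>\<tau>. 2 powr (- ?m) * (1 + (?m - f \<tau>) * ln 2))"
  proof -
    have "av V N (\<lambda>\<tau>. 1 + (?m - f \<tau>) * ln 2) = av V N (\<lambda>\<tau>. (1 + ?m * ln 2) - ln 2 * f \<tau>)"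
      by (intro av_cong) (simp add: algebra_simps)
    also have "\<dots> = 1"
      unfolding av_diff av_cmult by (simp add: av_const assms)
    finally show ?thesis by (simp add: av_cmult)
  qed
  also have "\<dots> \<le> av V N (\<lambda>\<tau>. 2 powr (- f \<tau>))"
  proof (rule av_mono)
    fix \<tau>
    have "1 + (?m - f \<tau>) * ln 2 \<le> exp ((?m - f \<tau>) * ln 2)" by (rule exp_ge_add_one_self)
    also have "\<dots> = 2 powr (?m - f \<tau>)" by (simp add: powr_def)
    finally have "2 powr (- ?m) * (1 + (?m - f \<tau>) * ln 2) \<le> 2 powr (- ?m) * 2 powr (?m - f \<tau>)"
      by (intro mult_left_mono) auto
    then show "2 powr (- ?m) * (1 + (?m - f \<tau>) * ln 2) \<le> 2 powr (- f \<tau>)"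
      by (simp add: powr_add[symmetric])
  qed
  finally show ?thesis .
qed

definition share :: "nat \<Rightarrow> (nat \<Rightarrow> bool) \<Rightarrow> real" where
  "share N P = real (card {v. v < N \<and> P v}) / real N"

lemma av_all:
  assumes "finite V"
  shows "av V N (\<lambda>\<tau>. of_bool (\<forall>y\<in>V. P y (\<tau> y))) = (\<Prod>y\<in>V. share N (P y))"
proof -
  have "(\<Sum>\<tau>\<in>PiE V (\<lambda>_. {..<N}). (of_bool (\<forall>y\<in>V. P y (\<tau> y)) :: real))
     = (\<Sum>\<tau>\<in>PiE V (\<lambda>_. {..<N}). \<Prod>y\<in>V. of_bool (P y (\<tau> y)))"
    using assms by (intro sum.cong refl) (auto simp: prod_zero_iff intro!: prod.neutral[symmetric])
  also have "\<dots> = (\<Prod>y\<in>V. \<Sum>v<N. of_bool (P y v))"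
    by (rule prod_sum_PiE[symmetric]) (use assms in auto)
  also have "(\<lambda>y. \<Sum>v<N. (of_bool (P y v) :: real)) = (\<lambda>y. real (card {v. v < N \<and> P y v}))"
    by (auto simp: of_bool_def sum.If_cases Int_def lessThan_def)
  finally show ?thesis
    by (simp add: av_def share_def prod_dividef)
qed

lemma share_True: "0 < N \<Longrightarrow> share N (\<lambda>_. True) = 1"
  by (simp add: share_def)

lemma av_2:
  assumes "finite V" "0 < N" "x \<in> V" "y \<in> V" "x \<noteq> y"
  shows "av V N (\<lambda>\<tau>. of_bool (P (\<tau> x) \<and> Q (\<tau> y))) = share N P * share N Q"
proof -
  let ?P = "\<lambda>v. if v = x then P else if v = y then Q else (\<lambda>_. True)"
  have iff: "(P (\<tau> x) \<and> Q (\<tau> y)) = (\<forall>v\<in>V. ?P v (\<tau> v))" for \<tau>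
  proof
    assume "\<forall>v\<in>V. ?P v (\<tau> v)"
    from this[rule_format, OF assms(3)] this[rule_format, OF assms(4)] show "P (\<tau> x) \<and> Q (\<tau> y)"
      using assms(5) by simp
  qed simp
  have "av V N (\<lambda>\<tau>. of_bool (P (\<tau> x) \<and> Q (\<tau> y))) = av V N (\<lambda>\<tau>. of_bool (\<forall>v\<in>V. ?P v (\<tau> v)))"
    by (simp only: iff)
  also have "\<dots> = (\<Prod>v\<in>V. share N (?P v))" by (rule av_all[OF assms(1)])
  also have "\<dots> = (\<Prod>v\<in>insert x (insert y (V - {x, y})). share N (?P v))"
    using assms by (intro prod.cong) auto
  also have "\<dots> = share N P * (share N Q * (\<Prod>v\<in>V - {x, y}. share N (?P v)))"
    using assms by simp
  also have "(\<Prod>v\<in>V - {x, y}. share N (?P v)) = 1"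
    using assms by (intro prod.neutral) (auto simp: share_True)
  finally show ?thesis by simp
qed

lemma av_3:
  assumes "finite V" "0 < N" "x \<in> V" "y \<in> V" "z \<in> V" "x \<noteq> y" "x \<noteq> z" "y \<noteq> z"
  shows "av V N (\<lambda>\<tau>. of_bool (P (\<tau> x) \<and> Q (\<tau> y) \<and> R (\<tau> z))) = share N P * share N Q * share N R"
proof -
  let ?P = "\<lambda>v. if v = x then P else if v = y then Q else if v = z then R else (\<lambda>_. True)"
  have iff: "(P (\<tau> x) \<and> Q (\<tau> y) \<and> R (\<tau> z)) = (\<forall>v\<in>V. ?P v (\<tau> v))" for \<tau>
  proof
    assume "\<forall>v\<in>V. ?P v (\<tau> v)"
    from this[rule_format, OF assms(3)] this[rule_format, OF assms(4)] this[rule_format, OF assms(5)] show "P (\<tau> x) \<and> Q (\<tau> y) \<and> R (\<tau> z)"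
      using assms(6-8) by simp
  qed simp
  have "av V N (\<lambda>\<tau>. of_bool (P (\<tau> x) \<and> Q (\<tau> y) \<and> R (\<tau> z))) = av V N (\<lambda>\<tau>. of_bool (\<forall>v\<in>V. ?P v (\<tau> v)))"
    by (simp only: iff)
  also have "\<dots> = (\<Prod>v\<in>V. share N (?P v))" by (rule av_all[OF assms(1)])
  also have "\<dots> = (\<Prod>v\<in>insert x (insert y (insert z (V - {x, y, z}))). share N (?P v))"
    using assms by (intro prod.cong) auto
  also have "\<dots> = share N P * (share N Q * (share N R * (\<Prod>v\<in>V - {x, y, z}. share N (?P v))))"
    using assms by simp
  also have "(\<Prod>v\<in>V - {x, y, z}. share N (?P v)) = 1"
    using assms by (intro prod.neutral) (auto simp: share_True)
  finally show ?thesis by simp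
qed

section \<open>Random subsets containing each element with probability t, and Harris'
  inequality\<close>

definition bern :: "real \<Rightarrow> 'a set \<Rightarrow> ('a set \<Rightarrow> real) \<Rightarrow> real" where
  "bern t V f = (\<Sum>S\<in>Pow V. t ^ card S * (1 - t) ^ card (V - S) * f S)"

lemma bern_empty [simp]: "bern t {} f = f {}"
  by (simp add: bern_def)

lemma bern_insert:
  assumes "finite V" "x \<notin> V"
  shows "bern t (insert x V) f = t * bern t V (\<lambda>S. f (insert x S)) + (1 - t) * bern t V f"
proof -
  have inj: "inj_on (insert x) (Pow V)" using assms by (auto simp: inj_on_def)
  have "bern t (insert x V) f = (\<Sum>S\<in>Pow V. t ^ card S * (1 - t) ^ card (insert x V - S) * f S)
     + (\<Sum>S\<in>insert x ` Pow V. t ^ card S * (1 - t) ^ card (insert x V - S) * f S)"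
    unfolding bern_def Pow_insert using assms by (intro sum.union_disjoint) auto
  also have "(\<Sum>S\<in>insert x ` Pow V. t ^ card S * (1 - t) ^ card (insert x V - S) * f S)
     = (\<Sum>S\<in>Pow V. t ^ card (insert x S) * (1 - t) ^ card (insert x V - insert x S) * f (insert x S))"
    using inj by (simp add: sum.reindex)
  also have "\<dots> = t * bern t V (\<lambda>S. f (insert x S))"
    unfolding bern_def sum_distrib_left
  proof (intro sum.cong refl)
    fix S assume "S \<in> Pow V"
    then have "finite S" "x \<notin> S" "insert x V - insert x S = V - S" using assms finite_subset by auto
    then show "t ^ card (insert x S) * (1 - t) ^ card (insert x V - insert x S) * f (insert x S) =
      t * (t ^ card S * (1 - t) ^ card (V - S) * f (insert x S))" by simp
  qed
  also have "(\<Sum>S\<in>Pow V. t ^ card S * (1 - t) ^ card (insert x V - S) * f S) = (1 - t) * bern t V f"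
    unfolding bern_def sum_distrib_left
  proof (intro sum.cong refl)
    fix S assume "S \<in> Pow V"
    then have "insert x V - S = insert x (V - S)" "x \<notin> V - S" "finite (V - S)" using assms by auto
    then show "t ^ card S * (1 - t) ^ card (insert x V - S) * f S =
      (1 - t) * (t ^ card S * (1 - t) ^ card (V - S) * f S)" by simp
  qed
  finally show ?thesis by simp
qed

lemma bern_const: "finite V \<Longrightarrow> bern t V (\<lambda>_. c) = c"
  by (induction rule: finite_induct) (auto simp: bern_insert algebra_simps)

lemma bern_mono:
  assumes "0 \<le> t" "t \<le> 1" "\<And>S. S \<subseteq> V \<Longrightarrow> f S \<le> g S"
  shows "bern t V f \<le> bern t V g"
  unfolding bern_def using assms by (intro sum_mono mult_left_mono) auto

lemma bern_irrelevant:
  assumes "finite V" "y \<in> V" "\<And>S. f (insert y S) = f S"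
  shows "bern t V f = bern t (V - {y}) f"
  using bern_insert[of "V - {y}" y t f] assms by (simp add: insert_absorb algebra_simps)

text \<open>Splitting off \<open>x\<close>, the conditional means of both functions increase when
  \<open>x\<close> joins the subset. The covariance gained from \<open>x\<close> is t (1 - t) times
  the product of the two increments, hence not negative.\<close>

lemma harris:
  assumes "finite V" "0 \<le> t" "t \<le> 1" "mono f" "mono g"
  shows "bern t V f * bern t V g \<le> bern t V (\<lambda>S. f S * g S)"
  using assms(1,4,5)
proof (induction arbitrary: f g rule: finite_induct)
  case (insert x V)
  define f1 where "f1 S = f (insert x S)" for S
  define g1 where "g1 S = g (insert x S)" for S
  have "mono f1"
    unfolding f1_def by (rule monoI, rule monoD[OF insert.prems(1)], blast)
  moreover have "mono g1"
    unfolding g1_def by (rule monoI, rule monoD[OF insert.prems(2)], blast)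
  ultimately have mono1: "mono f1" "mono g1" by blast+
  have le: "bern t V h \<le> bern t V (\<lambda>S. h (insert x S))" if "mono h" for h
    by (rule bern_mono[OF assms(2,3)], rule monoD[OF that], blast)
  have le: "bern t V f \<le> bern t V f1" "bern t V g \<le> bern t V g1"
    unfolding f1_def g1_def by (rule le[OF insert.prems(1)], rule le[OF insert.prems(2)])
  let ?p = "t * (bern t V f1 * bern t V g1) + (1 - t) * (bern t V f * bern t V g)"
  have "bern t (insert x V) f * bern t (insert x V) g
     = (t * bern t V f1 + (1 - t) * bern t V f) * (t * bern t V g1 + (1 - t) * bern t V g)"
    unfolding bern_insert[OF insert.hyps(1,2)] f1_def[abs_def] g1_def[abs_def] ..
  also have "\<dots> = ?p - t * (1 - t) * ((bern t V f1 - bern t V f) * (bern t V g1 - bern t V g))"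
    by (simp add: algebra_simps)
  also have "\<dots> \<le> ?p"
    using le assms(2,3) by (simp add: mult_nonneg_nonneg)
  also have "\<dots> \<le> t * bern t V (\<lambda>S. f1 S * g1 S) + (1 - t) * bern t V (\<lambda>S. f S * g S)"
    using insert.IH[OF mono1] insert.IH[OF insert.prems] assms(2,3)
    by (intro add_mono mult_left_mono) auto
  also have "\<dots> = bern t (insert x V) (\<lambda>S. f S * g S)"
    unfolding bern_insert[OF insert.hyps(1,2)] f1_def[abs_def] g1_def[abs_def] ..
  finally show ?case .
qed simp

text \<open>Increasing events are positively correlated even if they depend on common variables.
  This is what allows critical clause trees in which a variable occurs on several branches.\<close>

lemma harris_all:
  assumes "finite V" "0 \<le> t" "t \<le> 1" "finite Y" "\<And>y S S'. y \<in> Y \<Longrightarrow> S \<subseteq> S' \<Longrightarrow> E y S \<Longrightarrow> E y S'"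
    and "\<And>y. y \<in> Y \<Longrightarrow> u \<le> bern t V (\<lambda>S. of_bool (E y S))" "0 \<le> u"
  shows "u ^ card Y \<le> bern t V (\<lambda>S. of_bool (\<forall>y\<in>Y. E y S))"
  using assms(4-6)
proof (induction rule: finite_induct)
  case empty
  then show ?case using assms(1) by (simp add: bern_const)
next
  case (insert y Y)
  have "u ^ card (insert y Y) \<le> bern t V (\<lambda>S. of_bool (E y S)) * bern t V (\<lambda>S. of_bool (\<forall>y\<in>Y. E y S))"
    using insert assms(7) by (auto intro!: mult_mono order_trans[OF assms(7) insert.prems(2)])
  also have "\<dots> \<le> bern t V (\<lambda>S. of_bool (E y S) * of_bool (\<forall>y\<in>Y. E y S))"
  proof (rule harris[OF assms(1-3)])
    show "mono (\<lambda>S. of_bool (E y S) :: real)"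
      using insert.prems(1)[of y] by (auto simp: mono_def of_bool_def)
    show "mono (\<lambda>S. of_bool (\<forall>y\<in>Y. E y S) :: real)"
      using insert.prems(1) unfolding mono_def of_bool_def by (auto; blast)
  qed
  also have "\<dots> = bern t V (\<lambda>S. of_bool (\<forall>y\<in>insert y Y. E y S))"
    by (intro arg_cong[of _ _ "bern t V"]) auto
  finally show ?case .
qed

text \<open>For a fixed threshold, the variables with an earlier time form a random subset of
  density \<open>r / N\<close>.\<close>

lemma av_below:
  assumes "finite V" "0 < N" "r \<le> N"
  shows "av V N (\<lambda>\<tau>. f {y \<in> V. \<tau> y < r}) = bern (real r / real N) V f"
  using assms(1)
proof (induction arbitrary: f rule: finite_induct)
  case empty
  then show ?case by (simp add: av_def)
next
  case (insert x V)
  let ?t = "real r / real N"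
  have "av (insert x V) N (\<lambda>\<tau>. f {y \<in> insert x V. \<tau> y < r})
     = (\<Sum>v<N. av V N (\<lambda>\<tau>. f {y \<in> insert x V. (\<tau>(x := v)) y < r})) / real N"
    by (rule av_insert[OF insert.hyps])
  also have "(\<Sum>v<N. av V N (\<lambda>\<tau>. f {y \<in> insert x V. (\<tau>(x := v)) y < r}))
     = (\<Sum>v<N. if v < r then bern ?t V (\<lambda>S. f (insert x S)) else bern ?t V f)"
  proof (intro sum.cong refl)
    fix v
    have "{y \<in> insert x V. (\<tau>(x := v)) y < r} = (if v < r then insert x {y \<in> V. \<tau> y < r} else {y \<in> V. \<tau> y < r})" for \<tau>
      using insert.hyps by auto
    then show "av V N (\<lambda>\<tau>. f {y \<in> insert x V. (\<tau>(x := v)) y < r})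
       = (if v < r then bern ?t V (\<lambda>S. f (insert x S)) else bern ?t V f)"
      using insert.IH[of "\<lambda>S. f (insert x S)"] insert.IH[of f] by simp
  qed
  also have "\<dots> = real r * bern ?t V (\<lambda>S. f (insert x S)) + real (N - r) * bern ?t V f"
  proof -
    have "{..<N} \<inter> {v. v < r} = {..<r}" "{..<N} \<inter> - {v. v < r} = {r..<N}" using assms(3) by auto
    then show ?thesis by (simp add: sum.If_cases)
  qed
  also have "\<dots> / real N = ?t * bern ?t V (\<lambda>S. f (insert x S)) + (1 - ?t) * bern ?t V f"
    using assms(2,3) by (simp add: field_simps of_nat_diff)
  finally show ?case using insert.hyps by (simp add: bern_insert)
qed

text \<open>Lower bound for the probability that a binary critical clause tree of depth \<open>d + 1\<close> is cut
  at time \<open>t\<close>.\<close>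

primrec cut_prob :: "nat \<Rightarrow> real \<Rightarrow> real" where
  "cut_prob 0 t = t\<^sup>2"
| "cut_prob (Suc d) t = (t + (1 - t) * cut_prob d t)\<^sup>2"

lemma cut_prob_bounds:
  assumes "0 \<le> t" "t \<le> 1"
  shows "0 \<le> cut_prob d t" "cut_prob d t \<le> 1"
proof -
  have "cut_prob d t \<le> 1"
  proof (induction d)
    case 0
    show ?case using assms by (simp add: power_le_one)
  next
    case (Suc d)
    have "0 \<le> cut_prob d t" by (cases d) auto
    moreover have "(1 - t) * cut_prob d t \<le> (1 - t) * 1"
      using Suc assms by (intro mult_left_mono) auto
    ultimately show ?case using assms by (simp add: power_le_one)
  qed
  then show "cut_prob d t \<le> 1" .
  show "0 \<le> cut_prob d t" by (cases d) auto
qed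

section \<open>Probability that a critical clause tree is cut\<close>

context unique_cnf
begin

lemma cut_mono: "cut d W S \<Longrightarrow> S \<subseteq> S' \<Longrightarrow> cut d W S'"
  by (induction d arbitrary: W) auto

text \<open>\<open>children\<close> excludes the path, so a variable on the path never reappears
  below it. This makes the event that a subtree is cut independent of the variable at its
  root.\<close>

lemma cut_insert: "y \<in> W \<Longrightarrow> cut d W (insert y S) = cut d W S"
proof (induction d arbitrary: W)
  case 0
  then show ?case by (auto simp: children_def)
next
  case (Suc d)
  have "cut d (insert z W) (insert y S) = cut d (insert z W) S" for z
    using Suc by auto
  moreover have "y \<notin> children W" using Suc.prems by (simp add: children_def)
  ultimately show ?case by auto
qed

text \<open>A child is harmless if it is in the subset or else its subtree is cut, which by
  independence has probability at least \<open>t + (1 - t) * cut_prob d t\<close>. Harris'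
  inequality multiplies this over the children, and fewer than two children only increase the
  bound.\<close>

lemma bern_cut:
  assumes "x \<in> W" "W \<subseteq> {..<n}" "0 \<le> t" "t \<le> 1"
  shows "cut_prob d t \<le> bern t {..<n} (\<lambda>S. of_bool (cut d W S))"
  using assms(1,2)
proof (induction d arbitrary: W)
  case 0
  have x: "x < n" using 0 by auto
  have in_S: "t \<le> bern t {..<n} (\<lambda>S. of_bool (y \<in> S))" if "y \<in> children W" for y
  proof -
    have y: "y < n" using children(3)[OF 0(1) x] that by auto
    then have eq: "{..<n} = insert y ({..<n} - {y})" by auto
    have "bern t {..<n} (\<lambda>S. of_bool (y \<in> S)) =
      t * bern t ({..<n} - {y}) (\<lambda>S. of_bool (y \<in> insert y S)) + (1 - t) * bern t ({..<n} - {y}) (\<lambda>S. of_bool (y \<in> S))"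
      by (subst eq, subst bern_insert) auto
    then have "bern t {..<n} (\<lambda>S. of_bool (y \<in> S)) = t + (1 - t) * bern t ({..<n} - {y}) (\<lambda>S. of_bool (y \<in> S))"
      by (simp add: bern_const)
    moreover have "bern t ({..<n} - {y}) (\<lambda>S. 0) \<le> bern t ({..<n} - {y}) (\<lambda>S. of_bool (y \<in> S))"
      using assms by (intro bern_mono) auto
    ultimately show ?thesis using assms(3,4) by (simp add: bern_const)
  qed
  have "cut_prob 0 t \<le> t ^ card (children W)"
    using power_decreasing[OF children(2)[OF 0(1) x] assms(3,4)] by simp
  also have "\<dots> \<le> bern t {..<n} (\<lambda>S. of_bool (\<forall>y\<in>children W. y \<in> S))"
    by (rule harris_all) (use assms in_S children(1)[OF 0(1) x] in auto)
  also have "\<dots> = bern t {..<n} (\<lambda>S. of_bool (cut 0 W S))"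
    by (simp add: subset_eq)
  finally show ?case .
next
  case (Suc d)
  have x: "x < n" using Suc by auto
  let ?u = "t + (1 - t) * cut_prob d t"
  have u: "0 \<le> ?u" "?u \<le> 1"
    using cut_prob_bounds[OF assms(3,4), of d] assms(3,4) mult_left_mono[of "cut_prob d t" 1 "1 - t"] by auto
  have E: "?u \<le> bern t {..<n} (\<lambda>S. of_bool (y \<in> S \<or> cut d (insert y W) S))" if "y \<in> children W" for y
  proof -
    have y: "y < n" using children(3)[OF Suc.prems(1) x] that by auto
    then have eq: "{..<n} = insert y ({..<n} - {y})" by auto
    let ?f = "\<lambda>S. of_bool (y \<in> S \<or> cut d (insert y W) S) :: real"
    have "bern t {..<n} ?f = t * bern t ({..<n} - {y}) (\<lambda>S. ?f (insert y S)) + (1 - t) * bern t ({..<n} - {y}) ?f"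
      by (subst eq, subst bern_insert) auto
    also have "bern t ({..<n} - {y}) (\<lambda>S. ?f (insert y S)) = 1"
      using bern_const[of "{..<n} - {y}" t 1] by simp
    finally have eq: "bern t {..<n} ?f = t * 1 + (1 - t) * bern t ({..<n} - {y}) ?f" .
    have "cut_prob d t \<le> bern t {..<n} (\<lambda>S. of_bool (cut d (insert y W) S))"
      using Suc.prems y by (intro Suc.IH) auto
    also have "\<dots> = bern t ({..<n} - {y}) (\<lambda>S. of_bool (cut d (insert y W) S))"
      using y by (intro bern_irrelevant) (auto simp: cut_insert)
    also have "\<dots> \<le> bern t ({..<n} - {y}) ?f"
      using assms by (intro bern_mono) auto
    finally show ?thesis unfolding eq using assms(3,4) by (simp add: mult_left_mono)
  qed
  have "cut_prob (Suc d) t \<le> ?u ^ card (children W)"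
    using power_decreasing[OF children(2)[OF Suc.prems(1) x] u] by simp
  also have "\<dots> \<le> bern t {..<n} (\<lambda>S. of_bool (\<forall>y\<in>children W. y \<in> S \<or> cut d (insert y W) S))"
    by (rule harris_all) (use assms E u children(1)[OF Suc.prems(1) x] in \<open>auto intro: cut_mono\<close>)
  finally show ?case by simp
qed

text \<open>Conditioning on the time \<open>v\<close> of \<open>x\<close> turns the earlier
  variables into a random subset of density \<open>v / N\<close>; \<open>x\<close> itself, being the
  root, has no influence on the cut.\<close>

lemma av_cut:
  assumes x: "x < n" and N: "0 < N"
  shows "av {..<n} N (\<lambda>\<tau>. of_bool (P (\<tau> x) \<and> \<not> cut d {x} {y. y < n \<and> \<tau> y < \<tau> x}))
     \<le> (\<Sum>v | v < N \<and> P v. 1 - cut_prob d (real v / real N)) / real N"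
proof -
  let ?V = "{..<n} - {x}"
  have "av {..<n} N (\<lambda>\<tau>. of_bool (P (\<tau> x) \<and> \<not> cut d {x} {y. y < n \<and> \<tau> y < \<tau> x}))
     = (\<Sum>v<N. av ?V N (\<lambda>\<tau>. of_bool (P v \<and> \<not> cut d {x} {y. y < n \<and> (\<tau>(x := v)) y < v}))) / real N"
    using x by (subst av_remove[of _ x]) auto
  also have "(\<Sum>v<N. av ?V N (\<lambda>\<tau>. of_bool (P v \<and> \<not> cut d {x} {y. y < n \<and> (\<tau>(x := v)) y < v})))
    \<le> (\<Sum>v<N. of_bool (P v) * (1 - cut_prob d (real v / real N)))"
  proof (rule sum_mono)
    fix v assume v: "v \<in> {..<N}"
    have eq: "{y. y < n \<and> (\<tau>(x := v)) y < v} = {y \<in> ?V. \<tau> y < v}" for \<tau> by auto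
    show "av ?V N (\<lambda>\<tau>. of_bool (P v \<and> \<not> cut d {x} {y. y < n \<and> (\<tau>(x := v)) y < v}))
       \<le> of_bool (P v) * (1 - cut_prob d (real v / real N))"
    proof (cases "P v")
      case True
      have "av ?V N (\<lambda>\<tau>. of_bool (P v \<and> \<not> cut d {x} {y. y < n \<and> (\<tau>(x := v)) y < v}))
        = av ?V N (\<lambda>\<tau>. 1 - of_bool (cut d {x} {y \<in> ?V. \<tau> y < v}))"
        unfolding eq using True by (simp add: of_bool_not_iff)
      also have "\<dots> = 1 - bern (real v / real N) ?V (\<lambda>S. of_bool (cut d {x} S))"
      proof -
        have "av ?V N (\<lambda>\<tau>. of_bool (cut d {x} {y \<in> ?V. \<tau> y < v})) = bern (real v / real N) ?V (\<lambda>S. of_bool (cut d {x} S))"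
          by (rule av_below) (use v N in auto)
        then show ?thesis by (simp only: av_diff) (simp add: av_const N)
      qed
      also have "bern (real v / real N) ?V (\<lambda>S. of_bool (cut d {x} S)) = bern (real v / real N) {..<n} (\<lambda>S. of_bool (cut d {x} S))"
        using x by (intro bern_irrelevant[symmetric]) (auto simp: cut_insert)
      also have "1 - \<dots> \<le> 1 - cut_prob d (real v / real N)"
        using x v bern_cut[of x "{x}" "real v / real N" d] by auto
      also have "\<dots> = of_bool (P v) * (1 - cut_prob d (real v / real N))"
        using True by simp
      finally show ?thesis .
    qed (simp add: av_const N)
  qed
  also have "\<dots> = (\<Sum>v | v < N \<and> P v. 1 - cut_prob d (real v / real N))"
    by (intro sum.mono_neutral_cong_right) auto
  finally show ?thesis by (simp add: divide_right_mono)
qed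

end

section \<open>Votes\<close>

definition clamp2 :: "int \<Rightarrow> int" where
  "clamp2 k = max (- 2) (min 2 k)"

lemma card_words: "card {e :: bool list. length e = J} = 2 ^ J"
  using card_lists_length_eq[of "UNIV :: bool set" J] by simp

lemma finite_words: "finite {e :: bool list. length e = J \<and> P e}"
  using finite_lists_length_eq[of "UNIV :: bool set" J] by (rule rev_finite_subset) auto

text \<open>Each tail in \<open>Z\<close> has one word of either first bit; overriding makes both
  count for \<open>d\<close>, which shifts the balance by the size of \<open>Z\<close>.\<close>

lemma card_override:
  "real (card {w. length w = Suc J \<and> (if Z (tl w) then d else coin w) = b})
     = 2 ^ J + (if d = b then 1 else - 1) * real (card {e. length e = J \<and> Z e})"
proof -
  let ?E = "{e :: bool list. length e = J}" and ?Z = "{e. length e = J \<and> Z e}"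
  have eq: "{w. length w = Suc J \<and> (if Z (tl w) then d else coin w) = b}
     = (#) b ` {e. length e = J \<and> \<not> Z e} \<union> (if d = b then (#) b ` ?Z \<union> (#) (\<not> b) ` ?Z else {})"
    (is "?L = ?R")
  proof (rule set_eqI)
    fix w show "w \<in> ?L \<longleftrightarrow> w \<in> ?R"
      by (cases w) (auto simp: coin_def)
  qed
  have "card ?L = card ((#) b ` {e. length e = J \<and> \<not> Z e})
      + card (if d = b then (#) b ` ?Z \<union> (#) (\<not> b) ` ?Z else {})"
    unfolding eq by (rule card_Un_disjoint) (auto simp: finite_words)
  also have "card (if d = b then (#) b ` ?Z \<union> (#) (\<not> b) ` ?Z else {}) = (if d = b then 2 * card ?Z else 0)"
  proof -
    have "card ((#) b ` ?Z \<union> (#) (\<not> b) ` ?Z) = card ((#) b ` ?Z) + card ((#) (\<not> b) ` ?Z)"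
      by (rule card_Un_disjoint) (auto simp: finite_words)
    then show ?thesis by (simp add: card_image)
  qed
  also have "card ((#) b ` {e. length e = J \<and> \<not> Z e}) = card {e. length e = J \<and> \<not> Z e}"
    by (simp add: card_image)
  finally have 1: "card ?L = card {e. length e = J \<and> \<not> Z e} + (if d = b then 2 * card ?Z else 0)" .
  have "?E = {e. length e = J \<and> \<not> Z e} \<union> ?Z" by auto
  then have "card ?E = card {e. length e = J \<and> \<not> Z e} + card ?Z"
    by (simp only:) (rule card_Un_disjoint, auto simp: finite_words)
  then have "real (card {e. length e = J \<and> \<not> Z e}) + real (card ?Z) = 2 ^ J"
    unfolding card_words by (metis of_nat_add of_nat_numeral of_nat_power)
  moreover have "real (y + (if d = b then 2 * z else 0)) = 2 ^ J + (if d = b then 1 else - 1) * real z"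
    if "real y + real z = 2 ^ J" for y z
    using that by auto
  ultimately show ?thesis unfolding 1 by blast
qed

text \<open>A shift by 1 is obtained from a single tail, a shift by 2 from the two tails that begin
  with \<open>J - 1\<close> bits \<open>True\<close>; the latter needs a nonempty tail.\<close>

lemma card_biased:
  assumes "0 < J"
  shows "real (card {w. length w = Suc J \<and> biased J p q w = b})
     = 2 ^ J + real_of_int (clamp2 (if b then int p - int q else int q - int p))"
proof -
  have z1: "card {e. length e = J \<and> e = replicate J True} = 1"
  proof -
    have "{e. length e = J \<and> e = replicate J True} = {replicate J True}" by auto
    then show ?thesis by simp
  qed
  have z2: "card {e. length e = J \<and> take (J - 1) e = replicate (J - 1) True} = 2"
  proof -
    have "{e. length e = J \<and> take (J - 1) e = replicate (J - 1) True}
       = {replicate (J - 1) True @ [True], replicate (J - 1) True @ [False]}" (is "?L = ?R")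
    proof
      show "?L \<subseteq> ?R"
      proof
        fix e assume "e \<in> ?L"
        then have e: "length e = J" "take (J - 1) e = replicate (J - 1) True" by auto
        then have "e = take (J - 1) e @ [last e]"
          using assms by (metis append_butlast_last_id butlast_conv_take length_greater_0_conv)
        then have "e = replicate (J - 1) True @ [last e]" using e by metis
        then show "e \<in> ?R" by (cases "last e") auto
      qed
    qed (use assms in auto)
    then show ?thesis by simp
  qed
  consider "p = q" | "p \<noteq> q" "p = Suc q \<or> q = Suc p" | "p \<noteq> q" "\<not> (p = Suc q \<or> q = Suc p)" by blast
  then show ?thesis
  proof cases
    case 1
    then show ?thesis
      using card_override[of J "\<lambda>_. False" True b] by (simp add: biased_def clamp2_def)
  next
    case 2
    then have "{w. length w = Suc J \<and> biased J p q w = b}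
      = {w. length w = Suc J \<and> (if tl w = replicate J True then q < p else coin w) = b}"
      by (auto simp: biased_def)
    then show ?thesis
      using card_override[of J "\<lambda>e. e = replicate J True" "q < p" b] 2 z1 by (auto simp: clamp2_def)
  next
    case 3
    then have "{w. length w = Suc J \<and> biased J p q w = b}
      = {w. length w = Suc J \<and> (if take (J - 1) (tl w) = replicate (J - 1) True then q < p else coin w) = b}"
      by (auto simp: biased_def)
    then show ?thesis
      using card_override[of J "\<lambda>e. take (J - 1) e = replicate (J - 1) True" "q < p" b] 3 z2
      by (auto simp: clamp2_def)
  qed
qed

text \<open>If a clause has one true literal, \<open>tlits\<close> names its critical variable, so
  the first assumption says that every variable has at most one critical clause. The assumptions on
  \<open>a\<close> make A, B and B' unions of time slots of length 2^-K.\<close>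

locale one_critical_cnf = unique_cnf +
  fixes K a :: nat
  assumes one_critical: "c \<in> set cls \<Longrightarrow> c' \<in> set cls \<Longrightarrow> length (tlits c) = 1 \<Longrightarrow> tlits c = tlits c' \<Longrightarrow> c = c'"
    and a: "0 < a" "2 * a \<le> K"
begin

text \<open>The groups of the algorithm, in terms of times scaled to integers below \<open>2 ^ K\<close>.\<close>

definition "gA v \<longleftrightarrow> v < (2::nat) ^ (K - a)"
definition "gB v \<longleftrightarrow> (2::nat) ^ (K - a) \<le> v \<and> v < 2 * 2 ^ (K - a)"
definition "gB' v \<longleftrightarrow> (2::nat) ^ (K - a) \<le> v \<and> v < 2 ^ (K - a) + 2 ^ (K - 2 * a)"
definition "gC v \<longleftrightarrow> 2 * (2::nat) ^ (K - a) \<le> v"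

text \<open>The lengths of the time intervals: \<open>p\<close> of A and of B, \<open>q\<close> of
  C.\<close>

definition "p = 1 / (2::real) ^ a"
definition "q = 1 - 2 * p"

lemma pow_eq: "(2::nat) ^ K = 2 ^ (K - a) * 2 ^ a" "(2::nat) ^ (K - a) = 2 ^ (K - 2 * a) * 2 ^ a"
  using a by (simp_all add: power_add[symmetric])

lemma pow_le: "2 * (2::nat) ^ (K - a) \<le> 2 ^ K"
proof -
  have "(2::nat) ^ 1 \<le> 2 ^ a" using a by (intro power_increasing) auto
  then show ?thesis unfolding pow_eq(1) by simp
qed

lemma pow_le': "(2::nat) ^ (K - 2 * a) \<le> 2 ^ (K - a)"
  by (intro power_increasing) auto

lemma shares: "share (2 ^ K) gA = p" "share (2 ^ K) gB = p" "share (2 ^ K) gB' = p\<^sup>2" "share (2 ^ K) gC = q"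
proof -
  let ?m = "(2::nat) ^ (K - a)" and ?m' = "(2::nat) ^ (K - 2 * a)"
  have "{v. v < 2 ^ K \<and> gA v} = {..<?m}" "{v. v < 2 ^ K \<and> gB v} = {?m..<2 * ?m}"
    "{v. v < 2 ^ K \<and> gB' v} = {?m..<?m + ?m'}" "{v. v < 2 ^ K \<and> gC v} = {2 * ?m..<2 ^ K}"
    using pow_le pow_le' by (auto simp: gA_def gB_def gB'_def gC_def simp del: power_increasing_iff)
  then have c: "card {v. v < 2 ^ K \<and> gA v} = ?m" "card {v. v < 2 ^ K \<and> gB v} = ?m"
    "card {v. v < 2 ^ K \<and> gB' v} = ?m'" "card {v. v < 2 ^ K \<and> gC v} = 2 ^ K - 2 * ?m"
    by auto
  have r: "real (2 ^ K) = real ?m * 2 ^ a" "real ?m = real ?m' * 2 ^ a"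
    using pow_eq by (metis of_nat_mult of_nat_numeral of_nat_power)+
  show "share (2 ^ K) gA = p" "share (2 ^ K) gB = p"
    unfolding share_def c r(1) p_def by auto
  show "share (2 ^ K) gB' = p\<^sup>2"
    unfolding share_def c r(1) unfolding r(2) p_def by (auto simp: power2_eq_square)
  have "real (2 ^ K - 2 * ?m) = real (2 ^ K) - 2 * real ?m" using pow_le by (simp add: of_nat_diff)
  then show "share (2 ^ K) gC = q"
    unfolding share_def c unfolding r(1) q_def p_def by (auto simp: field_simps)
qed

lemma p_bounds: "0 < p" "p \<le> 1 / 2" "0 \<le> q"
proof -
  have "(2::real) ^ 1 \<le> 2 ^ a" using a by (intro power_increasing) auto
  then have "p \<le> 1 / 2" by (simp add: p_def field_simps)
  then show "p \<le> 1 / 2" "0 \<le> q" by (auto simp: q_def)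
qed (simp add: p_def)

lemma groups_disjoint: "gB v \<Longrightarrow> \<not> gA v" "gB v \<Longrightarrow> \<not> gC v" "gA v \<Longrightarrow> \<not> gC v" "gB' v \<Longrightarrow> gB v"
  "gA v \<or> gB v \<or> gC v"
  using pow_le' by (auto simp: gA_def gB_def gB'_def gC_def simp del: power_increasing_iff)

text \<open>What \<open>votes\<close> selects if the guesses in A are right. It depends on the times
  only, so that votes can be averaged before any guess is made.\<close>

definition supports :: "(nat \<Rightarrow> nat) \<Rightarrow> nat \<Rightarrow> (nat \<times> bool) list \<Rightarrow> bool" where
  "supports \<tau> x c \<longleftrightarrow> length (filter (\<lambda>l. gC (\<tau> (fst l))) c) = 1 \<and>
     (length c = 3 \<and> length (filter (\<lambda>l. gA (\<tau> (fst l)) \<and> \<alpha> (fst l) \<noteq> snd l) c) = 1 \<or>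
      length c = 2 \<and> gB' (\<tau> x))"

definition E :: "((nat \<Rightarrow> nat) \<Rightarrow> real) \<Rightarrow> real" where
  "E = av {..<n} (2 ^ K)"

definition vote_prob :: "(nat \<times> bool) list \<Rightarrow> nat \<Rightarrow> real" where
  "vote_prob c x = E (\<lambda>\<tau>. of_bool (gB (\<tau> x) \<and> supports \<tau> x c))"

lemma length_filter_mset: "mset c = mset d \<Longrightarrow> length (filter P c) = length (filter P d)"
  by (metis mset_filter size_mset)

lemma E_3:
  assumes "x < n" "y < n" "z < n" "x \<noteq> y" "x \<noteq> z" "y \<noteq> z"
  shows "E (\<lambda>\<tau>. of_bool (P (\<tau> x) \<and> Q (\<tau> y) \<and> R (\<tau> z))) = share (2 ^ K) P * share (2 ^ K) Q * share (2 ^ K) R"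
  unfolding E_def by (rule av_3) (use assms in auto)

text \<open>With \<open>l1\<close> over B, a vote needs one of the other literals to be false and
  over A and the last one to be over C: probability p^2 q for every choice of the false
  literal.\<close>

lemma vote_prob_3:
  assumes c: "c \<in> set cls" "mset c = mset [l1, l2, l3]"
  shows "vote_prob c (fst l1) = p\<^sup>2 * q * (of_bool (\<alpha> (fst l2) \<noteq> snd l2) + of_bool (\<alpha> (fst l3) \<noteq> snd l3))"
proof -
  have len: "length c = 3" using arg_cong[OF c(2), of size] by simp
  have set: "set c = {l1, l2, l3}" using arg_cong[OF c(2), of set_mset] by simp
  have less: "fst l1 < n" "fst l2 < n" "fst l3 < n" using vars_less[OF c(1)] set by auto
  have "mset (map fst c) = mset (map fst [l1, l2, l3])" using c(2) by simp
  then have "distinct (map fst [l1, l2, l3])" using distinct_vars[OF c(1)] mset_eq_imp_distinct_iff by blast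
  then have dist: "fst l1 \<noteq> fst l2" "fst l1 \<noteq> fst l3" "fst l2 \<noteq> fst l3" by auto
  let ?f2 = "of_bool (\<alpha> (fst l2) \<noteq> snd l2) :: real" and ?f3 = "of_bool (\<alpha> (fst l3) \<noteq> snd l3) :: real"
  have "vote_prob c (fst l1) = E (\<lambda>\<tau>. ?f3 * of_bool (gB (\<tau> (fst l1)) \<and> gC (\<tau> (fst l2)) \<and> gA (\<tau> (fst l3)))
     + ?f2 * of_bool (gB (\<tau> (fst l1)) \<and> gA (\<tau> (fst l2)) \<and> gC (\<tau> (fst l3))))"
    unfolding vote_prob_def supports_def len length_filter_mset[OF c(2)]
    by (intro arg_cong[of _ _ E] ext) (auto simp: groups_disjoint)
  also have "\<dots> = ?f3 * (p * q * p) + ?f2 * (p * p * q)"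
    unfolding E_def av_add av_cmult
    unfolding E_def[symmetric] using less dist by (simp add: E_3 shares)
  finally show ?thesis by (simp add: algebra_simps power2_eq_square)
qed

text \<open>The length p^2 of B' is chosen so that a clause with two literals has the same unit p^2
  q of influence as a falsified literal of a longer clause.\<close>

lemma vote_prob_2:
  assumes c: "c \<in> set cls" "mset c = mset [l1, l2]"
  shows "vote_prob c (fst l1) = p\<^sup>2 * q"
proof -
  have len: "length c = 2" using arg_cong[OF c(2), of size] by simp
  have set: "set c = {l1, l2}" using arg_cong[OF c(2), of set_mset] by simp
  have less: "fst l1 < n" "fst l2 < n" using vars_less[OF c(1)] set by auto
  have "mset (map fst c) = mset (map fst [l1, l2])" using c(2) by simp
  then have "distinct (map fst [l1, l2])" using distinct_vars[OF c(1)] mset_eq_imp_distinct_iff by blast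
  then have dist: "fst l1 \<noteq> fst l2" by auto
  have "vote_prob c (fst l1) = E (\<lambda>\<tau>. of_bool (gB' (\<tau> (fst l1)) \<and> gC (\<tau> (fst l2))))"
    unfolding vote_prob_def supports_def len length_filter_mset[OF c(2)]
    by (intro arg_cong[of _ _ E] ext) (auto simp: groups_disjoint)
  also have "\<dots> = p\<^sup>2 * q"
    unfolding E_def using less dist by (subst av_2) (auto simp: shares)
  finally show ?thesis .
qed

lemma vote_prob_1:
  assumes "length c < 2"
  shows "vote_prob c x = 0"
  using assms unfolding vote_prob_def supports_def E_def by (simp add: av_const)

lemma clause_cases:
  assumes "c \<in> set cls"
  obtains l where "c = [l]" | l1 l2 where "c = [l1, l2]" | l1 l2 l3 where "c = [l1, l2, l3]"
proof -
  have "c \<noteq> []" using sat[OF assms] by auto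
  moreover have "length c \<le> 3" by (rule le3[OF assms])
  ultimately consider "length c = 1" | "length c = 2" | "length c = 3"
    by (metis One_nat_def Suc_1 eval_nat_numeral(3) le_Suc_eq le_zero_eq length_0_conv)
  then show thesis using that by cases (auto simp: length_Suc_conv eval_nat_numeral)
qed

definition flits :: "(nat \<times> bool) list \<Rightarrow> (nat \<times> bool) list" where
  "flits c = filter (\<lambda>l. \<alpha> (fst l) \<noteq> snd l) c"

text \<open>In units of p^2 q, a critical clause with three literals votes twice at its true literal
  and once at each false one; with two literals it votes once at each. Right and wrong votes cancel
  on average.\<close>

lemma vote_prob_balance:
  assumes "c \<in> set cls" "length (tlits c) = 1"
  shows "(\<Sum>l\<leftarrow>tlits c. vote_prob c (fst l)) = (\<Sum>l\<leftarrow>flits c. vote_prob c (fst l))"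
    "(\<Sum>l\<leftarrow>tlits c. vote_prob c (fst l)) \<le> 2 * p\<^sup>2 * q"
proof -
  have pq: "0 \<le> p\<^sup>2 * q" "0 \<le> q * p\<^sup>2" using p_bounds by simp_all
  have "(\<Sum>l\<leftarrow>tlits c. vote_prob c (fst l)) = (\<Sum>l\<leftarrow>flits c. vote_prob c (fst l)) \<and>
    (\<Sum>l\<leftarrow>tlits c. vote_prob c (fst l)) \<le> 2 * p\<^sup>2 * q"
    using assms(1)
  proof (cases rule: clause_cases)
    case (1 l)
    then have "vote_prob c (fst l) = 0" by (intro vote_prob_1) auto
    then show ?thesis using 1 pq by (auto simp: tlits_def flits_def)
  next
    case (2 l1 l2)
    have v: "vote_prob c (fst l1) = p\<^sup>2 * q" "vote_prob c (fst l2) = p\<^sup>2 * q"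
      using vote_prob_2[OF assms(1), of l1 l2] vote_prob_2[OF assms(1), of l2 l1] 2
      by (auto simp: add_mset_commute)
    then show ?thesis using 2 assms(2) pq by (auto simp: tlits_def flits_def split: if_splits)
  next
    case (3 l1 l2 l3)
    have v: "vote_prob c (fst l1) = p\<^sup>2 * q * (of_bool (\<alpha> (fst l2) \<noteq> snd l2) + of_bool (\<alpha> (fst l3) \<noteq> snd l3))"
      "vote_prob c (fst l2) = p\<^sup>2 * q * (of_bool (\<alpha> (fst l1) \<noteq> snd l1) + of_bool (\<alpha> (fst l3) \<noteq> snd l3))"
      "vote_prob c (fst l3) = p\<^sup>2 * q * (of_bool (\<alpha> (fst l1) \<noteq> snd l1) + of_bool (\<alpha> (fst l2) \<noteq> snd l2))"
      using vote_prob_3[OF assms(1), of l1 l2 l3] vote_prob_3[OF assms(1), of l2 l1 l3]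
        vote_prob_3[OF assms(1), of l3 l1 l2] 3 by (auto simp: add_mset_commute)
    then show ?thesis using 3 assms(2) pq by (auto simp: tlits_def flits_def split: if_splits)
  qed
  then show "(\<Sum>l\<leftarrow>tlits c. vote_prob c (fst l)) = (\<Sum>l\<leftarrow>flits c. vote_prob c (fst l))"
    "(\<Sum>l\<leftarrow>tlits c. vote_prob c (fst l)) \<le> 2 * p\<^sup>2 * q" by auto
qed

text \<open>Apart from \<open>l\<close>, a clause with three literals of which two are true has
  exactly one false literal, hence one unit; a clause with two literals always has one.\<close>

lemma vote_prob_good:
  assumes "c \<in> set cls" "length (tlits c) = 2" "l \<in> set (tlits c)"
  shows "vote_prob c (fst l) = p\<^sup>2 * q"
  using assms(1)
proof (cases rule: clause_cases)
  case (1 l')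
  then show ?thesis using assms(2) by (auto simp: tlits_def split: if_splits)
next
  case (2 l1 l2)
  have "vote_prob c (fst l1) = p\<^sup>2 * q" "vote_prob c (fst l2) = p\<^sup>2 * q"
    using vote_prob_2[OF assms(1), of l1 l2] vote_prob_2[OF assms(1), of l2 l1] 2
    by (auto simp: add_mset_commute)
  then show ?thesis using 2 assms(3) by (auto simp: tlits_def split: if_splits)
next
  case (3 l1 l2 l3)
  have "vote_prob c (fst l1) = p\<^sup>2 * q * (of_bool (\<alpha> (fst l2) \<noteq> snd l2) + of_bool (\<alpha> (fst l3) \<noteq> snd l3))"
    "vote_prob c (fst l2) = p\<^sup>2 * q * (of_bool (\<alpha> (fst l1) \<noteq> snd l1) + of_bool (\<alpha> (fst l3) \<noteq> snd l3))"
    "vote_prob c (fst l3) = p\<^sup>2 * q * (of_bool (\<alpha> (fst l1) \<noteq> snd l1) + of_bool (\<alpha> (fst l2) \<noteq> snd l2))"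
    using vote_prob_3[OF assms(1), of l1 l2 l3] vote_prob_3[OF assms(1), of l2 l1 l3]
      vote_prob_3[OF assms(1), of l3 l1 l2] 3 by (auto simp: add_mset_commute)
  then show ?thesis using 3 assms(2,3) by (auto simp: tlits_def split: if_splits)
qed

definition critical_clauses :: "(nat \<times> bool) list set" where
  "critical_clauses = {c \<in> set cls. length (tlits c) = 1}"

text \<open>A critical clause is determined by its critical variable.\<close>

lemma card_critical_clauses: "card critical_clauses \<le> n"
proof -
  have tl: "\<exists>x<n. tlits c = [(x, \<alpha> x)]" if c: "c \<in> critical_clauses" for c
  proof -
    obtain l where l: "tlits c = [l]"
      using c by (cases "tlits c"; cases "tl (tlits c)") (auto simp: critical_clauses_def)
    then have "l \<in> set (tlits c)" by simp
    then have "l \<in> set c" "\<alpha> (fst l) = snd l" by (auto simp: tlits_def)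
    then show ?thesis using l vars_less[of c l] c
      by (intro exI[of _ "fst l"]) (auto simp: critical_clauses_def prod_eq_iff)
  qed
  have "card critical_clauses \<le> card {..<n}"
  proof (rule card_inj_on_le)
    show "inj_on (\<lambda>c. fst (hd (tlits c))) critical_clauses"
    proof (rule inj_onI)
      fix c c' assume c: "c \<in> critical_clauses" "c' \<in> critical_clauses" "fst (hd (tlits c)) = fst (hd (tlits c'))"
      then have "tlits c = tlits c'" using tl[OF c(1)] tl[OF c(2)] by auto
      then show "c = c'" using c one_critical by (auto simp: critical_clauses_def)
    qed
    show "(\<lambda>c. fst (hd (tlits c))) ` critical_clauses \<subseteq> {..<n}"
    proof
      fix x assume "x \<in> (\<lambda>c. fst (hd (tlits c))) ` critical_clauses"
      then obtain c where "c \<in> critical_clauses" "x = fst (hd (tlits c))" by auto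
      then show "x \<in> {..<n}" using tl[of c] by auto
    qed
  qed simp
  then show ?thesis by simp
qed

section \<open>The lead of right votes over wrong ones\<close>

definition right_votes :: "(nat \<Rightarrow> nat) \<Rightarrow> nat \<Rightarrow> nat" where
  "right_votes \<tau> x = card {c \<in> set cls. (x, \<alpha> x) \<in> set c \<and> supports \<tau> x c}"
definition wrong_votes :: "(nat \<Rightarrow> nat) \<Rightarrow> nat \<Rightarrow> nat" where
  "wrong_votes \<tau> x = card {c \<in> set cls. (x, \<not> \<alpha> x) \<in> set c \<and> supports \<tau> x c}"
definition lead :: "(nat \<Rightarrow> nat) \<Rightarrow> nat \<Rightarrow> int" where
  "lead \<tau> x = clamp2 (int (right_votes \<tau> x) - int (wrong_votes \<tau> x))"

definition right_critical :: "(nat \<Rightarrow> nat) \<Rightarrow> nat \<Rightarrow> nat" where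
  "right_critical \<tau> x = card {c \<in> critical_clauses. (x, \<alpha> x) \<in> set c \<and> supports \<tau> x c}"
definition wrong_critical :: "(nat \<Rightarrow> nat) \<Rightarrow> nat \<Rightarrow> nat" where
  "wrong_critical \<tau> x = card {c \<in> critical_clauses. (x, \<not> \<alpha> x) \<in> set c \<and> supports \<tau> x c}"
definition good_vote :: "(nat \<Rightarrow> nat) \<Rightarrow> nat \<Rightarrow> bool" where
  "good_vote \<tau> x \<longleftrightarrow> (\<exists>c\<in>set cls. length (tlits c) = 2 \<and> (x, \<alpha> x) \<in> set c \<and> supports \<tau> x c)"

lemma length_tlits_flits: "length (tlits c) + length (flits c) = length c"
  unfolding tlits_def flits_def using sum_length_filter_compl[of "\<lambda>l. \<alpha> (fst l) = snd l" c] by simp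

lemma supports_right:
  assumes "c \<in> set cls" "supports \<tau> x c"
  shows "length (tlits c) \<le> 2"
proof -
  have "length (tlits c) \<noteq> 3"
  proof
    assume *: "length (tlits c) = 3"
    then have "length c = 3" using le3[OF assms(1)] length_tlits_flits[of c] by simp
    then have "flits c = []" using * length_tlits_flits[of c] by simp
    then have "filter (\<lambda>l. gA (\<tau> (fst l)) \<and> \<alpha> (fst l) \<noteq> snd l) c = []"
      by (auto simp: flits_def filter_empty_conv)
    then show False using assms(2) \<open>length c = 3\<close> by (simp add: supports_def)
  qed
  then show ?thesis using length_tlits(2)[OF assms(1)] by simp
qed

text \<open>The literal over \<open>x\<close> is false and lies over B; in a clause with three
  literals, the one falsified in A is a second false literal. So at most one literal is left to be
  true, and one has to be.\<close>

lemma supports_wrong: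
  assumes "c \<in> set cls" "supports \<tau> x c" "(x, \<not> \<alpha> x) \<in> set c" "gB (\<tau> x)"
  shows "length (tlits c) = 1"
proof -
  have "distinct c" using distinct_vars[OF assms(1)] distinct_map by blast
  then have card: "length (filter P c) = card {l \<in> set c. P l}" for P
    by (simp add: distinct_length_filter Int_def conj_commute)
  consider "length c = 3" "length (filter (\<lambda>l. gA (\<tau> (fst l)) \<and> \<alpha> (fst l) \<noteq> snd l) c) = 1" | "length c = 2"
    using assms(2) by (auto simp: supports_def)
  then have "length c \<le> 1 + length (flits c)"
  proof cases
    case 1
    let ?X = "{l \<in> set c. gA (\<tau> (fst l)) \<and> \<alpha> (fst l) \<noteq> snd l}"
    have "card (insert (x, \<not> \<alpha> x) ?X) = 2"
      using 1 assms(4) groups_disjoint(1) by (auto simp: card)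
    moreover have "insert (x, \<not> \<alpha> x) ?X \<subseteq> {l \<in> set c. \<alpha> (fst l) \<noteq> snd l}" using assms(3) by auto
    ultimately have "2 \<le> card {l \<in> set c. \<alpha> (fst l) \<noteq> snd l}"
      using card_mono[of "{l \<in> set c. \<alpha> (fst l) \<noteq> snd l}" "insert (x, \<not> \<alpha> x) ?X"] by simp
    then show ?thesis using 1 by (simp add: flits_def card)
  next
    case 2
    have "(x, \<not> \<alpha> x) \<in> set (flits c)" using assms(3) by (auto simp: flits_def)
    then have "flits c \<noteq> []" by auto
    then show ?thesis using 2 by (cases "flits c") auto
  qed
  then show ?thesis using length_tlits_flits[of c] length_tlits(1)[OF assms(1)] by linarith
qed

text \<open>Truncation at 2 has the right height: at most one critical clause votes rightly, so
  together with one good vote it contributes at most 2, and cutting off larger differences keeps the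
  linear lower bound. The quadratic bound holds since a nonzero lead needs at least one vote and its
  square is at most 4.\<close>

lemma lead_bounds:
  assumes B: "gB (\<tau> x)"
  shows "real (right_critical \<tau> x) - real (wrong_critical \<tau> x) + of_bool (good_vote \<tau> x) \<le> real_of_int (lead \<tau> x)"
    "(real_of_int (lead \<tau> x))\<^sup>2 \<le> 4 * (of_bool (good_vote \<tau> x) + real (right_critical \<tau> x) + real (wrong_critical \<tau> x))"
proof -
  let ?R = "{c \<in> set cls. (x, \<alpha> x) \<in> set c \<and> supports \<tau> x c}"
  let ?T = "{c \<in> critical_clauses. (x, \<alpha> x) \<in> set c \<and> supports \<tau> x c}"
  let ?G = "{c \<in> set cls. length (tlits c) = 2 \<and> (x, \<alpha> x) \<in> set c \<and> supports \<tau> x c}"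
  have W: "wrong_votes \<tau> x = wrong_critical \<tau> x"
    unfolding wrong_votes_def wrong_critical_def using supports_wrong B
    by (intro arg_cong[of _ _ card]) (auto simp: critical_clauses_def)
  have "?R = ?T \<union> ?G"
  proof -
    have "length (tlits c) = 1 \<or> length (tlits c) = 2" if "c \<in> ?R" for c
    proof -
      have "length (tlits c) \<le> 2" "0 < length (tlits c)"
        using supports_right[of c \<tau> x] length_tlits(1)[of c] that by auto
      then show ?thesis by arith
    qed
    then show ?thesis by (auto simp: critical_clauses_def)
  qed
  moreover have "card (?T \<union> ?G) = card ?T + card ?G"
    by (intro card_Un_disjoint) (auto simp: critical_clauses_def)
  ultimately have R: "right_votes \<tau> x = right_critical \<tau> x + card ?G"
    by (simp add: right_votes_def right_critical_def)
  have G: "good_vote \<tau> x \<longleftrightarrow> 0 < card ?G"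
    by (auto simp: good_vote_def card_gt_0_iff)
  have T: "right_critical \<tau> x \<le> 1"
    unfolding right_critical_def
  proof (rule card_le_Suc0_iff_eq[THEN iffD2, unfolded One_nat_def[symmetric]])
    show "\<forall>c\<in>?T. \<forall>c'\<in>?T. c = c'"
    proof (intro ballI)
      have *: "tlits c = [(x, \<alpha> x)]" if "c \<in> ?T" for c
      proof -
        have "(x, \<alpha> x) \<in> set (tlits c)" "length (tlits c) = 1" using that by (auto simp: tlits_def critical_clauses_def)
        then show ?thesis by (auto simp: length_Suc_conv)
      qed
      fix c c' assume c: "c \<in> ?T" "c' \<in> ?T"
      show "c = c'"
        by (rule one_critical) (use c *[OF c(1)] *[OF c(2)] in \<open>simp_all add: critical_clauses_def\<close>)
    qed
  qed (auto simp: critical_clauses_def)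
  define k where "k = int (right_votes \<tau> x) - int (wrong_votes \<tau> x)"
  have k: "k = int (right_critical \<tau> x) + int (card ?G) - int (wrong_critical \<tau> x)"
    by (simp add: k_def R W)
  have lead: "lead \<tau> x = clamp2 k" by (simp add: lead_def k_def)
  have "int (right_critical \<tau> x) - int (wrong_critical \<tau> x) + of_bool (good_vote \<tau> x) \<le> lead \<tau> x"
    unfolding lead k clamp2_def G using T by (auto simp: max_def min_def)
  then have "real_of_int (int (right_critical \<tau> x) - int (wrong_critical \<tau> x) + of_bool (good_vote \<tau> x)) \<le> real_of_int (lead \<tau> x)"
    by (rule of_int_le_iff[THEN iffD2])
  then show "real (right_critical \<tau> x) - real (wrong_critical \<tau> x) + of_bool (good_vote \<tau> x) \<le> real_of_int (lead \<tau> x)"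
    by simp
  show "(real_of_int (lead \<tau> x))\<^sup>2 \<le> 4 * (of_bool (good_vote \<tau> x) + real (right_critical \<tau> x) + real (wrong_critical \<tau> x))"
  proof (cases "k = 0")
    case False
    have "\<bar>real_of_int (lead \<tau> x)\<bar> \<le> 2" unfolding lead clamp2_def by auto
    then have "(real_of_int (lead \<tau> x))\<^sup>2 \<le> 2\<^sup>2" by (rule power2_le_iff_abs_le[THEN iffD2, rotated]) simp
    moreover have "1 \<le> (of_bool (good_vote \<tau> x) + right_critical \<tau> x + wrong_critical \<tau> x :: nat)"
    proof (cases "good_vote \<tau> x")
      case no_good: False
      then have "card ?G = 0" using G by linarith
      then have "1 \<le> right_critical \<tau> x + wrong_critical \<tau> x" using False unfolding k by linarith
      then show ?thesis by simp
    qed simp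
    then have "1 \<le> real (of_bool (good_vote \<tau> x) + right_critical \<tau> x + wrong_critical \<tau> x)" by linarith
    then have "1 \<le> of_bool (good_vote \<tau> x) + real (right_critical \<tau> x) + real (wrong_critical \<tau> x)" by simp
    ultimately show ?thesis by simp
  qed (simp add: lead clamp2_def)
qed

text \<open>Double counting: votes summed over the variables equal votes summed over the literals of
  the critical clauses. This makes the cancellation within each clause available.\<close>

lemma E_critical:
  "(\<Sum>x<n. E (\<lambda>\<tau>. of_bool (gB (\<tau> x)) * real (right_critical \<tau> x))) = (\<Sum>c\<in>critical_clauses. \<Sum>l\<leftarrow>tlits c. vote_prob c (fst l))"
  "(\<Sum>x<n. E (\<lambda>\<tau>. of_bool (gB (\<tau> x)) * real (wrong_critical \<tau> x))) = (\<Sum>c\<in>critical_clauses. \<Sum>l\<leftarrow>flits c. vote_prob c (fst l))"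
proof -
  have fin: "finite critical_clauses" by (auto simp: critical_clauses_def)
  have *: "(\<Sum>x<n. E (\<lambda>\<tau>. of_bool (gB (\<tau> x)) * real (card {c \<in> critical_clauses. (x, s x) \<in> set c \<and> supports \<tau> x c})))
     = (\<Sum>c\<in>critical_clauses. \<Sum>l\<leftarrow>filter (\<lambda>l. s (fst l) = snd l) c. vote_prob c (fst l))" for s
  proof -
    have "E (\<lambda>\<tau>. of_bool (gB (\<tau> x)) * real (card {c \<in> critical_clauses. (x, s x) \<in> set c \<and> supports \<tau> x c}))
      = (\<Sum>c\<in>critical_clauses. of_bool ((x, s x) \<in> set c) * vote_prob c x)" for x
    proof -
      have "of_bool (gB (\<tau> x)) * real (card {c \<in> critical_clauses. (x, s x) \<in> set c \<and> supports \<tau> x c})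
        = (\<Sum>c\<in>critical_clauses. of_bool ((x, s x) \<in> set c) * of_bool (gB (\<tau> x) \<and> supports \<tau> x c))" for \<tau>
      proof -
        have "real (card {c \<in> critical_clauses. (x, s x) \<in> set c \<and> supports \<tau> x c})
          = (\<Sum>c\<in>critical_clauses. of_bool ((x, s x) \<in> set c \<and> supports \<tau> x c))"
          using fin by (simp add: of_bool_def sum.If_cases Int_def)
        then show ?thesis by (auto simp: sum_distrib_left intro!: sum.cong)
      qed
      then show ?thesis unfolding vote_prob_def E_def by (simp add: av_sum av_cmult)
    qed
    then have "(\<Sum>x<n. E (\<lambda>\<tau>. of_bool (gB (\<tau> x)) * real (card {c \<in> critical_clauses. (x, s x) \<in> set c \<and> supports \<tau> x c})))
      = (\<Sum>c\<in>critical_clauses. \<Sum>x<n. of_bool ((x, s x) \<in> set c) * vote_prob c x)"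
      by (simp only:) (rule sum.swap)
    also have "\<dots> = (\<Sum>c\<in>critical_clauses. \<Sum>l\<leftarrow>filter (\<lambda>l. s (fst l) = snd l) c. vote_prob c (fst l))"
    proof (rule sum.cong[OF refl])
      fix c assume "c \<in> critical_clauses"
      then have c: "c \<in> set cls" by (simp add: critical_clauses_def)
      let ?L = "filter (\<lambda>l. s (fst l) = snd l) c"
      have "distinct c" using distinct_vars[OF c] distinct_map by blast
      then have "(\<Sum>l\<leftarrow>?L. vote_prob c (fst l)) = (\<Sum>l\<in>set ?L. vote_prob c (fst l))"
        by (simp add: sum_list_distinct_conv_sum_set)
      also have "\<dots> = (\<Sum>x\<in>fst ` set ?L. vote_prob c x)"
        by (subst sum.reindex) (auto simp: inj_on_def prod_eq_iff)
      also have "fst ` set ?L = {x \<in> {..<n}. (x, s x) \<in> set c}"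
        using vars_less[OF c] by (auto simp: image_iff)
      also have "(\<Sum>x\<in>\<dots>. vote_prob c x) = (\<Sum>x<n. of_bool ((x, s x) \<in> set c) * vote_prob c x)"
        by (intro sum.mono_neutral_cong_left) auto
      finally show "(\<Sum>x<n. of_bool ((x, s x) \<in> set c) * vote_prob c x) = (\<Sum>l\<leftarrow>?L. vote_prob c (fst l))" ..
    qed
    finally show ?thesis .
  qed
  show "(\<Sum>x<n. E (\<lambda>\<tau>. of_bool (gB (\<tau> x)) * real (right_critical \<tau> x))) = (\<Sum>c\<in>critical_clauses. \<Sum>l\<leftarrow>tlits c. vote_prob c (fst l))"
    using *[of \<alpha>] by (simp add: right_critical_def tlits_def)
  show "(\<Sum>x<n. E (\<lambda>\<tau>. of_bool (gB (\<tau> x)) * real (wrong_critical \<tau> x))) = (\<Sum>c\<in>critical_clauses. \<Sum>l\<leftarrow>flits c. vote_prob c (fst l))"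
  proof -
    have "flits c = filter (\<lambda>l. (\<not> \<alpha> (fst l)) = snd l) c" for c
      unfolding flits_def by (rule filter_cong) auto
    then show ?thesis using *[of "\<lambda>x. \<not> \<alpha> x"] by (simp add: wrong_critical_def)
  qed
qed

end

section \<open>The PPSZ integral\<close>

lemma cut_prob_mono: "0 \<le> t \<Longrightarrow> t \<le> 1 \<Longrightarrow> cut_prob d t \<le> cut_prob (Suc d) t"
proof (induction d)
  case 0
  have "t \<le> t + (1 - t) * t\<^sup>2" using 0 by simp
  then show ?case using 0 by (simp add: power_mono)
next
  case (Suc d)
  have "0 \<le> (1 - t) * cut_prob d t"
    using cut_prob_bounds[of t d] Suc.prems by simp
  moreover have "(1 - t) * cut_prob d t \<le> (1 - t) * cut_prob (Suc d) t"
    using Suc by (intro mult_left_mono) auto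
  ultimately have "(t + (1 - t) * cut_prob d t)\<^sup>2 \<le> (t + (1 - t) * cut_prob (Suc d) t)\<^sup>2"
    using Suc.prems by (intro power_mono) auto
  then show ?case by simp
qed

text \<open>The smallest root in [0, 1] of L = (t + (1 - t) L)^2, the equation satisfied by the
  limit of \<open>cut_prob d t\<close> for growing depth.\<close>

definition cut_limit :: "real \<Rightarrow> real" where
  "cut_limit t = (if t < 1 / 2 then (t / (1 - t))\<^sup>2 else 1)"

text \<open>The sequence is increasing and bounded, hence converges to a root. For L = w^2 the
  equation factors as (w - 1) ((1 - t) w - t) = 0, and either factor gives a root that is at least
  \<open>cut_limit t\<close>.\<close>

lemma cut_prob_limit:
  assumes t: "0 \<le> t" "t \<le> 1" and e: "0 < e"
  shows "\<exists>d0. \<forall>d\<ge>d0. cut_limit t - e \<le> cut_prob d t"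
proof -
  have inc: "incseq (\<lambda>d. cut_prob d t)"
    using cut_prob_mono t by (intro incseq_SucI) auto
  have "\<exists>L. (\<lambda>d. cut_prob d t) \<longlonglongrightarrow> L \<and> (\<forall>d. cut_prob d t \<le> L)"
    using incseq_convergent[OF inc, of 1] cut_prob_bounds(2)[OF t] by metis
  then obtain L where L: "(\<lambda>d. cut_prob d t) \<longlonglongrightarrow> L" by auto
  have "(\<lambda>d. cut_prob (Suc d) t) \<longlonglongrightarrow> (t + (1 - t) * L)\<^sup>2"
    using tendsto_power[OF tendsto_add[OF tendsto_const[of t] tendsto_mult[OF tendsto_const[of "1 - t"] L]], of 2]
    by simp
  moreover have "(\<lambda>d. cut_prob (Suc d) t) \<longlonglongrightarrow> L" using L by (rule LIMSEQ_Suc)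
  ultimately have fix_L: "L = (t + (1 - t) * L)\<^sup>2" by (rule LIMSEQ_unique[rotated])
  define w where "w = t + (1 - t) * L"
  have w: "L = w\<^sup>2" "w = t + (1 - t) * w\<^sup>2" using fix_L by (auto simp: w_def)
  have "0 \<le> L" unfolding w(1) by simp
  then have w0: "0 \<le> w" using t by (simp add: w_def)
  have "(w - 1) * ((1 - t) * w - t) = (1 - t) * w\<^sup>2 + t - w" by (simp add: algebra_simps power2_eq_square)
  then have "(w - 1) * ((1 - t) * w - t) = 0" using w(2) by simp
  then consider "w = 1" | "(1 - t) * w = t" by auto
  then have "cut_limit t \<le> L"
  proof cases
    case 1
    then show ?thesis using w t by (auto simp: cut_limit_def power_le_one)
  next
    case 2
    show ?thesis
    proof (cases "t = 1")
      case False
      then have "w = t / (1 - t)" using 2 t by (simp add: field_simps)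
      moreover have "1 \<le> t / (1 - t)" if "\<not> t < 1 / 2" using that t False by (simp add: field_simps)
      ultimately show ?thesis using w(1) by (auto simp: cut_limit_def)
    qed (use 2 in auto)
  qed
  then have "eventually (\<lambda>d. cut_limit t - e < cut_prob d t) sequentially"
    using e by (intro order_tendstoD(1)[OF L]) auto
  then show ?thesis by (auto simp: eventually_sequentially intro: less_imp_le)
qed

text \<open>The antiderivative behind the constant: its increment from 0 to 1/2 is 2 ln 2 -
  1.\<close>

lemma uncut_derivative:
  assumes "x < (1::real)"
  shows "((\<lambda>t. - 2 * ln (1 - t) - 1 / (1 - t)) has_real_derivative (1 - (x / (1 - x))\<^sup>2)) (at x)"
proof -
  have "((\<lambda>t. - 2 * ln (1 - t) - 1 / (1 - t)) has_real_derivative (2 / (1 - x) - 1 / (1 - x)\<^sup>2)) (at x)"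
    using assms by (auto intro!: derivative_eq_intros simp: power2_eq_square)
  moreover have "2 / (1 - x) - 1 / (1 - x)\<^sup>2 = 1 - (x / (1 - x))\<^sup>2"
  proof -
    define y where "y = 1 - x"
    have "y \<noteq> 0" using assms by (auto simp: y_def)
    then have "2 / y - 1 / y\<^sup>2 = 1 - ((1 - y) / y)\<^sup>2" by (simp add: field_simps power2_eq_square)
    then show ?thesis by (simp add: y_def)
  qed
  ultimately show ?thesis by simp
qed

text \<open>The integrand decreases from 1 at time 0 to 0 at time 1/2, and the summands vanish from
  there on. A left sum of a decreasing function exceeds the integral by at most its first
  term.\<close>

lemma uncut_riemann:
  assumes "0 < m"
  shows "(\<Sum>v<2 * m. 1 - cut_limit (real v / real (2 * m))) / real (2 * m) \<le> (2 * ln 2 - 1) + 1 / real (2 * m)"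
proof -
  let ?N = "real (2 * m)"
  define G where "G t = - 2 * ln (1 - t) - 1 / (1 - t)" for t :: real
  define h where "h t = 1 - (t / (1 - t))\<^sup>2" for t :: real
  have N: "0 < ?N" using assms by simp
  \<comment> \<open>By the mean value theorem the increment of \<open>G\<close> is
    \<open>1 / N\<close> times \<open>h\<close> at an inner point, where \<open>h\<close> is at
    least its value at the right end.\<close>
  have step: "h (real (Suc v) / ?N) / ?N \<le> G (real (Suc v) / ?N) - G (real v / ?N)" if v: "v < m" for v
  proof -
    let ?a = "real v / ?N" and ?b = "real (Suc v) / ?N"
    have ab: "0 \<le> ?a" "?a < ?b" "?b \<le> 1 / 2" "?b - ?a = 1 / ?N" using v N by (auto simp: field_simps)
    have "\<exists>z>?a. z < ?b \<and> G ?b - G ?a = (?b - ?a) * h z"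
      unfolding G_def h_def
      by (rule MVT2[OF ab(2)]) (rule uncut_derivative, use ab in linarith)
    then obtain z where z: "?a < z" "z < ?b" "G ?b - G ?a = (?b - ?a) * h z" by auto
    have "0 \<le> z" "z < 1" using z(1,2) ab by linarith+
    then have "z / (1 - z) \<le> ?b / (1 - ?b)"
      using z(2) ab(3) \<open>0 \<le> z\<close> by (intro frac_le) linarith+
    then have "(z / (1 - z))\<^sup>2 \<le> (?b / (1 - ?b))\<^sup>2"
      using \<open>0 \<le> z\<close> \<open>z < 1\<close> by (intro power_mono) auto
    then have "h ?b \<le> h z" by (simp add: h_def)
    then have "h ?b / ?N \<le> h z / ?N" using N by (intro divide_right_mono) auto
    then show ?thesis using z(3) ab(4) by simp
  qed
  have "(\<Sum>v<2 * m. 1 - cut_limit (real v / ?N)) = (\<Sum>v<m. h (real v / ?N))"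
  proof -
    have "(\<Sum>v<m. h (real v / ?N)) = (\<Sum>v<m. 1 - cut_limit (real v / ?N))"
      using assms by (intro sum.cong) (auto simp: cut_limit_def h_def field_simps)
    also have "\<dots> = (\<Sum>v<2 * m. 1 - cut_limit (real v / ?N))"
      using assms by (intro sum.mono_neutral_left) (auto simp: cut_limit_def field_simps)
    finally show ?thesis ..
  qed
  \<comment> \<open>The added term is h(1/2) = 0; it allows the sum to be shifted to right end
    points.\<close>
  also have "\<dots> = (\<Sum>v<Suc m. h (real v / ?N))"
    using assms by (simp add: h_def)
  also have "\<dots> = h 0 + (\<Sum>v<m. h (real (Suc v) / ?N))"
    by (subst sum.lessThan_Suc_shift) simp
  also have "\<dots> / ?N = 1 / ?N + (\<Sum>v<m. h (real (Suc v) / ?N) / ?N)"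
    by (simp add: h_def add_divide_distrib sum_divide_distrib)
  also have "(\<Sum>v<m. h (real (Suc v) / ?N) / ?N) \<le> (\<Sum>v<m. G (real (Suc v) / ?N) - G (real v / ?N))"
    using step by (intro sum_mono) auto
  also have "\<dots> = G (real m / ?N) - G 0"
    by (subst sum_lessThan_telescope) simp
  also have "\<dots> = 2 * ln 2 - 1"
    using assms by (simp add: G_def ln_div)
  finally show ?thesis by simp
qed

text \<open>Blind guessing in A and B costs 2p, whereas the integral charges at least 2p (1 - r) for
  these times, with r = (2p / (1 - 2p))^2; the difference 2p r is the third-order term.
  \<open>K\<close> makes the Riemann error and \<open>D\<close> the error of the cut probabilities
  at most \<open>\<eta> / 2\<close>.\<close>

lemma baseline_cost:
  fixes a :: nat
  defines "p \<equiv> 1 / (2::real) ^ a"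
  assumes a: "2 \<le> a" and \<eta>: "0 < \<eta>"
  shows "\<exists>K D. 2 * a \<le> K \<and> 2 * p + (\<Sum>v | v < 2 ^ K \<and> 2 * 2 ^ (K - a) \<le> v. 1 - cut_prob D (real v / real (2 ^ K))) / real (2 ^ K)
     \<le> (2 * ln 2 - 1) + 8 * p ^ 3 / (1 - 2 * p)\<^sup>2 + \<eta>"
proof -
  obtain K0 where K0: "1 / 2 ^ K0 < \<eta> / 2"
    using real_arch_pow_inv[of "\<eta> / 2" "1 / 2"] \<eta> by (auto simp: power_one_over)
  define K where "K = max (2 * a) K0"
  have K: "2 * a \<le> K" "a \<le> K" "0 < K" using a by (auto simp: K_def)
  have "(1::real) / 2 ^ K \<le> 1 / 2 ^ K0" by (simp add: K_def field_simps)
  then have K\<eta>: "1 / 2 ^ K \<le> \<eta> / 2" using K0 by simp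
  define N where "N = (2::nat) ^ K"
  have N: "0 < real N" "1 / real N \<le> \<eta> / 2" using K\<eta> by (auto simp: N_def)
  obtain m where m: "N = 2 * m" "0 < m"
    using K(3) by (cases K) (auto simp: N_def)
  have "\<forall>v<N. \<exists>d0. \<forall>d\<ge>d0. cut_limit (real v / real N) - \<eta> / 2 \<le> cut_prob d (real v / real N)"
    using \<eta> N by (auto intro!: cut_prob_limit)
  then obtain f where f: "\<And>v d. v < N \<Longrightarrow> f v \<le> d \<Longrightarrow> cut_limit (real v / real N) - \<eta> / 2 \<le> cut_prob d (real v / real N)"
    by metis
  \<comment> \<open>The limit is approached at different speeds at different times, but there are
    only \<open>N\<close> of them, so a common depth exists.\<close>
  define D where "D = Max (f ` {..<N})"
  have D: "cut_limit (real v / real N) - \<eta> / 2 \<le> cut_prob D (real v / real N)" if "v < N" for v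
    using that by (intro f) (auto simp: D_def)
  let ?m = "2 * (2::nat) ^ (K - a)"
  have pN: "p * real N = 2 ^ (K - a)"
    using K(2) by (simp add: p_def N_def power_diff)
  have p: "0 < p" "p \<le> 1 / 4"
    using power_increasing[OF a, of "2::real"] by (auto simp: p_def field_simps)
  have m_le: "?m \<le> N"
  proof -
    have "real ?m \<le> real N" using pN p(2) N(1) mult_right_mono[OF p(2), of "real N"] by simp
    then show ?thesis by linarith
  qed
  have early: "cut_limit (real v / real N) \<le> (2 * p / (1 - 2 * p))\<^sup>2" if "v < ?m" for v
  proof -
    have "real v \<le> 2 * 2 ^ (K - a)" using of_nat_less_iff[of v "2 * 2 ^ (K - a)", where ?'a = real] that by simp
    then have "real v / real N \<le> 2 * p" using pN N(1) by (simp add: field_simps)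
    moreover have "0 \<le> real v / real N" by simp
    moreover have "1 - real v / real N \<ge> 1 - 2 * p" "2 * p < 1" "2 * p \<le> 1 / 2" using calculation p by linarith+
    ultimately have "(real v / real N) / (1 - real v / real N) \<le> 2 * p / (1 - 2 * p)"
      using p(1) by (intro frac_le) linarith+
    moreover have "0 \<le> (real v / real N) / (1 - real v / real N)"
      using \<open>1 - real v / real N \<ge> 1 - 2 * p\<close> \<open>2 * p < 1\<close> by (intro divide_nonneg_nonneg) auto
    ultimately have *: "((real v / real N) / (1 - real v / real N))\<^sup>2 \<le> (2 * p / (1 - 2 * p))\<^sup>2"
      by (intro power_mono) auto
    show ?thesis
    proof (cases "real v / real N < 1 / 2")
      \<comment> \<open>Times up to 2p reach 1/2 only for p = 1/4, where both sides are 1.\<close>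
      case False
      then have "2 * p = 1 / 2" using \<open>real v / real N \<le> 2 * p\<close> \<open>2 * p \<le> 1 / 2\<close> by linarith
      then have "p = 1 / 4" by simp
      then have "(2 * p / (1 - 2 * p))\<^sup>2 = 1" by (simp only:) simp
      then show ?thesis using False unfolding cut_limit_def by (simp only: if_False order_refl)
    next
      case True
      then show ?thesis using * unfolding cut_limit_def by (simp only: if_True)
    qed
  qed
  define late where "late = {v. v < N \<and> ?m \<le> v}"
  define r where "r = (2 * p / (1 - 2 * p))\<^sup>2"
  have split: "{..<N} = {..<?m} \<union> late" "{..<?m} \<inter> late = {}" "finite late"
    using m_le by (auto simp: late_def)
  have "(\<Sum>v\<in>late. 1 - cut_prob D (real v / real N)) \<le> (\<Sum>v\<in>late. (1 - cut_limit (real v / real N)) + \<eta> / 2)"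
    using D by (intro sum_mono) (auto simp: late_def algebra_simps)
  moreover have "(\<Sum>v\<in>late. (1 - cut_limit (real v / real N)) + \<eta> / 2)
    \<le> (\<Sum>v\<in>late. 1 - cut_limit (real v / real N)) + real N * (\<eta> / 2)"
  proof -
    have "card late \<le> card {..<N}" by (intro card_mono) (auto simp: late_def)
    then have "real (card late) * (\<eta> / 2) \<le> real N * (\<eta> / 2)"
      using \<eta> by (intro mult_right_mono) auto
    then show ?thesis by (simp only: sum.distrib sum_constant)
  qed
  moreover have "(\<Sum>v<N. 1 - cut_limit (real v / real N))
     = (\<Sum>v<?m. 1 - cut_limit (real v / real N)) + (\<Sum>v\<in>late. 1 - cut_limit (real v / real N))"
    unfolding split(1) using split(2,3) by (intro sum.union_disjoint) auto
  moreover have "(\<Sum>v<?m. 1 - r) \<le> (\<Sum>v<?m. 1 - cut_limit (real v / real N))"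
    using early by (intro sum_mono) (auto simp: r_def)
  moreover have "(\<Sum>v<?m. 1 - r) = real N * (2 * p * (1 - r))"
  proof -
    have "real ?m = 2 * (p * real N)" using pN by simp
    moreover have "(\<Sum>v<?m. 1 - r) = real ?m * (1 - r)" by (simp only: sum_constant card_lessThan)
    ultimately show ?thesis by (simp only: mult_ac)
  qed
  ultimately have "(\<Sum>v\<in>late. 1 - cut_prob D (real v / real N))
    \<le> (\<Sum>v<N. 1 - cut_limit (real v / real N)) - real N * (2 * p * (1 - r)) + real N * (\<eta> / 2)"
    by linarith
  then have "(\<Sum>v\<in>late. 1 - cut_prob D (real v / real N)) / real N
    \<le> ((\<Sum>v<N. 1 - cut_limit (real v / real N)) - real N * (2 * p * (1 - r)) + real N * (\<eta> / 2)) / real N"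
    using N(1) by (intro divide_right_mono) auto
  also have "\<dots> = (\<Sum>v<N. 1 - cut_limit (real v / real N)) / real N - 2 * p * (1 - r) + \<eta> / 2"
    using N(1) by (simp add: add_divide_distrib diff_divide_distrib)
  finally have "(\<Sum>v\<in>late. 1 - cut_prob D (real v / real N)) / real N
    \<le> (\<Sum>v<N. 1 - cut_limit (real v / real N)) / real N - 2 * p * (1 - r) + \<eta> / 2" .
  moreover have "(\<Sum>v<N. 1 - cut_limit (real v / real N)) / real N \<le> (2 * ln 2 - 1) + \<eta> / 2"
    using uncut_riemann[OF m(2)] N(2) unfolding m(1) by linarith
  moreover have "2 * p * (1 - r) = 2 * p - 8 * p ^ 3 / (1 - 2 * p)\<^sup>2"
    by (simp add: r_def power2_eq_square power3_eq_cube algebra_simps)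
  ultimately have "2 * p + (\<Sum>v\<in>late. 1 - cut_prob D (real v / real N)) / real N
     \<le> (2 * ln 2 - 1) + 8 * p ^ 3 / (1 - 2 * p)\<^sup>2 + \<eta>"
    by linarith
  then show ?thesis using K(1) unfolding late_def N_def by blast
qed

text \<open>From e^9 \<le> 2.72^9 \<le> 2^13. It yields 2 ln 2 - 1 \<ge> 5/13 > 3/8, the margin
  needed for the rate of the linear candidate.\<close>

lemma ln2_lower: "9 / 13 \<le> ln (2::real)"
proof -
  have "exp (9 / 13 :: real) ^ 13 = exp 1 ^ 9"
    by (simp add: exp_of_nat_mult[symmetric])
  also have "\<dots> \<le> (272 / 100) ^ 9"
    using e_less_272 by (intro power_mono) auto
  also have "\<dots> \<le> 2 ^ 13" by (simp add: power_divide divide_le_eq)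
  finally have "exp (9 / 13 :: real) \<le> 2" by (rule power_le_imp_le_base[of _ 12, simplified]) simp
  then show ?thesis by (subst ln_ge_iff) auto
qed

section \<open>Packings of clauses with two true literals\<close>

context one_critical_cnf
begin

lemma E_mono: "(\<And>\<tau>. f \<tau> \<le> g \<tau>) \<Longrightarrow> E f \<le> E g"
  unfolding E_def by (rule av_mono)

lemma E_add: "E (\<lambda>\<tau>. f \<tau> + g \<tau>) = E f + E g"
  unfolding E_def by (rule av_add)

lemma E_diff: "E (\<lambda>\<tau>. f \<tau> - g \<tau>) = E f - E g"
  unfolding E_def by (rule av_diff)

lemma E_cmult: "E (\<lambda>\<tau>. c * f \<tau>) = c * E f"
  unfolding E_def by (rule av_cmult)

definition good_prob :: real where
  "good_prob = (\<Sum>x<n. E (\<lambda>\<tau>. of_bool (gB (\<tau> x)) * of_bool (good_vote \<tau> x)))"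

text \<open>In the term linear in \<theta>, right and wrong votes of critical clauses have the same
  mean and cancel. The quadratic loss counts every critical vote, and each of the at most n critical
  clauses contributes a mean of at most 2 p^2 q on either side.\<close>

lemma lead_gain:
  assumes \<theta>: "0 \<le> \<theta>"
  shows "(\<theta> - 8 * \<theta>\<^sup>2) * good_prob - 32 * \<theta>\<^sup>2 * p\<^sup>2 * q * real n
    \<le> (\<Sum>x<n. E (\<lambda>\<tau>. of_bool (gB (\<tau> x)) * (\<theta> * lead \<tau> x - 2 * (\<theta> * lead \<tau> x)\<^sup>2)))"
proof -
  let ?B = "\<lambda>\<tau> x. of_bool (gB (\<tau> x)) :: real"
  let ?g = "\<lambda>\<tau> x. of_bool (good_vote \<tau> x) :: real"
  let ?T = "\<lambda>\<tau> x. real (right_critical \<tau> x)"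
  let ?F = "\<lambda>\<tau> x. real (wrong_critical \<tau> x)"
  define X where "X = (\<Sum>c\<in>critical_clauses. \<Sum>l\<leftarrow>tlits c. vote_prob c (fst l))"
  have T: "(\<Sum>x<n. E (\<lambda>\<tau>. ?B \<tau> x * ?T \<tau> x)) = X"
    unfolding X_def by (rule E_critical(1))
  have F: "(\<Sum>x<n. E (\<lambda>\<tau>. ?B \<tau> x * ?F \<tau> x)) = X"
    unfolding X_def E_critical(2)
    by (intro sum.cong refl vote_prob_balance(1)[symmetric]) (auto simp: critical_clauses_def)
  have "X \<le> (\<Sum>c\<in>critical_clauses. 2 * p\<^sup>2 * q)"
    unfolding X_def by (intro sum_mono vote_prob_balance(2)) (auto simp: critical_clauses_def)
  also have "\<dots> = real (card critical_clauses) * (2 * p\<^sup>2 * q)" by simp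
  also have "\<dots> \<le> real n * (2 * p\<^sup>2 * q)"
    using card_critical_clauses p_bounds by (intro mult_right_mono) auto
  finally have X: "X \<le> real n * (2 * p\<^sup>2 * q)" .
  \<comment> \<open>The lead is at least T - F + g and its square at most 4 (T + F + g), whence the
    coefficients \<theta> and 8 \<theta>^2.\<close>
  have pt: "(\<theta> - 8 * \<theta>\<^sup>2) * (?B \<tau> x * ?g \<tau> x) + (\<theta> - 8 * \<theta>\<^sup>2) * (?B \<tau> x * ?T \<tau> x) - (\<theta> + 8 * \<theta>\<^sup>2) * (?B \<tau> x * ?F \<tau> x)
     \<le> ?B \<tau> x * (\<theta> * lead \<tau> x - 2 * (\<theta> * lead \<tau> x)\<^sup>2)" for \<tau> x
  proof (cases "gB (\<tau> x)")
    case True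
    have "\<theta> * (?T \<tau> x - ?F \<tau> x + ?g \<tau> x) \<le> \<theta> * lead \<tau> x"
      using lead_bounds(1)[of \<tau> x, OF True] \<theta> by (intro mult_left_mono) auto
    moreover have "(2 * \<theta>\<^sup>2) * (real_of_int (lead \<tau> x))\<^sup>2 \<le> (2 * \<theta>\<^sup>2) * (4 * (?g \<tau> x + ?T \<tau> x + ?F \<tau> x))"
      using lead_bounds(2)[of \<tau> x, OF True] by (intro mult_left_mono) auto
    ultimately show ?thesis using True by (simp add: power_mult_distrib algebra_simps)
  qed simp
  have "(\<theta> - 8 * \<theta>\<^sup>2) * good_prob + (\<theta> - 8 * \<theta>\<^sup>2) * X - (\<theta> + 8 * \<theta>\<^sup>2) * X
    = (\<Sum>x<n. (\<theta> - 8 * \<theta>\<^sup>2) * E (\<lambda>\<tau>. ?B \<tau> x * ?g \<tau> x) + (\<theta> - 8 * \<theta>\<^sup>2) * E (\<lambda>\<tau>. ?B \<tau> x * ?T \<tau> x)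
        - (\<theta> + 8 * \<theta>\<^sup>2) * E (\<lambda>\<tau>. ?B \<tau> x * ?F \<tau> x))"
    unfolding sum_subtractf sum.distrib sum_distrib_left[symmetric] T F good_prob_def ..
  also have "\<dots> = (\<Sum>x<n. E (\<lambda>\<tau>. (\<theta> - 8 * \<theta>\<^sup>2) * (?B \<tau> x * ?g \<tau> x) + (\<theta> - 8 * \<theta>\<^sup>2) * (?B \<tau> x * ?T \<tau> x)
        - (\<theta> + 8 * \<theta>\<^sup>2) * (?B \<tau> x * ?F \<tau> x)))"
    unfolding E_diff E_add E_cmult ..
  also have "\<dots> \<le> (\<Sum>x<n. E (\<lambda>\<tau>. ?B \<tau> x * (\<theta> * lead \<tau> x - 2 * (\<theta> * lead \<tau> x)\<^sup>2)))"
    by (intro sum_mono E_mono pt)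
  finally have "(\<theta> - 8 * \<theta>\<^sup>2) * good_prob - 16 * \<theta>\<^sup>2 * X
      \<le> (\<Sum>x<n. E (\<lambda>\<tau>. ?B \<tau> x * (\<theta> * lead \<tau> x - 2 * (\<theta> * lead \<tau> x)\<^sup>2)))"
    by (simp add: algebra_simps)
  moreover have "16 * \<theta>\<^sup>2 * X \<le> 16 * \<theta>\<^sup>2 * (real n * (2 * p\<^sup>2 * q))"
    using X by (intro mult_left_mono) auto
  ultimately show ?thesis by (simp add: algebra_simps)
qed

definition tvars :: "(nat \<times> bool) list \<Rightarrow> nat set" where
  "tvars c = fst ` set (tlits c)"

definition packing :: "(nat \<times> bool) list set \<Rightarrow> bool" where
  "packing P \<longleftrightarrow> P \<subseteq> {c \<in> set cls. length (tlits c) = 2} \<and> disjoint_family_on tvars P"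

definition covered :: "(nat \<times> bool) list set \<Rightarrow> nat set" where
  "covered P = (\<Union>c\<in>P. tvars c)"

text \<open>By maximality every clause with two true literals has a true literal over a covered
  variable, so right guesses for the covered variables satisfy all these clauses.\<close>

lemma maximal_packing:
  obtains P where "packing P"
    "\<And>c. c \<in> set cls \<Longrightarrow> length (tlits c) = 2 \<Longrightarrow> \<exists>l\<in>set (tlits c). fst l \<in> covered P"
proof -
  have "finite {P. packing P}"
    by (rule finite_subset[of _ "Pow (set cls)"]) (auto simp: packing_def)
  moreover have "{} \<in> {P. packing P}" by (simp add: packing_def disjoint_family_on_def)
  ultimately obtain P where P: "packing P" "\<And>P'. packing P' \<Longrightarrow> P \<subseteq> P' \<Longrightarrow> P' = P"
    using finite_has_maximal[of "{P. packing P}"] by (metis empty_iff mem_Collect_eq)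
  have "\<exists>l\<in>set (tlits c). fst l \<in> covered P" if c: "c \<in> set cls" "length (tlits c) = 2" for c
  proof (rule ccontr)
    assume *: "\<not> ?thesis"
    then have disj: "tvars c \<inter> covered P = {}" by (auto simp: tvars_def)
    then have "packing (insert c P)"
      using P(1) c unfolding packing_def disjoint_family_on_def covered_def by fast
    then have "c \<in> P" using P(2)[of "insert c P"] by auto
    moreover obtain l where "l \<in> set (tlits c)" using c(2) by (cases "tlits c") auto
    ultimately show False using * by (auto simp: covered_def tvars_def)
  qed
  with P(1) that show thesis by blast
qed

lemma tvars:
  assumes "c \<in> set cls"
  shows "tvars c \<subseteq> {..<n}" "card (tvars c) = length (tlits c)" "x \<in> tvars c \<Longrightarrow> (x, \<alpha> x) \<in> set (tlits c)"
proof -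
  show "tvars c \<subseteq> {..<n}" using vars_less[OF assms] by (auto simp: tvars_def tlits_def)
  have "distinct (map fst (tlits c))"
    unfolding tlits_def using distinct_vars[OF assms] by (rule distinct_map_filter)
  then show "card (tvars c) = length (tlits c)"
    using distinct_card[of "map fst (tlits c)"] by (simp add: tvars_def)
  show "x \<in> tvars c \<Longrightarrow> (x, \<alpha> x) \<in> set (tlits c)"
    by (auto simp: tvars_def tlits_def)
qed

lemma covered_less: "packing P \<Longrightarrow> covered P \<subseteq> {..<n}"
  using tvars(1) by (auto simp: packing_def covered_def)

text \<open>The clause of the packing that covers \<open>x\<close> alone gives \<open>x\<close> a
  good vote with probability p^2 q.\<close>

lemma good_prob_ge:
  assumes "packing P"
  shows "real (card (covered P)) * (p\<^sup>2 * q) \<le> good_prob"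
proof -
  have "p\<^sup>2 * q \<le> E (\<lambda>\<tau>. of_bool (gB (\<tau> x)) * of_bool (good_vote \<tau> x))" if x_cov: "x \<in> covered P" for x
  proof -
    obtain c where c: "c \<in> set cls" "length (tlits c) = 2" "x \<in> tvars c"
      using x_cov assms by (auto simp: covered_def packing_def)
    then have x: "(x, \<alpha> x) \<in> set (tlits c)" using tvars(3) by auto
    have "p\<^sup>2 * q = vote_prob c x"
      using vote_prob_good[OF c(1,2) x] by simp
    also have "\<dots> \<le> E (\<lambda>\<tau>. of_bool (gB (\<tau> x)) * of_bool (good_vote \<tau> x))"
      unfolding vote_prob_def
      using c x by (intro E_mono) (auto simp: good_vote_def tlits_def)
    finally show ?thesis .
  qed
  then have "(\<Sum>x\<in>covered P. p\<^sup>2 * q) \<le> (\<Sum>x\<in>covered P. E (\<lambda>\<tau>. of_bool (gB (\<tau> x)) * of_bool (good_vote \<tau> x)))"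
    by (rule sum_mono)
  also have "\<dots> \<le> good_prob"
    unfolding good_prob_def
  proof (rule sum_mono2)
    show "covered P \<subseteq> {..<n}" by (rule covered_less[OF assms])
    show "0 \<le> E (\<lambda>\<tau>. of_bool (gB (\<tau> x)) * of_bool (good_vote \<tau> x))" for x
      using E_mono[of "\<lambda>_. 0" "\<lambda>\<tau>. of_bool (gB (\<tau> x)) * of_bool (good_vote \<tau> x)"]
      by (simp add: E_def av_const)
  qed simp
  finally show ?thesis by simp
qed

text \<open>Minus the binary logarithm of the probability that variable \<open>x\<close> gets the right value.\<close>

definition cost :: "real \<Rightarrow> nat \<Rightarrow> (nat \<Rightarrow> nat) \<Rightarrow> nat \<Rightarrow> real" where
  "cost \<theta> D \<tau> x = of_bool (gA (\<tau> x)) + of_bool (gB (\<tau> x)) * (1 - log 2 (1 + \<theta> * lead \<tau> x))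
     + of_bool (gC (\<tau> x) \<and> \<not> cut D {x} {y. y < n \<and> \<tau> y < \<tau> x})"

lemma abs_lead: "\<bar>real_of_int (lead \<tau> x)\<bar> \<le> 2"
  unfolding lead_def clamp2_def by auto

text \<open>Per variable: p in A, the tail of the integral in C, and in B the cost p minus the gain
  of the bias, estimated by ln (1 + s) \<ge> s - 2 s^2. At least n/16 covered variables turn the
  linear gain into a constant per variable.\<close>

lemma expected_cost:
  assumes \<theta>: "0 \<le> \<theta>" "\<theta> \<le> 1 / 8" "32 * \<theta>\<^sup>2 \<le> (\<theta> - 8 * \<theta>\<^sup>2) / 16"
    and base: "2 * p + (\<Sum>v | v < 2 ^ K \<and> 2 * 2 ^ (K - a) \<le> v. 1 - cut_prob D (real v / real (2 ^ K))) / real (2 ^ K) \<le> S0"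
    and P: "packing P" "real n / 16 \<le> real (card (covered P))"
  shows "E (\<lambda>\<tau>. \<Sum>x<n. cost \<theta> D \<tau> x)
    \<le> real n * (S0 - p\<^sup>2 * q * ((\<theta> - 8 * \<theta>\<^sup>2) / 16 - 32 * \<theta>\<^sup>2))"
proof -
  let ?B = "\<lambda>\<tau> x. of_bool (gB (\<tau> x)) :: real"
  let ?L = "\<lambda>\<tau> x. \<theta> * lead \<tau> x - 2 * (\<theta> * lead \<tau> x)\<^sup>2"
  let ?C = "\<lambda>\<tau> x. of_bool (gC (\<tau> x) \<and> \<not> cut D {x} {y. y < n \<and> \<tau> y < \<tau> x}) :: real"
  have log: "log 2 (1 + \<theta> * lead \<tau> x) \<ge> ?L \<tau> x / ln 2" for \<tau> x
  proof -
    let ?s = "\<theta> * lead \<tau> x"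
    have "\<bar>?s\<bar> \<le> (1 / 8) * 2"
      unfolding abs_mult using abs_lead \<theta> by (intro mult_mono) auto
    then have s: "\<bar>?s\<bar> \<le> 1 / 2" by simp
    have "?L \<tau> x \<le> ln (1 + ?s)"
      using abs_ln_one_plus_x_minus_x_bound[OF s] by (simp add: abs_le_iff)
    then show ?thesis unfolding log_def by (intro divide_right_mono) auto
  qed
  have cost_le: "cost \<theta> D \<tau> x \<le> of_bool (gA (\<tau> x)) + (?B \<tau> x + - 1 / ln 2 * (?B \<tau> x * ?L \<tau> x)) + ?C \<tau> x" for \<tau> x
    using log[of \<tau> x] unfolding cost_def by (cases "gB (\<tau> x)") (auto simp: diff_le_eq add_increasing)
  have E1: "E (\<lambda>\<tau>. of_bool (gA (\<tau> x))) = p" "E (\<lambda>\<tau>. of_bool (gB (\<tau> x))) = p" if "x < n" for x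
  proof -
    have "E (\<lambda>\<tau>. of_bool (P (\<tau> x))) = share (2 ^ K) P" for P
    proof -
      let ?P = "\<lambda>v. if v = x then P else (\<lambda>_. True)"
      have iff: "P (\<tau> x) = (\<forall>v\<in>{..<n}. ?P v (\<tau> v))" for \<tau>
        using \<open>x < n\<close> by auto
      have "E (\<lambda>\<tau>. of_bool (P (\<tau> x))) = (\<Prod>v\<in>{..<n}. share (2 ^ K) (?P v))"
        unfolding E_def iff by (rule av_all) simp
      also have "\<dots> = (\<Prod>v\<in>{x}. share (2 ^ K) (?P v))"
        using \<open>x < n\<close> by (intro prod.mono_neutral_right) (auto simp: share_True)
      finally show ?thesis by simp
    qed
    then show "E (\<lambda>\<tau>. of_bool (gA (\<tau> x))) = p" "E (\<lambda>\<tau>. of_bool (gB (\<tau> x))) = p"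
      by (simp_all add: shares)
  qed
  define c0 where "c0 = (\<Sum>v | v < 2 ^ K \<and> 2 * 2 ^ (K - a) \<le> v. 1 - cut_prob D (real v / real (2 ^ K))) / real (2 ^ K)"
  have EC: "E (\<lambda>\<tau>. ?C \<tau> x) \<le> c0" if "x < n" for x
    using av_cut[OF that, of "2 ^ K" gC D] unfolding E_def c0_def gC_def by simp
  have "E (\<lambda>\<tau>. \<Sum>x<n. cost \<theta> D \<tau> x) = (\<Sum>x<n. E (\<lambda>\<tau>. cost \<theta> D \<tau> x))"
    unfolding E_def by (rule av_sum)
  also have "\<dots> \<le> (\<Sum>x<n. E (\<lambda>\<tau>. of_bool (gA (\<tau> x)) + (?B \<tau> x + - 1 / ln 2 * (?B \<tau> x * ?L \<tau> x)) + ?C \<tau> x))"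
    by (intro sum_mono E_mono cost_le)
  also have "\<dots> = (\<Sum>x<n. p + (p + - 1 / ln 2 * E (\<lambda>\<tau>. ?B \<tau> x * ?L \<tau> x)) + E (\<lambda>\<tau>. ?C \<tau> x))"
    unfolding E_add E_cmult by (intro sum.cong) (auto simp: E1)
  also have "\<dots> \<le> (\<Sum>x<n. (p + p + c0) + - 1 / ln 2 * E (\<lambda>\<tau>. ?B \<tau> x * ?L \<tau> x))"
    using EC by (intro sum_mono) auto
  also have "\<dots> = real n * (2 * p + c0) - (1 / ln 2) * (\<Sum>x<n. E (\<lambda>\<tau>. ?B \<tau> x * ?L \<tau> x))"
    by (simp only: sum.distrib sum_distrib_left[symmetric]) (simp add: algebra_simps)
  finally have 1: "E (\<lambda>\<tau>. \<Sum>x<n. cost \<theta> D \<tau> x)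
    \<le> real n * (2 * p + c0) - (1 / ln 2) * (\<Sum>x<n. E (\<lambda>\<tau>. ?B \<tau> x * ?L \<tau> x))" .
  have \<theta>2: "0 \<le> \<theta> - 8 * \<theta>\<^sup>2"
    using mult_left_mono[OF \<theta>(2), of \<theta>] \<theta>(1) by (simp add: power2_eq_square)
  have pq: "0 \<le> p\<^sup>2 * q" using p_bounds by simp
  let ?gain = "real n * (p\<^sup>2 * q * ((\<theta> - 8 * \<theta>\<^sup>2) / 16 - 32 * \<theta>\<^sup>2))"
  have "?gain \<le> (\<theta> - 8 * \<theta>\<^sup>2) * good_prob - 32 * \<theta>\<^sup>2 * p\<^sup>2 * q * real n"
  proof -
    have "real n / 16 * (p\<^sup>2 * q) \<le> good_prob"
      using mult_right_mono[OF P(2) pq] good_prob_ge[OF P(1)] by linarith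
    then have "(\<theta> - 8 * \<theta>\<^sup>2) * (real n / 16 * (p\<^sup>2 * q)) \<le> (\<theta> - 8 * \<theta>\<^sup>2) * good_prob"
      using \<theta>2 by (rule mult_left_mono)
    then show ?thesis by (simp add: algebra_simps)
  qed
  also have "\<dots> \<le> (\<Sum>x<n. E (\<lambda>\<tau>. ?B \<tau> x * ?L \<tau> x))"
    by (rule lead_gain[OF \<theta>(1)])
  finally have gain: "?gain \<le> (\<Sum>x<n. E (\<lambda>\<tau>. ?B \<tau> x * ?L \<tau> x))" .
  \<comment> \<open>The logarithm has base 2, so the gain carries a factor 1 / ln 2 > 1. It may be
    dropped because the gain is not negative, which is the purpose of the third assumption on
    \<theta>.\<close>
  have ln2: "1 \<le> 1 / ln (2::real)" using ln_2_less_1 by (simp add: field_simps)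
  have "0 \<le> ?gain" using \<theta>(3) by (intro mult_nonneg_nonneg[OF _ mult_nonneg_nonneg[OF pq]]) auto
  then have "1 * ?gain \<le> (1 / ln 2) * (\<Sum>x<n. E (\<lambda>\<tau>. ?B \<tau> x * ?L \<tau> x))"
    by (intro mult_mono[OF ln2 gain]) auto
  moreover have "real n * (2 * p + c0) \<le> real n * S0"
    using base unfolding c0_def by (intro mult_left_mono) auto
  ultimately show ?thesis using 1 by (simp add: right_diff_distrib)
qed

end

section \<open>Success probability of a round\<close>

lemma card_bounded_lists:
  assumes "\<And>x. x < n \<Longrightarrow> finite (W x)"
  shows "card {gs. length gs = n \<and> (\<forall>x<n. gs ! x \<in> W x)} = (\<Prod>x<n. card (W x))"
proof -
  have "bij_betw (\<lambda>f. map f [0..<n]) (PiE {..<n} W) {gs. length gs = n \<and> (\<forall>x<n. gs ! x \<in> W x)}"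
  proof (rule bij_betw_byWitness[where f' = "\<lambda>gs. restrict (\<lambda>x. gs ! x) {..<n}"])
    show "\<forall>f\<in>PiE {..<n} W. restrict (\<lambda>x. map f [0..<n] ! x) {..<n} = f"
      by (auto simp: fun_eq_iff PiE_def extensional_def)
    show "\<forall>gs\<in>{gs. length gs = n \<and> (\<forall>x<n. gs ! x \<in> W x)}. map (restrict (\<lambda>x. gs ! x) {..<n}) [0..<n] = gs"
      by (auto intro!: nth_equalityI)
    show "(\<lambda>f. map f [0..<n]) ` PiE {..<n} W \<subseteq> {gs. length gs = n \<and> (\<forall>x<n. gs ! x \<in> W x)}"
      by (auto simp: PiE_def Pi_def)
    show "(\<lambda>gs. restrict (\<lambda>x. gs ! x) {..<n}) ` {gs. length gs = n \<and> (\<forall>x<n. gs ! x \<in> W x)} \<subseteq> PiE {..<n} W"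
      by (auto simp: PiE_def Pi_def)
  qed
  then have "card {gs. length gs = n \<and> (\<forall>x<n. gs ! x \<in> W x)} = card (PiE {..<n} W)"
    by (rule bij_betw_same_card[symmetric])
  then show ?thesis by (simp add: card_PiE)
qed

definition word_lists :: "nat \<Rightarrow> nat \<Rightarrow> bool list list set" where
  "word_lists k n = {ws. length ws = n \<and> (\<forall>x<n. ws ! x \<in> {w. length w = k})}"

lemma card_word_lists: "card (word_lists k n) = (2 ^ k) ^ n"
  unfolding word_lists_def by (subst card_bounded_lists) (auto simp: card_words finite_words[where P = "\<lambda>_. True", simplified])

lemma finite_word_lists: "finite (word_lists k n)"
proof (rule ccontr)
  assume "infinite (word_lists k n)"
  then have "card (word_lists k n) = 0" by simp
  then show False by (simp add: card_word_lists)
qed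

text \<open>The right-hand side decreases in \<open>u\<close>, so u = n/16 is the worst case; there
  the claim is 15 (16/15)^16 \<le> 2^6, raised to the power n/16 and inverted.\<close>

lemma sparse_probability:
  assumes "real u \<le> real n / 16" "u \<le> n"
  shows "2 powr (- (3 / 8) * real n) \<le> (1 / 16) ^ u * (15 / 16) ^ (n - u)"
proof -
  have "ln (15 * (16 / 15 :: real) ^ 16) \<le> ln (2 ^ 6)"
    by (subst ln_le_cancel_iff) (simp_all add: power_divide divide_le_eq)
  moreover have "ln (15 * (16 / 15 :: real) ^ 16) = ln 15 + 16 * ln (16 / 15)"
    by (simp add: ln_mult ln_realpow)
  moreover have "ln ((2 :: real) ^ 6) = 6 * ln 2"
    by (subst ln_realpow) simp_all
  ultimately have *: "ln 15 + 16 * ln (16 / 15 :: real) \<le> 6 * ln 2"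
    by linarith
  have "(1 / 16 :: real) ^ u * (15 / 16) ^ (n - u) = exp (- real u * ln 16 - real (n - u) * ln (16 / 15))"
  proof -
    have "(1 / 16 :: real) ^ u = exp (- real u * ln 16)"
      by (simp add: exp_minus exp_of_nat_mult power_one_over inverse_eq_divide)
    moreover have "(15 / 16 :: real) ^ (n - u) = exp (- real (n - u) * ln (16 / 15))"
    proof -
      have "exp (- real (n - u) * ln (16 / 15)) = inverse (exp (real (n - u) * ln (16 / 15)))"
        by (simp add: exp_minus)
      also have "\<dots> = inverse ((16 / 15) ^ (n - u))" by (simp only: exp_of_nat_mult) simp
      also have "\<dots> = (15 / 16) ^ (n - u)" by (simp add: power_inverse[symmetric])
      finally show ?thesis ..
    qed
    ultimately show ?thesis by (simp add: exp_add[symmetric])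
  qed
  moreover have "- real u * ln 16 - real (n - u) * ln (16 / 15) = - (real u * ln 15) - real n * ln (16 / 15 :: real)"
  proof -
    have "ln (16 :: real) = ln 15 + ln (16 / 15)" by (simp add: ln_div)
    then show ?thesis using assms(2) by (simp add: of_nat_diff algebra_simps)
  qed
  moreover have "- (3 / 8) * (real n * ln 2) \<le> - (real u * ln 15) - real n * ln (16 / 15 :: real)"
  proof -
    have "real u * ln 15 \<le> (real n / 16) * ln (15 :: real)"
      using assms(1) by (intro mult_right_mono) auto
    moreover have "real n * (ln 15 + 16 * ln (16 / 15 :: real)) \<le> real n * (6 * ln 2)"
      using * by (intro mult_left_mono) auto
    then have "real n * ln 15 + 16 * (real n * ln (16 / 15 :: real)) \<le> 6 * (real n * ln 2)"
      by (simp add: algebra_simps)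
    ultimately show ?thesis by linarith
  qed
  ultimately have "exp (- (3 / 8) * (real n * ln 2)) \<le> (1 / 16 :: real) ^ u * (15 / 16) ^ (n - u)"
    by (simp only: exp_le_cancel_iff)
  then show ?thesis by (simp add: powr_def mult.commute mult.left_commute)
qed

section \<open>Counting favourable words for given times\<close>

context one_critical_cnf
begin

definition times :: "bool list list \<Rightarrow> nat \<Rightarrow> nat" where
  "times ts = restrict (\<lambda>x. val (ts ! x)) {..<n}"

lemma times_less: "x < n \<Longrightarrow> times ts x = val (ts ! x)"
  by (simp add: times_def)

text \<open>Turns counting over lists of words into the average \<open>E\<close> over times.\<close>

lemma bij_times: "bij_betw times (word_lists K n) (PiE {..<n} (\<lambda>_. {..<2 ^ K}))"
proof (rule bij_betw_byWitness[where f' = "\<lambda>\<tau>. map (\<lambda>x. words K ! \<tau> x) [0..<n]"])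
  show "\<forall>ts\<in>word_lists K n. map (\<lambda>x. words K ! times ts x) [0..<n] = ts"
  proof
    fix ts assume ts: "ts \<in> word_lists K n"
    have "words K ! times ts i = ts ! i" if "i < n" for i
      using that ts nth_words_val[of "ts ! i"] by (simp add: word_lists_def times_less)
    then show "map (\<lambda>x. words K ! times ts x) [0..<n] = ts"
      using ts by (intro nth_equalityI) (simp_all add: word_lists_def)
  qed
  show "\<forall>\<tau>\<in>PiE {..<n} (\<lambda>_. {..<2 ^ K}). times (map (\<lambda>x. words K ! \<tau> x) [0..<n]) = \<tau>"
    by (auto simp: fun_eq_iff times_def val_words_nth PiE_def extensional_def Pi_def)
  show "times ` word_lists K n \<subseteq> PiE {..<n} (\<lambda>_. {..<2 ^ K})"
    using val_less by (auto simp: word_lists_def times_def) metis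
  show "(\<lambda>\<tau>. map (\<lambda>x. words K ! \<tau> x) [0..<n]) ` PiE {..<n} (\<lambda>_. {..<2 ^ K}) \<subseteq> word_lists K n"
    using length_words[OF nth_mem] by (auto simp: word_lists_def length_words_list PiE_def Pi_def)
qed

lemma in_groups:
  assumes "length w = K"
  shows "in_A a w \<longleftrightarrow> gA (val w)" "in_B a w \<longleftrightarrow> gB (val w)" "in_B' a w \<longleftrightarrow> gB' (val w)" "in_C a w \<longleftrightarrow> gC (val w)"
proof -
  show A: "in_A a w \<longleftrightarrow> gA (val w)" using in_A_iff[of a w] assms a by (simp add: gA_def)
  show B: "in_B a w \<longleftrightarrow> gB (val w)" using in_B_iff[of a w] assms a by (simp add: gB_def)
  show "in_B' a w \<longleftrightarrow> gB' (val w)" using in_B'_iff[of a w] assms a by (simp add: gB'_def)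
  show "in_C a w \<longleftrightarrow> gC (val w)"
    unfolding in_C_def A B using groups_disjoint by blast
qed

definition count_votes :: "(nat \<Rightarrow> nat) \<Rightarrow> nat \<Rightarrow> bool \<Rightarrow> nat" where
  "count_votes \<tau> x b = card {c \<in> set cls. (x, b) \<in> set c \<and> supports \<tau> x c}"

lemma length_votes:
  assumes "set \<alpha>s = true_lits {y. y < n \<and> gA (\<tau> y)}" "set Cs = {y. y < n \<and> gC (\<tau> y)}"
  shows "length (votes cls \<alpha>s Cs (gB' (\<tau> x)) (x, b)) = count_votes \<tau> x b"
proof -
  have "votes cls \<alpha>s Cs (gB' (\<tau> x)) (x, b) = filter (\<lambda>c. (x, b) \<in> set c \<and> supports \<tau> x c) cls"
    unfolding votes_def
  proof (rule filter_cong[OF refl])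
    fix c assume c: "c \<in> set cls"
    have 1: "filter (\<lambda>l. fst l \<in> set Cs) c = filter (\<lambda>l. gC (\<tau> (fst l))) c"
      using vars_less[OF c] by (intro filter_cong) (auto simp: assms)
    have 2: "filter (\<lambda>l. neg l \<in> set \<alpha>s) c = filter (\<lambda>l. gA (\<tau> (fst l)) \<and> \<alpha> (fst l) \<noteq> snd l) c"
      using vars_less[OF c] by (intro filter_cong) (auto simp: assms true_lits_def neg_def)
    show "((x, b) \<in> set c \<and> length (filter (\<lambda>l. fst l \<in> set Cs) c) = 1 \<and>
       (length c = 3 \<and> length (filter (\<lambda>l. neg l \<in> set \<alpha>s) c) = 1 \<or> length c = 2 \<and> gB' (\<tau> x)))
       = ((x, b) \<in> set c \<and> supports \<tau> x c)"
      unfolding 1 2 supports_def by simp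
  qed
  then show ?thesis
    using distinct_cls by (simp add: count_votes_def distinct_length_filter Int_def conj_commute)
qed

text \<open>Given the times, the condition on the word of \<open>x\<close> does not involve the
  other words, because the votes are counted as if the guesses in A were right. If every word is of
  this kind, those guesses are indeed right, so the favourable choices contain a product over the
  variables.\<close>

definition ok_words :: "nat \<Rightarrow> nat \<Rightarrow> (nat \<Rightarrow> nat) \<Rightarrow> nat \<Rightarrow> bool list set" where
  "ok_words J D \<tau> x = {w. length w = Suc J \<and>
     (if gA (\<tau> x) then coin w = \<alpha> x
      else if gB (\<tau> x) then biased J (count_votes \<tau> x True) (count_votes \<tau> x False) w = \<alpha> x
      else cut D {x} {y. y < n \<and> \<tau> y < \<tau> x} \<or> coin w = \<alpha> x)}"

lemma ppsz_success:
  assumes ts: "ts \<in> word_lists K n" and gs: "length gs = n"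
    and ok: "\<And>x. x < n \<Longrightarrow> gs ! x \<in> ok_words J D (times ts) x"
  shows "ppsz_candidate a J K D n cls (entries n ts gs) = filter \<alpha> [0..<n]"
proof -
  let ?\<tau> = "times ts" and ?es = "entries n ts gs"
  have len: "length ts = n" "\<And>x. x < n \<Longrightarrow> length (ts ! x) = K" using ts by (auto simp: word_lists_def)
  have es: "?es = map (\<lambda>i. (i, ts ! i, gs ! i)) [0..<n]"
    unfolding entries_def using len gs by (auto simp: Cons_nth_drop_Suc[symmetric])
  have grp: "in_A a (ts ! x) \<longleftrightarrow> gA (?\<tau> x)" "in_B a (ts ! x) \<longleftrightarrow> gB (?\<tau> x)"
    "in_B' a (ts ! x) \<longleftrightarrow> gB' (?\<tau> x)" "in_C a (ts ! x) \<longleftrightarrow> gC (?\<tau> x)" if "x < n" for x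
    using in_groups[OF len(2)[OF that]] that by (simp_all add: times_less)
  have A: "set (A_lits a ?es) = true_lits {y. y < n \<and> gA (?\<tau> y)}"
    using ok grp unfolding A_lits_def es true_lits_def by (force simp: ok_words_def image_iff)
  have C: "set (C_vars a ?es) = {y. y < n \<and> gC (?\<tau> y)}"
    using grp unfolding C_vars_def es by (force simp: image_iff)
  have B: "set (B_lits a J cls ?es) = true_lits {y. y < n \<and> gB (?\<tau> y)}"
  proof -
    have "biased J (length (votes cls (A_lits a ?es) (C_vars a ?es) (in_B' a (ts ! x)) (x, True)))
       (length (votes cls (A_lits a ?es) (C_vars a ?es) (in_B' a (ts ! x)) (x, False))) (gs ! x) = \<alpha> x"
      if "x < n" "gB (?\<tau> x)" for x
      using ok[OF that(1)] that groups_disjoint(1)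
      by (simp add: grp length_votes[OF A C] ok_words_def)
    then show ?thesis
      using grp unfolding B_lits_def es true_lits_def by (force simp: image_iff)
  qed
  show ?thesis
  proof (rule ppsz_correct[OF _ _ len(1)])
    show "0 < a" "a \<le> K" "length gs = n" using a gs by auto
    show "length w = K" if "w \<in> set ts" for w using that len by (auto simp: in_set_conv_nth)
    have "{y. y < n \<and> \<not> in_C a (ts ! y)} = {y. y < n \<and> gA (?\<tau> y)} \<union> {y. y < n \<and> gB (?\<tau> y)}"
      using grp groups_disjoint by blast
    then show "set (A_lits a ?es) \<union> set (B_lits a J cls ?es) = true_lits {y. y < n \<and> \<not> in_C a (ts ! y)}"
      unfolding A B by (auto simp: true_lits_def)
    fix i assume i: "i < n" "in_C a (ts ! i)" and "\<not> cut D {i} {y. y < n \<and> val (ts ! y) < val (ts ! i)}"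
    moreover have "{y. y < n \<and> val (ts ! y) < val (ts ! i)} = {y. y < n \<and> ?\<tau> y < ?\<tau> i}"
      using i by (auto simp: times_less)
    ultimately show "coin (gs ! i) = \<alpha> i"
      using ok[OF i(1)] grp[OF i(1)] groups_disjoint by (auto simp: ok_words_def)
  qed
qed

lemma finite_ok_words: "finite (ok_words J D \<tau> x)"
  unfolding ok_words_def by (rule finite_words)

lemma card_ok_words:
  assumes "3 \<le> J"
  shows "real (card (ok_words J D \<tau> x)) = 2 ^ Suc J * 2 powr (- cost (1 / 2 ^ J) D \<tau> x)"
proof -
  have coin: "real (card {w. length w = Suc J \<and> coin w = b}) = 2 ^ J" for b
    using card_override[of J "\<lambda>_. False" True b] by simp
  consider "gA (\<tau> x)" "\<not> gB (\<tau> x)" "\<not> gC (\<tau> x)" | "gB (\<tau> x)" "\<not> gA (\<tau> x)" "\<not> gC (\<tau> x)"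
    | "gC (\<tau> x)" "\<not> gA (\<tau> x)" "\<not> gB (\<tau> x)"
    using groups_disjoint by blast
  then show ?thesis
  proof cases
    case 1
    then show ?thesis using coin[of "\<alpha> x"] by (simp add: ok_words_def cost_def powr_minus)
  next
    case 2
    have "(if \<alpha> x then int (count_votes \<tau> x True) - int (count_votes \<tau> x False)
        else int (count_votes \<tau> x False) - int (count_votes \<tau> x True)) = int (right_votes \<tau> x) - int (wrong_votes \<tau> x)"
      by (cases "\<alpha> x") (simp_all add: count_votes_def right_votes_def wrong_votes_def)
    then have c: "real (card (ok_words J D \<tau> x)) = 2 ^ J + real_of_int (lead \<tau> x)"
      using 2 assms by (simp add: ok_words_def card_biased lead_def)
    have "(2::real) ^ 3 \<le> 2 ^ J" using assms by (intro power_increasing) auto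
    then have J: "(8::real) \<le> 2 ^ J" by simp
    have pos: "0 < 1 + lead \<tau> x / 2 ^ J"
      using abs_lead[of \<tau> x] J by (simp add: field_simps abs_le_iff)
    have "2 powr (- cost (1 / 2 ^ J) D \<tau> x) = 2 powr (log 2 (1 + lead \<tau> x / 2 ^ J) - 1)"
      using 2 by (simp add: cost_def)
    also have "\<dots> = (1 + lead \<tau> x / 2 ^ J) / 2"
      using pos by (simp add: powr_diff)
    finally show ?thesis unfolding c by (simp add: field_simps)
  next
    case 3
    show ?thesis
    proof (cases "cut D {x} {y. y < n \<and> \<tau> y < \<tau> x}")
      case True
      then show ?thesis using 3 card_words[of "Suc J"] by (simp add: ok_words_def cost_def)
    next
      case False
      then show ?thesis using 3 coin[of "\<alpha> x"] by (simp add: ok_words_def cost_def powr_minus)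
    qed
  qed
qed

text \<open>Quantifying over the previous output makes the success probability of a round
  independent of the history.\<close>

definition successes :: "nat \<Rightarrow> nat \<Rightarrow> (bool list list \<times> bool list list) set" where
  "successes J D = {(ts, gs). ts \<in> word_lists K n \<and> gs \<in> word_lists (Suc J) n \<and>
     (\<forall>out. attempt a J K D cls ts gs out = map \<alpha> [0..<n])}"

lemma finite_successes: "finite (successes J D)"
  by (rule finite_subset[of _ "word_lists K n \<times> word_lists (Suc J) n"])
    (auto simp: successes_def finite_word_lists)

text \<open>For fixed times the favourable guess words contain a product, whose proportion is 2 to
  the minus total cost. Averaging over the times and Jensen's inequality replace the random cost by
  its expectation.\<close>

lemma card_successes_dense:
  assumes J: "3 \<le> J"
  shows "real (card (word_lists K n \<times> word_lists (Suc J) n)) * 2 powr (- E (\<lambda>\<tau>. \<Sum>x<n. cost (1 / 2 ^ J) D \<tau> x))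
    \<le> real (card (successes J D))"
proof -
  let ?W = "\<lambda>ts. {gs. length gs = n \<and> (\<forall>x<n. gs ! x \<in> ok_words J D (times ts) x)}"
  let ?c = "\<lambda>\<tau>. \<Sum>x<n. cost (1 / 2 ^ J) D \<tau> x"
  have sub: "Sigma (word_lists K n) ?W \<subseteq> successes J D"
  proof
    fix z assume "z \<in> Sigma (word_lists K n) ?W"
    then obtain ts gs where z: "z = (ts, gs)" and ts: "ts \<in> word_lists K n"
      and gs: "length gs = n" "\<forall>x<n. gs ! x \<in> ok_words J D (times ts) x" by auto
    have "gs \<in> word_lists (Suc J) n" using gs by (auto simp: word_lists_def ok_words_def)
    then show "z \<in> successes J D"
      unfolding z using ts attempt_correct ppsz_success[OF ts gs(1)] gs(2) by (auto simp: successes_def)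
  qed
  have fin: "finite (?W ts)" for ts
  proof (rule finite_subset)
    show "?W ts \<subseteq> word_lists (Suc J) n" by (auto simp: word_lists_def ok_words_def)
  qed (rule finite_word_lists)
  have card_W: "real (card (?W ts)) = (2 ^ Suc J) ^ n * 2 powr (- ?c (times ts))" for ts
  proof -
    have "real (card (?W ts)) = (\<Prod>x<n. real (card (ok_words J D (times ts) x)))"
      using finite_ok_words by (subst card_bounded_lists) auto
    also have "\<dots> = (\<Prod>x<n. 2 ^ Suc J * 2 powr (- cost (1 / 2 ^ J) D (times ts) x))"
      by (simp only: card_ok_words[OF J])
    also have "\<dots> = (2 ^ Suc J) ^ n * 2 powr (\<Sum>x<n. - cost (1 / 2 ^ J) D (times ts) x)"
      unfolding prod.distrib by (subst powr_sum) auto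
    finally show ?thesis by (simp add: sum_negf)
  qed
  have "real (card (word_lists K n \<times> word_lists (Suc J) n)) * 2 powr (- E ?c)
    \<le> real (card (word_lists K n \<times> word_lists (Suc J) n)) * E (\<lambda>\<tau>. 2 powr (- ?c \<tau>))"
    unfolding E_def by (intro mult_left_mono av_powr_ge) auto
  also have "\<dots> = (2 ^ Suc J) ^ n * (\<Sum>\<tau>\<in>PiE {..<n} (\<lambda>_. {..<2 ^ K}). 2 powr (- ?c \<tau>))"
    by (simp add: card_cartesian_product card_word_lists E_def av_def)
  also have "\<dots> = (2 ^ Suc J) ^ n * (\<Sum>ts\<in>word_lists K n. 2 powr (- ?c (times ts)))"
    by (subst sum.reindex_bij_betw[OF bij_times, symmetric]) simp
  also have "\<dots> = (\<Sum>ts\<in>word_lists K n. real (card (?W ts)))"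
    by (simp only: card_W sum_distrib_left)
  also have "\<dots> = real (card (Sigma (word_lists K n) ?W))"
    by (subst card_SigmaI) (auto simp: finite_word_lists fin)
  also have "\<dots> \<le> real (card (successes J D))"
    using card_mono[OF finite_successes sub] by simp
  finally show ?thesis .
qed

text \<open>It suffices that every covered variable is guessed rightly and no other variable is
  guessed wrongly; by independence this has probability (1/16)^u (15/16)^(n - u) for u covered
  variables, whatever the times are.\<close>

lemma card_successes_sparse:
  assumes J: "3 \<le> J" and P: "packing P" "real (card (covered P)) \<le> real n / 16"
    "\<And>c. c \<in> set cls \<Longrightarrow> length (tlits c) = 2 \<Longrightarrow> \<exists>l\<in>set (tlits c). fst l \<in> covered P"
  shows "real (card (word_lists K n \<times> word_lists (Suc J) n)) * 2 powr (- (3 / 8) * real n)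
    \<le> real (card (successes J D))"
proof -
  let ?U = "covered P"
  let ?Z = "{e :: bool list. length e = J \<and> take 3 e = [True, True, True]}"
  \<comment> \<open>\<open>Z\<close> holds the tails that trigger a guess; for uncovered variables
    only the combination of such a tail with the wrong bit is forbidden.\<close>
  define W where "W x = (if x \<in> ?U then (#) (\<alpha> x) ` ?Z else {w. length w = Suc J} - (#) (\<not> \<alpha> x) ` ?Z)" for x
  have U: "?U \<subseteq> {..<n}" by (rule covered_less[OF P(1)])
  have card_Z: "card ?Z = 2 ^ (J - 3)"
  proof -
    have "?Z = (\<lambda>e. [True, True, True] @ e) ` {e. length e = J - 3}"
    proof
      show "?Z \<subseteq> (\<lambda>e. [True, True, True] @ e) ` {e. length e = J - 3}"
      proof
        fix e assume "e \<in> ?Z"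
        then have "e = [True, True, True] @ drop 3 e" "length (drop 3 e) = J - 3"
          by (auto, metis append_take_drop_id append_Cons append_Nil)
        then show "e \<in> (\<lambda>e. [True, True, True] @ e) ` {e. length e = J - 3}" by blast
      qed
    qed (use J in auto)
    moreover have "inj (\<lambda>e. [True, True, True] @ e)" by (auto simp: inj_def)
    ultimately show ?thesis
      using card_image[of "\<lambda>e. [True, True, True] @ e" "{e. length e = J - 3}"] card_words[of "J - 3"]
      by (simp add: inj_on_subset)
  qed
  have pow: "(2::real) ^ J = 8 * 2 ^ (J - 3)"
    using J power_add[of "2::real" 3 "J - 3"] by simp
  have card_W: "real (card (W x)) = 2 ^ Suc J * (if x \<in> ?U then 1 / 16 else 15 / 16)" for x
  proof (cases "x \<in> ?U")
    case True
    then show ?thesis using card_Z pow by (simp add: W_def card_image)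
  next
    case False
    have "card ({w. length w = Suc J} - (#) (\<not> \<alpha> x) ` ?Z) = card {w :: bool list. length w = Suc J} - card ((#) (\<not> \<alpha> x) ` ?Z)"
      by (rule card_Diff_subset) (auto simp: finite_words)
    also have "\<dots> = 2 ^ Suc J - 2 ^ (J - 3)"
      using card_Z card_words[of "Suc J"] by (simp add: card_image)
    finally have "card (W x) = 2 ^ Suc J - 2 ^ (J - 3)" using False by (simp add: W_def)
    moreover have "(2::nat) ^ (J - 3) \<le> 2 ^ Suc J" by (intro power_increasing) auto
    ultimately have "real (card (W x)) = 2 ^ Suc J - 2 ^ (J - 3)" by (simp add: of_nat_diff)
    then show ?thesis using False pow by simp
  qed
  have fin: "finite (W x)" for x
    by (auto simp: W_def finite_words finite_words[where P = "\<lambda>_. True", simplified])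
  let ?G = "{gs. length gs = n \<and> (\<forall>x<n. gs ! x \<in> W x)}"
  have "word_lists K n \<times> ?G \<subseteq> successes J D"
  proof
    fix z assume "z \<in> word_lists K n \<times> ?G"
    then obtain ts gs where z: "z = (ts, gs)" and ts: "ts \<in> word_lists K n"
      and gs: "length gs = n" "\<forall>x<n. gs ! x \<in> W x" by auto
    let ?es = "entries n ts gs"
    have len: "length ts = n" using ts by (auto simp: word_lists_def)
    have es: "?es = map (\<lambda>i. (i, ts ! i, gs ! i)) [0..<n]"
      unfolding entries_def using len gs by (auto simp: Cons_nth_drop_Suc[symmetric])
    have Gs: "gs \<in> word_lists (Suc J) n"
      using gs by (auto simp: word_lists_def W_def split: if_splits)
    have guess: "(x, b) \<in> set (guessed ?es) \<longleftrightarrow> x < n \<and> take 3 (tl (gs ! x)) = [True, True, True] \<and> b = coin (gs ! x)" for x b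
      unfolding guessed_def es by (auto simp: image_iff)
    have right: "coin (gs ! x) = \<alpha> x" if x: "x < n" "take 3 (tl (gs ! x)) = [True, True, True]" for x
    proof -
      have "length (gs ! x) = Suc J" using Gs x by (auto simp: word_lists_def)
      then obtain b e where e: "gs ! x = b # e" "length e = J" by (auto simp: length_Suc_conv)
      have W: "b # e \<in> W x" and Z: "e \<in> ?Z" using gs(2) x e by auto
      have "b = \<alpha> x"
      proof (cases "x \<in> ?U")
        case True
        then show ?thesis using W by (auto simp: W_def)
      next
        case False
        then have "b # e \<notin> (#) (\<not> \<alpha> x) ` ?Z" using W by (simp add: W_def)
        then have "b \<noteq> (\<not> \<alpha> x)" using Z by blast
        then show ?thesis by blast
      qed
      then show ?thesis using e by (simp add: coin_def)
    qed
    have in_U: "take 3 (tl (gs ! x)) = [True, True, True]" if "x \<in> ?U" for x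
    proof -
      have "gs ! x \<in> W x" using gs(2) that U by auto
      then show ?thesis using that by (auto simp: W_def)
    qed
    have "linear_candidate n cls ?es = filter \<alpha> [0..<n]"
    proof (rule linear_candidate_correct)
      show "fst l < n \<and> \<alpha> (fst l) = snd l" if "l \<in> set (guessed ?es)" for l
        using that right guess[of "fst l" "snd l"] by simp
      fix c assume c: "c \<in> set cls" "length (tlits c) = 2"
      then obtain l where l: "l \<in> set (tlits c)" "fst l \<in> ?U" using P(3) by blast
      have "fst l < n" using l U by auto
      then have "coin (gs ! fst l) = \<alpha> (fst l)" using in_U l(2) by (intro right) auto
      moreover have "\<alpha> (fst l) = snd l" "l \<in> set c" using l by (auto simp: tlits_def)
      ultimately have "(fst l, snd l) \<in> set (guessed ?es)"
        unfolding guess using in_U l U by auto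
      then show "\<exists>l\<in>set c. l \<in> set (guessed ?es)" using \<open>l \<in> set c\<close> by auto
    qed
    then show "z \<in> successes J D"
      unfolding z using ts Gs attempt_correct by (auto simp: successes_def)
  qed
  then have "card (word_lists K n \<times> ?G) \<le> card (successes J D)"
    by (rule card_mono[OF finite_successes])
  then have "real (card (word_lists K n)) * real (card ?G) \<le> real (card (successes J D))"
    unfolding card_cartesian_product of_nat_mult[symmetric] by (rule of_nat_mono)
  moreover have "real (card ?G) \<ge> (2 ^ Suc J) ^ n * 2 powr (- (3 / 8) * real n)"
  proof -
    have "real (card ?G) = (\<Prod>x<n. real (card (W x)))"
      using fin by (subst card_bounded_lists) auto
    also have "\<dots> = (2 ^ Suc J) ^ n * (\<Prod>x<n. if x \<in> ?U then 1 / 16 else 15 / 16)"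
      unfolding card_W prod.distrib by simp
    also have "(\<Prod>x<n. if x \<in> ?U then 1 / 16 else 15 / 16 :: real) = (1 / 16) ^ card ?U * (15 / 16) ^ (n - card ?U)"
    proof -
      have "{..<n} \<inter> {x. x \<in> ?U} = ?U" "{..<n} \<inter> - {x. x \<in> ?U} = {..<n} - ?U" using U by auto
      moreover have "card ({..<n} - ?U) = n - card ?U"
        using U finite_subset[OF U] by (simp add: card_Diff_subset)
      ultimately show ?thesis by (simp add: prod.If_cases)
    qed
    finally have eq: "real (card ?G) = (2 ^ Suc J) ^ n * ((1 / 16) ^ card ?U * (15 / 16) ^ (n - card ?U))" .
    have "2 powr (- (3 / 8) * real n) \<le> (1 / 16) ^ card ?U * (15 / 16) ^ (n - card ?U)"
      using P(2) card_mono[OF _ U] by (intro sparse_probability) auto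
    then show ?thesis unfolding eq by (intro mult_left_mono) auto
  qed
  then have "real (card (word_lists K n)) * ((2 ^ Suc J) ^ n * 2 powr (- (3 / 8) * real n))
     \<le> real (card (word_lists K n)) * real (card ?G)"
    by (rule mult_left_mono) simp
  ultimately have "real (card (word_lists K n)) * ((2 ^ Suc J) ^ n * 2 powr (- (3 / 8) * real n)) \<le> real (card (successes J D))"
    by linarith
  then show ?thesis by (simp add: card_cartesian_product card_word_lists mult_ac)
qed

end

section \<open>Sampling programs\<close>

lemma pair_pmf_of_set:
  assumes "finite A" "A \<noteq> {}" "finite B" "B \<noteq> {}"
  shows "pair_pmf (pmf_of_set A) (pmf_of_set B) = pmf_of_set (A \<times> B)"
proof (rule pmf_eqI)
  fix z show "pmf (pair_pmf (pmf_of_set A) (pmf_of_set B)) z = pmf (pmf_of_set (A \<times> B)) z"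
    using assms by (cases z) (auto simp: pmf_pair indicator_def card_cartesian_product)
qed

lemma replicate_pmf_of_set:
  assumes "finite A" "A \<noteq> {}"
  shows "replicate_pmf n (pmf_of_set A) = pmf_of_set {xs. set xs \<subseteq> A \<and> length xs = n}"
proof (induction n)
  case 0
  have "{xs. set xs \<subseteq> A \<and> length xs = 0} = {[]}" by auto
  then show ?case by (simp add: pmf_of_set_singleton)
next
  case (Suc n)
  let ?X = "{xs. set xs \<subseteq> A \<and> length xs = n}"
  obtain x where "x \<in> A" using assms(2) by blast
  then have "replicate n x \<in> ?X" by auto
  then have X: "finite ?X" "?X \<noteq> {}" using finite_lists_length_eq[OF assms(1)] by blast+
  have "replicate_pmf (Suc n) (pmf_of_set A) = map_pmf (\<lambda>(x, xs). x # xs) (pair_pmf (pmf_of_set A) (pmf_of_set ?X))"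
    by (simp add: Suc pair_pmf_def map_bind_pmf)
  also have "\<dots> = pmf_of_set ((\<lambda>(x, xs). x # xs) ` (A \<times> ?X))"
    unfolding pair_pmf_of_set[OF assms X]
    by (rule map_pmf_of_set_inj) (use assms X in \<open>auto simp: inj_on_def\<close>)
  also have "(\<lambda>(x, xs). x # xs) ` (A \<times> ?X) = {xs. set xs \<subseteq> A \<and> length xs = Suc n}"
    by (auto simp: length_Suc_conv image_iff)
  finally show ?case .
qed

text \<open>The programs prepend each new draw to the list, whereas \<open>replicate_pmf\<close>
  draws the head first; independent draws commute.\<close>

lemma replicate_pmf_Suc':
  "replicate_pmf (Suc n) p = bind_pmf (replicate_pmf n p) (\<lambda>xs. bind_pmf p (\<lambda>x. return_pmf (x # xs)))"
  by (simp add: bind_commute_pmf[of p])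

definition fair :: "bool pmf" where
  "fair = pmf_of_set UNIV"

text \<open>A coupling: execution surely terminates within time \<open>T\<close>, and its final state is related by
  \<open>\<Phi>\<close> to a value drawn from \<open>\<mu>\<close>.\<close>

definition samples :: "com \<Rightarrow> state \<Rightarrow> 'a pmf \<Rightarrow> ('a \<Rightarrow> state \<Rightarrow> bool) \<Rightarrow> nat \<Rightarrow> bool" where
  "samples P s \<mu> \<Phi> T \<longleftrightarrow> (\<exists>\<nu>. exec P s = spmf_of_pmf \<nu> \<and> rel_pmf (\<lambda>a (s', t). \<Phi> a s' \<and> t \<le> T) \<mu> \<nu>)"

lemma samples_mono:
  assumes "samples P s \<mu> \<Phi> T" "\<And>a s'. \<Phi> a s' \<Longrightarrow> \<Psi> a s'" "T \<le> T'"
  shows "samples P s \<mu> \<Psi> T'"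
proof -
  obtain \<nu> where \<nu>: "exec P s = spmf_of_pmf \<nu>" "rel_pmf (\<lambda>a (s', t). \<Phi> a s' \<and> t \<le> T) \<mu> \<nu>"
    using assms(1) by (auto simp: samples_def)
  have "rel_pmf (\<lambda>a (s', t). \<Psi> a s' \<and> t \<le> T') \<mu> \<nu>"
    by (rule pmf.rel_mono_strong[OF \<nu>(2)]) (use assms(2,3) in auto)
  then show ?thesis using \<nu>(1) by (auto simp: samples_def)
qed

lemma samples_runs: "runs P s s' t \<Longrightarrow> \<Phi> a s' \<Longrightarrow> t \<le> T \<Longrightarrow> samples P s (return_pmf a) \<Phi> T"
  unfolding samples_def runs_def
  by (rule exI[of _ "return_pmf (s', t)"]) (simp add: spmf_of_pmf_return_pmf)

lemma samples_Assign:
  "\<Phi> a (s(x := eval_exp e s)) \<Longrightarrow> 1 + exp_cost e \<le> T \<Longrightarrow> samples (Assign x e) s (return_pmf a) \<Phi> T"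
  by (rule samples_runs[OF runs_Assign]) auto

lemma enc_bool_eq: "enc b = tree_of_bool b"
  by (simp add: enc_bool_def)

lemma samples_Toss: "samples (Toss x) s fair (\<lambda>b s'. s' = s(x := enc b)) 1"
  unfolding samples_def
proof (intro exI conjI)
  show "exec (Toss x) s = spmf_of_pmf (map_pmf (\<lambda>b. (s(x := enc b), 1::nat)) fair)"
    by (simp add: fair_def enc_bool_eq map_spmf_of_pmf[symmetric] spmf_of_pmf_pmf_of_set del: map_spmf_of_pmf)
  show "rel_pmf (\<lambda>b (s', t). s' = s(x := enc b) \<and> t \<le> 1) fair (map_pmf (\<lambda>b. (s(x := enc b), 1::nat)) fair)"
    unfolding pmf.rel_map by (rule pmf.rel_refl) simp
qed

text \<open>Common core of sequence and loop; \<open>k\<close> is the cost of the loop test, and 0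
  for a sequence.\<close>

lemma bind_exec:
  assumes \<nu>: "exec_P = spmf_of_pmf \<nu>" "rel_pmf (\<lambda>a (s', t). \<Phi> a s' \<and> t \<le> T1) \<mu> \<nu>"
    and Q: "\<And>a s'. \<Phi> a s' \<Longrightarrow> samples Q s' (f a) \<Psi> T2"
  shows "\<exists>\<nu>'. bind_spmf exec_P (\<lambda>(s', t). map_spmf (add_cost (k + t)) (exec Q s')) = spmf_of_pmf \<nu>'
    \<and> rel_pmf (\<lambda>a (s', t). \<Psi> a s' \<and> t \<le> k + T1 + T2) (bind_pmf \<mu> f) \<nu>'"
proof -
  \<comment> \<open>From states that violate \<Phi> the program may diverge, so a proper
    distribution is chosen only where one exists; the coupling guarantees this on the support of
    \<nu>.\<close>
  define N where "N s' = (SOME \<nu>. exec Q s' = spmf_of_pmf \<nu>)" for s'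
  have N: "exec Q s' = spmf_of_pmf (N s')" if "\<Phi> a s'" for a s'
    using Q[OF that] someI_ex[of "\<lambda>\<nu>. exec Q s' = spmf_of_pmf \<nu>"] by (auto simp: samples_def N_def)
  let ?\<nu> = "bind_pmf \<nu> (\<lambda>(s', t). map_pmf (add_cost (k + t)) (N s'))"
  have supp: "\<exists>a. \<Phi> a s' \<and> t \<le> T1" if "(s', t) \<in> set_pmf \<nu>" for s' t
    using rel_pmf_imp_rel_set[OF \<nu>(2)] that by (auto simp: rel_set_def)
  have "bind_spmf exec_P (\<lambda>(s', t). map_spmf (add_cost (k + t)) (exec Q s'))
      = bind_pmf \<nu> (\<lambda>(s', t). map_spmf (add_cost (k + t)) (exec Q s'))"
    by (simp add: \<nu>(1))
  also have "\<dots> = bind_pmf \<nu> (\<lambda>z. spmf_of_pmf (case z of (s', t) \<Rightarrow> map_pmf (add_cost (k + t)) (N s')))"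
  proof (rule bind_pmf_cong[OF refl])
    fix z assume "z \<in> set_pmf \<nu>"
    moreover obtain s' t where z: "z = (s', t)" by (cases z)
    ultimately obtain a where "\<Phi> a s'" using supp by auto
    then show "(case z of (s', t) \<Rightarrow> map_spmf (add_cost (k + t)) (exec Q s'))
       = spmf_of_pmf (case z of (s', t) \<Rightarrow> map_pmf (add_cost (k + t)) (N s'))"
      using N by (simp add: z)
  qed
  also have "\<dots> = spmf_of_pmf ?\<nu>" by (simp add: spmf_of_pmf_bind)
  finally have 1: "bind_spmf exec_P (\<lambda>(s', t). map_spmf (add_cost (k + t)) (exec Q s')) = spmf_of_pmf ?\<nu>" .
  have "rel_pmf (\<lambda>a (s', t). \<Psi> a s' \<and> t \<le> k + T1 + T2) (bind_pmf \<mu> f) ?\<nu>"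
  proof (rule rel_pmf_bindI[OF \<nu>(2)])
    fix a z assume az: "case z of (s', t) \<Rightarrow> \<Phi> a s' \<and> t \<le> T1"
    obtain s' t where z: "z = (s', t)" by (cases z)
    then have \<Phi>: "\<Phi> a s'" "t \<le> T1" using az by auto
    obtain \<nu>' where \<nu>': "exec Q s' = spmf_of_pmf \<nu>'" "rel_pmf (\<lambda>a (s', t). \<Psi> a s' \<and> t \<le> T2) (f a) \<nu>'"
      using Q[OF \<Phi>(1)] by (auto simp: samples_def)
    have N_eq: "\<nu>' = N s'" using N[OF \<Phi>(1)] \<nu>'(1) by (intro pmf_eqI) (metis spmf_spmf_of_pmf)
    show "rel_pmf (\<lambda>a (s', t). \<Psi> a s' \<and> t \<le> k + T1 + T2) (f a) (case z of (s', t) \<Rightarrow> map_pmf (add_cost (k + t)) (N s'))"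
      unfolding z prod.case pmf.rel_map N_eq[symmetric]
      by (rule pmf.rel_mono_strong[OF \<nu>'(2)]) (use \<Phi>(2) in \<open>auto simp: add_cost_def\<close>)
  qed
  with 1 show ?thesis by blast
qed

lemma samples_Seq:
  assumes "samples P s \<mu> \<Phi> T1" "\<And>a s'. \<Phi> a s' \<Longrightarrow> samples Q s' (f a) \<Psi> T2"
  shows "samples (Seq P Q) s (bind_pmf \<mu> f) \<Psi> (T1 + T2)"
proof -
  obtain \<nu> where \<nu>: "exec P s = spmf_of_pmf \<nu>" "rel_pmf (\<lambda>a (s', t). \<Phi> a s' \<and> t \<le> T1) \<mu> \<nu>"
    using assms(1) by (auto simp: samples_def)
  from bind_exec[OF \<nu> assms(2), where k = 0] show ?thesis
    by (simp add: samples_def)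
qed

primrec iterate_pmf :: "nat \<Rightarrow> ('a \<Rightarrow> 'a pmf) \<Rightarrow> 'a \<Rightarrow> 'a pmf" where
  "iterate_pmf 0 f a = return_pmf a"
| "iterate_pmf (Suc n) f a = bind_pmf (f a) (iterate_pmf n f)"

text \<open>The loop counts a unary register down to \<open>Leaf\<close>, so it makes exactly
  \<open>n\<close> rounds and terminates surely.\<close>

lemma samples_While:
  assumes I: "\<And>j a s. I j a s \<Longrightarrow> s C = enc (j::nat)"
    and body: "\<And>j a s. I (Suc j) a s \<Longrightarrow> samples P s (f a) (\<lambda>a s'. I j a s') T"
    and init: "I n a s"
  shows "samples (While (Reg C) P) s (iterate_pmf n f a) (\<lambda>a s'. I 0 a s') (2 + n * (T + 2))"
  using init
proof (induction n arbitrary: a s)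
  case 0
  have "runs (While (Reg C) P) s s (1 + exp_cost (Reg C))"
    by (rule runs_While_False) (use I[OF 0] in simp)
  then have "samples (While (Reg C) P) s (return_pmf a) (\<lambda>a s'. I 0 a s') (2 + 0)"
    by (rule samples_runs) (use 0 in auto)
  then show ?case by simp
next
  case (Suc n)
  have ne: "eval_exp (Reg C) s \<noteq> Leaf" using I[OF Suc.prems] by simp
  obtain \<nu> where \<nu>: "exec P s = spmf_of_pmf \<nu>" "rel_pmf (\<lambda>a (s', t). I n a s' \<and> t \<le> T) (f a) \<nu>"
    using body[OF Suc.prems] by (auto simp: samples_def)
  have "\<exists>\<nu>'. bind_spmf (exec P s) (\<lambda>(s', t). map_spmf (add_cost (2 + t)) (exec (While (Reg C) P) s')) = spmf_of_pmf \<nu>'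
    \<and> rel_pmf (\<lambda>a (s', t). I 0 a s' \<and> t \<le> 2 + T + (2 + n * (T + 2))) (bind_pmf (f a) (iterate_pmf n f)) \<nu>'"
    by (rule bind_exec[OF \<nu> Suc.IH])
  moreover have "exec (While (Reg C) P) s = bind_spmf (exec P s) (\<lambda>(s', t). map_spmf (add_cost (2 + t)) (exec (While (Reg C) P) s'))"
    using ne by (simp add: while_loop.simps[of "Reg C" "exec P" s])
  ultimately show ?case by (simp add: samples_def add_ac)
qed

lemma iterate_pmf_return: "iterate_pmf n (\<lambda>a. return_pmf (g a)) a = return_pmf ((g ^^ n) a)"
  by (induction n arbitrary: a) (simp_all add: bind_return_pmf funpow_swap1)

lemma samples_Seq_det:
  assumes "samples P s (return_pmf a) \<Phi> T1" "\<And>s'. \<Phi> a s' \<Longrightarrow> samples Q s' \<mu> \<Psi> T2"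
  shows "samples (Seq P Q) s \<mu> \<Psi> (T1 + T2)"
proof -
  have "samples P s (return_pmf a) (\<lambda>b s'. b = a \<and> \<Phi> a s') T1"
  proof -
    obtain \<nu> where \<nu>: "exec P s = spmf_of_pmf \<nu>" "rel_pmf (\<lambda>b (s', t). \<Phi> b s' \<and> t \<le> T1) (return_pmf a) \<nu>"
      using assms(1) by (auto simp: samples_def)
    have "rel_pmf (\<lambda>b (s', t). (b = a \<and> \<Phi> a s') \<and> t \<le> T1) (return_pmf a) \<nu>"
      by (rule pmf.rel_mono_strong[OF \<nu>(2)]) auto
    then show ?thesis using \<nu>(1) by (auto simp: samples_def)
  qed
  from samples_Seq[OF this, of Q "\<lambda>_. \<mu>" \<Psi> T2] assms(2) show ?thesis
    by (auto simp: bind_return_pmf)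
qed

text \<open>The coupling carries the event that \<open>a\<close> is drawn into the event that
  \<open>g a\<close> is output. As the time bound holds surely, it also bounds the expectation, and
  no mass is lost to divergence.\<close>

lemma samples_output_prob:
  assumes "samples P ((\<lambda>_. Leaf)(0 := inp)) \<mu> (\<lambda>a s'. s' 0 = g a) T"
  shows "pmf \<mu> a \<le> output_prob P inp (g a)" "expected_time P inp \<le> of_nat T"
proof -
  obtain \<nu> where \<nu>: "exec P ((\<lambda>_. Leaf)(0 := inp)) = spmf_of_pmf \<nu>"
      "rel_pmf (\<lambda>a (s', t). s' 0 = g a \<and> t \<le> T) \<mu> \<nu>"
    using assms by (auto simp: samples_def)
  let ?\<rho> = "map_pmf (\<lambda>(s, t). (s 0, t)) \<nu>"
  have run: "run P inp = spmf_of_pmf ?\<rho>" unfolding run_def \<nu>(1) by simp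
  have rel: "rel_pmf (\<lambda>a (y, t). y = g a \<and> t \<le> T) \<mu> ?\<rho>"
    unfolding pmf.rel_map by (rule pmf.rel_mono_strong[OF \<nu>(2)]) auto
  have "pmf \<mu> a = measure_pmf.prob \<mu> {a}" by (simp add: measure_pmf_single)
  also have "\<dots> \<le> measure_pmf.prob ?\<rho> {z. \<exists>x\<in>{a}. case z of (y, t) \<Rightarrow> y = g x \<and> t \<le> T}"
    by (rule rel_pmf_measureD[OF rel])
  also have "\<dots> \<le> measure_pmf.prob ?\<rho> (fst -` {g a})"
    by (rule measure_pmf.finite_measure_mono) auto
  also have "\<dots> = output_prob P inp (g a)"
    unfolding output_prob_def run by (simp add: pmf_map)
  finally show "pmf \<mu> a \<le> output_prob P inp (g a)" .
  have "AE z in measure_pmf ?\<rho>. snd z \<le> T"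
    using rel_pmf_imp_rel_set[OF rel] by (auto simp: AE_measure_pmf_iff rel_set_def)
  then have "(\<integral>\<^sup>+ z. of_nat (snd z) \<partial>measure_pmf ?\<rho>) \<le> (\<integral>\<^sup>+ z. of_nat T \<partial>measure_pmf ?\<rho>)"
    by (intro nn_integral_mono_AE) auto
  then have "(\<integral>\<^sup>+ (y, t). of_nat t \<partial>measure_pmf ?\<rho>) \<le> of_nat T"
    by (simp add: case_prod_beta')
  then show "expected_time P inp \<le> of_nat T"
    unfolding expected_time_def run by simp
qed

section \<open>Programs that draw words and compute powers of two\<close>

primrec toss_word :: "nat \<Rightarrow> register \<Rightarrow> register \<Rightarrow> com" where
  "toss_word 0 w b = Assign w LeafE"
| "toss_word (Suc k) w b = Seq (toss_word k w b) (Seq (Toss b) (Assign w (NodeE (Reg b) (Reg w))))"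

lemma samples_toss_word:
  assumes "w \<noteq> b"
  shows "samples (toss_word k w b) s (replicate_pmf k fair)
    (\<lambda>ws s'. s' w = enc ws \<and> (\<forall>r. r \<noteq> w \<and> r \<noteq> b \<longrightarrow> s' r = s r)) (2 + k * 5)"
proof (induction k)
  case 0
  have "samples (Assign w LeafE) s (return_pmf []) (\<lambda>ws s'. s' w = enc ws \<and> (\<forall>r. r \<noteq> w \<and> r \<noteq> b \<longrightarrow> s' r = s r)) 2"
    by (intro samples_Assign) auto
  then show ?case by simp
next
  case (Suc k)
  have "samples (Seq (Toss b) (Assign w (NodeE (Reg b) (Reg w)))) s1 (bind_pmf fair (\<lambda>x. return_pmf (x # ws)))
     (\<lambda>ws s'. s' w = enc ws \<and> (\<forall>r. r \<noteq> w \<and> r \<noteq> b \<longrightarrow> s' r = s r)) (1 + 4)"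
    if s1: "s1 w = enc ws \<and> (\<forall>r. r \<noteq> w \<and> r \<noteq> b \<longrightarrow> s1 r = s r)" for ws s1
  proof (rule samples_Seq[OF samples_Toss])
    fix x :: bool and s2 assume s2: "s2 = s1(b := enc x)"
    have "samples (Assign w (NodeE (Reg b) (Reg w))) s2 (return_pmf (x # ws))
      (\<lambda>ws s'. s' w = enc ws \<and> (\<forall>r. r \<noteq> w \<and> r \<noteq> b \<longrightarrow> s' r = s r)) 4"
      by (intro samples_Assign) (use s1 s2 assms in auto)
    then show "samples (Assign w (NodeE (Reg b) (Reg w))) s2 (return_pmf (x # ws))
      (\<lambda>ws s'. s' w = enc ws \<and> (\<forall>r. r \<noteq> w \<and> r \<noteq> b \<longrightarrow> s' r = s r)) 4" by simp
  qed
  from samples_Seq[OF Suc this] show ?case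
    unfolding replicate_pmf_Suc' by (simp add: add_ac)
qed

definition toss_words :: "nat \<Rightarrow> register \<Rightarrow> register \<Rightarrow> register \<Rightarrow> register \<Rightarrow> register \<Rightarrow> com" where
  "toss_words k n r c w b = Seq (Assign r LeafE) (Seq (Assign c (Reg n)) (While (Reg c)
     (Seq (toss_word k w b) (Seq (Assign r (NodeE (Reg w) (Reg r))) (Assign c (RightE (Reg c)))))))"

lemma iterate_replicate_pmf:
  "iterate_pmf n (\<lambda>xs. bind_pmf p (\<lambda>x. return_pmf (x # xs))) xs = map_pmf (\<lambda>ys. ys @ xs) (replicate_pmf n p)"
proof (induction n arbitrary: xs)
  case (Suc n)
  have "iterate_pmf (Suc n) (\<lambda>xs. bind_pmf p (\<lambda>x. return_pmf (x # xs))) xs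
     = bind_pmf p (\<lambda>x. map_pmf (\<lambda>ys. ys @ x # xs) (replicate_pmf n p))"
    by (simp add: bind_assoc_pmf bind_return_pmf Suc)
  also have "\<dots> = map_pmf (\<lambda>ys. ys @ xs) (bind_pmf (replicate_pmf n p) (\<lambda>ys. bind_pmf p (\<lambda>x. return_pmf (ys @ [x]))))"
    by (simp add: map_bind_pmf map_pmf_def bind_commute_pmf[of p] bind_assoc_pmf bind_return_pmf)
  also have "bind_pmf (replicate_pmf n p) (\<lambda>ys. bind_pmf p (\<lambda>x. return_pmf (ys @ [x]))) = replicate_pmf (n + 1) p"
    unfolding replicate_pmf_distrib replicate_pmf_1 by (simp add: map_pmf_def bind_assoc_pmf bind_return_pmf)
  finally show ?case by simp
qed simp

lemma samples_toss_words:
  assumes dist: "distinct [n, r, c, w, b]" and N: "s n = enc (N::nat)"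
  shows "samples (toss_words k n r c w b) s (replicate_pmf N (replicate_pmf k fair))
    (\<lambda>ws s'. s' r = enc ws \<and> (\<forall>x. x \<notin> {r, c, w, b} \<longrightarrow> s' x = s x)) (6 + N * (11 + k * 5))"
proof -
  let ?body = "Seq (toss_word k w b) (Seq (Assign r (NodeE (Reg w) (Reg r))) (Assign c (RightE (Reg c))))"
  define I where "I j ws s' \<longleftrightarrow> s' c = enc (j::nat) \<and> s' r = enc (ws :: bool list list)
    \<and> (\<forall>x. x \<notin> {r, c, w, b} \<longrightarrow> s' x = s x)" for j ws s'
  have body: "samples ?body s0 (bind_pmf (replicate_pmf k fair) (\<lambda>x. return_pmf (x # ws))) (\<lambda>a s'. I j a s') (2 + k * 5 + (4 + 3))"
    if s0: "I (Suc j) ws s0" for j ws s0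
  proof (rule samples_Seq[OF samples_toss_word])
    show "w \<noteq> b" using dist by auto
    fix x :: "bool list" and s1 assume s1: "s1 w = enc x \<and> (\<forall>q. q \<noteq> w \<and> q \<noteq> b \<longrightarrow> s1 q = s0 q)"
    have "samples (Assign r (NodeE (Reg w) (Reg r))) s1 (return_pmf (x # ws))
      (\<lambda>a s'. s' = s1(r := Node (s1 w) (s1 r))) 4"
      by (intro samples_Assign) simp_all
    then have A: "samples (Assign r (NodeE (Reg w) (Reg r))) s1 (return_pmf (x # ws))
      (\<lambda>a s'. s' = s1(r := Node (s1 w) (s1 r))) 4" by simp
    show "samples (Seq (Assign r (NodeE (Reg w) (Reg r))) (Assign c (RightE (Reg c)))) s1 (return_pmf (x # ws))
      (\<lambda>a s'. I j a s') (4 + 3)"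
    proof (rule samples_Seq_det[OF A])
      fix s2 assume s2: "s2 = s1(r := Node (s1 w) (s1 r))"
      have "samples (Assign c (RightE (Reg c))) s2 (return_pmf (x # ws)) (\<lambda>a s'. I j a s') 3"
        by (intro samples_Assign) (use s0 s1 s2 dist in \<open>auto simp: I_def\<close>)
      then show "samples (Assign c (RightE (Reg c))) s2 (return_pmf (x # ws)) (\<lambda>a s'. I j a s') 3" by simp
    qed
  qed
  have A1: "samples (Assign r LeafE) s (return_pmf ()) (\<lambda>_ s'. s' = s(r := Leaf)) 2"
    by (intro samples_Assign) simp_all
  have A2: "samples (Assign c (Reg n)) (s(r := Leaf)) (return_pmf ()) (\<lambda>_ s'. s' = s(r := Leaf, c := enc N)) 2"
    using dist N by (intro samples_Assign) simp_all
  have "samples (While (Reg c) ?body) (s(r := Leaf, c := enc N))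
     (iterate_pmf N (\<lambda>ws. bind_pmf (replicate_pmf k fair) (\<lambda>x. return_pmf (x # ws))) [])
     (\<lambda>a s'. I 0 a s') (2 + N * (2 + k * 5 + (4 + 3) + 2))"
    by (rule samples_While[of I]) (use body dist in \<open>auto simp: I_def\<close>)
  then have W: "samples (While (Reg c) ?body) (s(r := Leaf, c := enc N)) (replicate_pmf N (replicate_pmf k fair))
     (\<lambda>a s'. I 0 a s') (2 + N * (11 + k * 5))"
    unfolding iterate_replicate_pmf by (simp add: add_ac)
  have "samples (toss_words k n r c w b) s (replicate_pmf N (replicate_pmf k fair)) (\<lambda>a s'. I 0 a s') (2 + (2 + (2 + N * (11 + k * 5))))"
    unfolding toss_words_def
    by (rule samples_Seq_det[OF A1], simp only:, rule samples_Seq_det[OF A2], simp only:, rule W)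
  then show ?thesis
    by (rule samples_mono) (auto simp: I_def)
qed

text \<open>The number of rounds has to be a unary loop counter, so it is exponentially large and
  outside the scope of \<open>polytime\<close>. It is built by \<open>L\<close> doublings, in time
  \<open>2 ^ L\<close> up to a polynomial factor, which the search needs anyway.\<close>

definition power_of_two :: "register \<Rightarrow> register \<Rightarrow> register \<Rightarrow> com" where
  "power_of_two l r c = Seq (Assign r (NodeE LeafE LeafE)) (While (Reg l)
     (Seq (Assign c (Reg r)) (Seq (Assign r LeafE) (Seq
       (While (Reg c) (Seq (Assign r (NodeE LeafE (NodeE LeafE (Reg r)))) (Assign c (RightE (Reg c)))))
       (Assign l (RightE (Reg l)))))))"

lemma samples_power_of_two:
  assumes dist: "distinct [l, r, c]" and L: "s l = enc (L::nat)"
  shows "samples (power_of_two l r c) s (return_pmf ())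
    (\<lambda>_ s'. s' r = enc ((2::nat) ^ L) \<and> (\<forall>x. x \<notin> {l, r, c} \<longrightarrow> s' x = s x)) (6 + L * (11 + 2 ^ L * 11))"
proof -
  let ?inner = "Seq (Assign r (NodeE LeafE (NodeE LeafE (Reg r)))) (Assign c (RightE (Reg c)))"
  let ?body = "Seq (Assign c (Reg r)) (Seq (Assign r LeafE) (Seq (While (Reg c) ?inner) (Assign l (RightE (Reg l)))))"
  define I where "I j (v::nat) s' \<longleftrightarrow> j \<le> L \<and> v = 2 ^ (L - j) \<and> s' l = enc (j::nat) \<and> s' r = enc v
    \<and> (\<forall>x. x \<notin> {l, r, c} \<longrightarrow> s' x = s x)" for j v s'
  have body: "samples ?body s0 (return_pmf (2 * v)) (\<lambda>a s'. I j a s') (2 + (2 + ((2 + 2 ^ L * (6 + 3 + 2)) + 3)))"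
    if s0: "I (Suc j) v s0" for j v s0
  proof -
    have v: "v \<le> 2 ^ L" using s0 by (auto simp: I_def intro: power_increasing)
    have v2: "2 * v = 2 ^ (L - j)"
    proof -
      have "L - j = Suc (L - Suc j)" using s0 by (auto simp: I_def)
      then show ?thesis using s0 by (simp add: I_def)
    qed
    define s1 where "s1 = s0(c := s0 r)"
    define s2 where "s2 = s1(r := Leaf)"
    define I2 where "I2 j u s' \<longleftrightarrow> s' c = enc (j::nat) \<and> s' r = enc (u::nat) \<and> (\<forall>x. x \<notin> {r, c} \<longrightarrow> s' x = s0 x)" for j u s'
    have A1: "samples (Assign c (Reg r)) s0 (return_pmf ()) (\<lambda>_ s'. s' = s1) 2"
      by (intro samples_Assign) (simp_all add: s1_def)
    have A2: "samples (Assign r LeafE) s1 (return_pmf ()) (\<lambda>_ s'. s' = s2) 2"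
      by (intro samples_Assign) (simp_all add: s2_def)
    have inner: "samples ?inner t0 (return_pmf (Suc (Suc u))) (\<lambda>a s'. I2 i a s') (6 + 3)"
      if t0: "I2 (Suc i) u t0" for i u t0
    proof (rule samples_Seq_det)
      show "samples (Assign r (NodeE LeafE (NodeE LeafE (Reg r)))) t0 (return_pmf ()) (\<lambda>_ s'. s' = t0(r := Node Leaf (Node Leaf (t0 r)))) 6"
        by (intro samples_Assign) simp_all
      fix t1 assume "t1 = t0(r := Node Leaf (Node Leaf (t0 r)))"
      then show "samples (Assign c (RightE (Reg c))) t1 (return_pmf (Suc (Suc u))) (\<lambda>a s'. I2 i a s') 3"
        using t0 dist by (intro samples_Assign) (auto simp: I2_def)
    qed
    have "samples (While (Reg c) ?inner) s2 (iterate_pmf v (\<lambda>u. return_pmf (Suc (Suc u))) 0) (\<lambda>a s'. I2 0 a s') (2 + v * (6 + 3 + 2))"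
      by (rule samples_While[of I2]) (use inner s0 dist in \<open>auto simp: I2_def I_def s2_def s1_def\<close>)
    moreover have "((\<lambda>u. Suc (Suc u)) ^^ v) 0 = 2 * v" by (induction v) auto
    ultimately have "samples (While (Reg c) ?inner) s2 (return_pmf (2 * v)) (\<lambda>a s'. I2 0 a s') (2 + v * (6 + 3 + 2))"
      by (simp add: iterate_pmf_return)
    then have W: "samples (While (Reg c) ?inner) s2 (return_pmf (2 * v)) (\<lambda>a s'. I2 0 a s') (2 + 2 ^ L * (6 + 3 + 2))"
      by (rule samples_mono) (use v in auto)
    show ?thesis
    proof (rule samples_Seq_det[OF A1], simp only:, rule samples_Seq_det[OF A2], simp only:, rule samples_Seq_det[OF W])
      fix s3 assume "I2 0 (2 * v) s3"
      then show "samples (Assign l (RightE (Reg l))) s3 (return_pmf (2 * v)) (\<lambda>a s'. I j a s') 3"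
        using s0 dist v2 by (intro samples_Assign) (auto simp: I2_def I_def)
    qed
  qed
  have A1: "samples (Assign r (NodeE LeafE LeafE)) s (return_pmf ()) (\<lambda>_ s'. s' = s(r := Node Leaf Leaf)) 4"
    by (intro samples_Assign) simp_all
  have "samples (While (Reg l) ?body) (s(r := Node Leaf Leaf)) (iterate_pmf L (\<lambda>v. return_pmf (2 * v)) 1)
     (\<lambda>a s'. I 0 a s') (2 + L * ((2 + (2 + ((2 + 2 ^ L * (6 + 3 + 2)) + 3))) + 2))"
    by (rule samples_While[of I]) (use body dist L in \<open>auto simp: I_def\<close>)
  moreover have "((\<lambda>v. 2 * v) ^^ L) (1::nat) = 2 ^ L" by (induction L) auto
  ultimately have W: "samples (While (Reg l) ?body) (s(r := Node Leaf Leaf)) (return_pmf (2 ^ L))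
     (\<lambda>a s'. I 0 a s') (2 + L * (11 + 2 ^ L * 11))"
    by (simp add: iterate_pmf_return add_ac)
  have W': "samples (While (Reg l) ?body) (s(r := Node Leaf Leaf)) (return_pmf ())
     (\<lambda>_ s'. I 0 (2 ^ L) s') (2 + L * (11 + 2 ^ L * 11))"
  proof -
    obtain \<nu> where \<nu>: "exec (While (Reg l) ?body) (s(r := Node Leaf Leaf)) = spmf_of_pmf \<nu>"
       "rel_pmf (\<lambda>a (s', t). I 0 a s' \<and> t \<le> 2 + L * (11 + 2 ^ L * 11)) (return_pmf (2 ^ L)) \<nu>"
      using W by (auto simp: samples_def)
    have "rel_pmf (\<lambda>_ (s', t). I 0 (2 ^ L) s' \<and> t \<le> 2 + L * (11 + 2 ^ L * 11)) (map_pmf (\<lambda>_. ()) (return_pmf ((2::nat) ^ L))) \<nu>"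
      unfolding pmf.rel_map by (rule pmf.rel_mono_strong[OF \<nu>(2)]) auto
    then show ?thesis using \<nu>(1) by (auto simp: samples_def)
  qed
  have "samples (power_of_two l r c) s (return_pmf ()) (\<lambda>_ s'. I 0 (2 ^ L) s') (4 + (2 + L * (11 + 2 ^ L * 11)))"
    unfolding power_of_two_def by (rule samples_Seq_det[OF A1], simp only:, rule W')
  then show ?thesis by (rule samples_mono) (auto simp: I_def)
qed

text \<open>Recovers the lengths of the drawn words, on which the time bound for the deterministic
  part relies.\<close>

lemma samples_support:
  assumes "samples P s \<mu> \<Phi> T"
  shows "samples P s \<mu> (\<lambda>a s'. \<Phi> a s' \<and> a \<in> set_pmf \<mu>) T"
proof -
  obtain \<nu> where \<nu>: "exec P s = spmf_of_pmf \<nu>" "rel_pmf (\<lambda>a (s', t). \<Phi> a s' \<and> t \<le> T) \<mu> \<nu>"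
    using assms by (auto simp: samples_def)
  have "rel_pmf (\<lambda>a (s', t). (\<Phi> a s' \<and> a \<in> set_pmf \<mu>) \<and> t \<le> T) \<mu> \<nu>"
    by (rule pmf.rel_mono_strong[OF \<nu>(2)]) auto
  then show ?thesis using \<nu>(1) by (auto simp: samples_def)
qed

lemma samples_computes:
  assumes "computes P m u f" "s 0 = enc x" "u x \<le> T"
  shows "samples P s (return_pmf a) (\<lambda>_ s'. s' 0 = enc (f x) \<and> (\<forall>r\<ge>m. s' r = s r)) T"
proof -
  obtain s' t where "runs P s s' t" "s' 0 = enc (f x)" "\<And>r. r \<ge> m \<Longrightarrow> s' r = s r" "t \<le> u x"
    using computesE[where s = s and x = x, OF assms(1,2)] by metis
  then show ?thesis using assms(3) by (intro samples_runs[of P s s' t]) auto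
qed

definition random_words :: "nat \<Rightarrow> nat \<Rightarrow> bool list list pmf" where
  "random_words k n = replicate_pmf n (replicate_pmf k fair)"

lemma random_words: "random_words k n = pmf_of_set (word_lists k n)"
proof -
  have 1: "replicate_pmf k fair = pmf_of_set {w. length w = k}"
    unfolding fair_def by (subst replicate_pmf_of_set) auto
  have "finite {w :: bool list. length w = k}" "{w :: bool list. length w = k} \<noteq> {}"
    using finite_words[of k "\<lambda>_. True"] length_replicate[of k True] by (simp, blast)
  then have "random_words k n = pmf_of_set {xs. set xs \<subseteq> {w. length w = k} \<and> length xs = n}"
    unfolding random_words_def 1 by (rule replicate_pmf_of_set)
  also have "{xs. set xs \<subseteq> {w. length w = k} \<and> length xs = n} = word_lists k n"
    by (auto simp: word_lists_def in_set_conv_nth subset_iff)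
  finally show ?thesis .
qed

lemma word_lists_nonempty: "word_lists k n \<noteq> {}"
  using card_word_lists[of k n] by auto

lemma set_random_words: "set_pmf (random_words k n) = word_lists k n"
  unfolding random_words by (rule set_pmf_of_set[OF word_lists_nonempty finite_word_lists])

section \<open>The search program: rounds and their repetition\<close>

definition round_pmf :: "nat \<Rightarrow> nat \<Rightarrow> nat \<Rightarrow> nat \<Rightarrow> (nat \<times> bool) list list \<Rightarrow> bool list \<Rightarrow> bool list pmf" where
  "round_pmf a J K D cls out = bind_pmf (random_words K (num_vars cls)) (\<lambda>ts.
     bind_pmf (random_words (Suc J) (num_vars cls)) (\<lambda>gs. return_pmf (attempt a J K D cls ts gs out)))"

text \<open>Registers: \<open>M\<close> the clauses, \<open>M + 1\<close> the number of variables,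
  \<open>M + 2\<close> the remaining rounds, \<open>M + 4\<close> the times, \<open>M + 5\<close>
  the guess words, \<open>M + 6\<close> the output so far, \<open>M + 7\<close> to
  \<open>M + 9\<close> scratch. The deterministic program \<open>P\<close> is meant to change
  registers below \<open>M\<close> only.\<close>

definition round_com :: "nat \<Rightarrow> nat \<Rightarrow> com \<Rightarrow> register \<Rightarrow> com" where
  "round_com J K P M = Seq (toss_words K (M + 1) (M + 4) (M + 9) (M + 7) (M + 8))
     (Seq (toss_words (Suc J) (M + 1) (M + 5) (M + 9) (M + 7) (M + 8))
     (Seq (Assign 0 (NodeE (Reg M) (NodeE (Reg (M + 4)) (NodeE (Reg (M + 5)) (Reg (M + 6))))))
     (Seq P (Seq (Assign (M + 6) (Reg 0)) (Assign (M + 2) (RightE (Reg (M + 2))))))))"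

definition search_com :: "nat \<Rightarrow> nat \<Rightarrow> com \<Rightarrow> com \<Rightarrow> com \<Rightarrow> register \<Rightarrow> com" where
  "search_com J K PN PL P M = Seq (Assign M (Reg 0)) (Seq PN (Seq (Assign (M + 1) (Reg 0)) (Seq PL
     (Seq (power_of_two 0 (M + 2) (M + 3)) (Seq (Assign (M + 6) LeafE)
     (Seq (While (Reg (M + 2)) (round_com J K P M)) (Assign 0 (Reg (M + 6)))))))))"

definition round_input :: "(nat \<times> bool) list list \<Rightarrow> bool list list \<Rightarrow> bool list list \<Rightarrow> bool list
    \<Rightarrow> (nat \<times> bool) list list \<times> bool list list \<times> bool list list \<times> bool list" where
  "round_input cls ts gs out = (cls, ts, gs, out)"

lemma length_attempt:
  "length out \<le> num_vars cls \<Longrightarrow> length (attempt a J K D cls ts gs out) \<le> num_vars cls"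
  by (simp add: attempt_def characteristic_def)

definition round_inv :: "register \<Rightarrow> (nat \<times> bool) list list \<Rightarrow> nat \<Rightarrow> bool list \<Rightarrow> state \<Rightarrow> bool" where
  "round_inv M cls j out s \<longleftrightarrow> s (M + 2) = enc j \<and> s M = enc cls \<and> s (M + 1) = enc (num_vars cls)
     \<and> s (M + 6) = enc out \<and> length out \<le> num_vars cls"

lemma samples_round:
  assumes P: "computes P m u (\<lambda>p. attempt a J K D (fst p) (fst (snd p)) (fst (snd (snd p))) (snd (snd (snd p))))"
    and M: "0 < M" "m \<le> M"
    and inv: "round_inv M cls (Suc j) out s"
    and B: "\<And>ts gs. ts \<in> word_lists K (num_vars cls) \<Longrightarrow> gs \<in> word_lists (Suc J) (num_vars cls) \<Longrightarrow>
      u (round_input cls ts gs out) \<le> B"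
  shows "samples (round_com J K P M) s (round_pmf a J K D cls out) (\<lambda>out s'. round_inv M cls j out s')
    ((6 + num_vars cls * (11 + K * 5)) + ((6 + num_vars cls * (11 + Suc J * 5)) + (8 + (B + (2 + 3)))))"
  unfolding round_com_def round_pmf_def
proof (rule samples_Seq[OF samples_support])
  let ?n = "num_vars cls"
  show "samples (toss_words K (M + 1) (M + 4) (M + 9) (M + 7) (M + 8)) s (random_words K ?n)
    (\<lambda>ts s'. s' (M + 4) = enc ts \<and> (\<forall>x. x \<notin> {M + 4, M + 9, M + 7, M + 8} \<longrightarrow> s' x = s x)) (6 + ?n * (11 + K * 5))"
    unfolding random_words_def by (rule samples_toss_words) (use inv in \<open>auto simp: round_inv_def\<close>)
  fix ts s1
  assume s1: "(s1 (M + 4) = enc ts \<and> (\<forall>x. x \<notin> {M + 4, M + 9, M + 7, M + 8} \<longrightarrow> s1 x = s x)) \<and> ts \<in> set_pmf (random_words K ?n)"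
  show "samples (Seq (toss_words (Suc J) (M + 1) (M + 5) (M + 9) (M + 7) (M + 8))
     (Seq (Assign 0 (NodeE (Reg M) (NodeE (Reg (M + 4)) (NodeE (Reg (M + 5)) (Reg (M + 6))))))
     (Seq P (Seq (Assign (M + 6) (Reg 0)) (Assign (M + 2) (RightE (Reg (M + 2)))))))) s1
     (bind_pmf (random_words (Suc J) ?n) (\<lambda>gs. return_pmf (attempt a J K D cls ts gs out)))
     (\<lambda>out s'. round_inv M cls j out s') ((6 + ?n * (11 + Suc J * 5)) + (8 + (B + (2 + 3))))"
  proof (rule samples_Seq[OF samples_support])
    show "samples (toss_words (Suc J) (M + 1) (M + 5) (M + 9) (M + 7) (M + 8)) s1 (random_words (Suc J) ?n)
      (\<lambda>gs s'. s' (M + 5) = enc gs \<and> (\<forall>x. x \<notin> {M + 5, M + 9, M + 7, M + 8} \<longrightarrow> s' x = s1 x)) (6 + ?n * (11 + Suc J * 5))"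
      unfolding random_words_def by (rule samples_toss_words) (use inv s1 in \<open>auto simp: round_inv_def\<close>)
    fix gs s2
    assume s2: "(s2 (M + 5) = enc gs \<and> (\<forall>x. x \<notin> {M + 5, M + 9, M + 7, M + 8} \<longrightarrow> s2 x = s1 x)) \<and> gs \<in> set_pmf (random_words (Suc J) ?n)"
    define s3 where "s3 = s2(0 := Node (s2 M) (Node (s2 (M + 4)) (Node (s2 (M + 5)) (s2 (M + 6)))))"
    have s3_0: "s3 0 = enc (round_input cls ts gs out)"
      using inv s1 s2 by (simp add: s3_def round_inv_def round_input_def)
    let ?out = "attempt a J K D cls ts gs out"
    have A: "samples (Assign 0 (NodeE (Reg M) (NodeE (Reg (M + 4)) (NodeE (Reg (M + 5)) (Reg (M + 6)))))) s2
       (return_pmf ()) (\<lambda>_ s'. s' = s3) 8"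
      by (rule samples_Assign) (auto simp: s3_def)
    have "u (round_input cls ts gs out) \<le> B"
      using B s1 s2 by (simp add: set_random_words)
    then have PP: "samples P s3 (return_pmf ()) (\<lambda>_ s'. s' 0 = enc ?out \<and> (\<forall>r\<ge>m. s' r = s3 r)) B"
      using samples_computes[where x = "round_input cls ts gs out" and s = s3, OF P s3_0] by (simp add: round_input_def)
    show "samples (Seq (Assign 0 (NodeE (Reg M) (NodeE (Reg (M + 4)) (NodeE (Reg (M + 5)) (Reg (M + 6))))))
     (Seq P (Seq (Assign (M + 6) (Reg 0)) (Assign (M + 2) (RightE (Reg (M + 2))))))) s2
     (return_pmf ?out) (\<lambda>out s'. round_inv M cls j out s') (8 + (B + (2 + 3)))"
    proof (rule samples_Seq_det[OF A], simp only:, rule samples_Seq_det[OF PP])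
      fix s4 assume s4: "s4 0 = enc ?out \<and> (\<forall>r\<ge>m. s4 r = s3 r)"
      have A2: "samples (Assign (M + 6) (Reg 0)) s4 (return_pmf ()) (\<lambda>_ s'. s' = s4(M + 6 := s4 0)) 2"
        by (rule samples_Assign) auto
      show "samples (Seq (Assign (M + 6) (Reg 0)) (Assign (M + 2) (RightE (Reg (M + 2))))) s4
        (return_pmf ?out) (\<lambda>out s'. round_inv M cls j out s') (2 + 3)"
      proof (rule samples_Seq_det[OF A2], simp only:, rule samples_Assign)
        have "s4 M = enc cls" "s4 (M + 1) = enc (num_vars cls)" "s4 (M + 2) = enc (Suc j)"
          using s4 s1 s2 inv M by (auto simp: s3_def round_inv_def)
        then show "round_inv M cls j ?out ((s4(M + 6 := s4 0))(M + 2 := eval_exp (RightE (Reg (M + 2))) (s4(M + 6 := s4 0))))"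
          using s4 inv length_attempt by (simp add: round_inv_def)
      qed simp
    qed
  qed
qed

lemma samples_search:
  assumes PN: "computes PN mN uN num_vars" and PL: "computes PL mL uL Lf"
    and P: "computes P m u (\<lambda>p. attempt a J K D (fst p) (fst (snd p)) (fst (snd (snd p))) (snd (snd (snd p))))"
    and M: "0 < M" "m \<le> M" "mN \<le> M" "mL \<le> M"
    and B: "\<And>ts gs out. ts \<in> word_lists K (num_vars cls) \<Longrightarrow> gs \<in> word_lists (Suc J) (num_vars cls) \<Longrightarrow>
      length out \<le> num_vars cls \<Longrightarrow> u (round_input cls ts gs out) \<le> B"
    and T: "T = (6 + num_vars cls * (11 + K * 5)) + ((6 + num_vars cls * (11 + Suc J * 5)) + (8 + (B + (2 + 3))))"
    and L: "L = Lf (num_vars cls)"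
  shows "samples (search_com J K PN PL P M) ((\<lambda>_. Leaf)(0 := enc cls))
    (iterate_pmf (2 ^ L) (round_pmf a J K D cls) []) (\<lambda>out s'. s' 0 = enc out)
    (2 + (uN cls + (2 + (uL (num_vars cls) + ((6 + L * (11 + 2 ^ L * 11)) + (2 + ((2 + 2 ^ L * (T + 2)) + 2)))))))"
proof -
  let ?n = "num_vars cls"
  define s0 :: state where "s0 = (\<lambda>_. Leaf)(0 := enc cls)"
  define s1 where "s1 = s0(M := enc cls)"
  have A1: "samples (Assign M (Reg 0)) s0 (return_pmf ()) (\<lambda>_ s'. s' = s1) 2"
    by (rule samples_Assign) (auto simp: s1_def s0_def)
  have A2: "samples PN s1 (return_pmf ()) (\<lambda>_ s'. s' 0 = enc ?n \<and> (\<forall>r\<ge>mN. s' r = s1 r)) (uN cls)"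
    by (rule samples_computes[OF PN]) (use M in \<open>auto simp: s1_def s0_def\<close>)
  have "samples (search_com J K PN PL P M) s0
    (iterate_pmf (2 ^ L) (round_pmf a J K D cls) []) (\<lambda>out s'. s' 0 = enc out)
    (2 + (uN cls + (2 + (uL ?n + ((6 + L * (11 + 2 ^ L * 11)) + (2 + ((2 + 2 ^ L * (T + 2)) + 2)))))))"
    unfolding search_com_def
  proof (rule samples_Seq_det[OF A1], simp only:, rule samples_Seq_det[OF A2])
    fix s2 assume s2: "s2 0 = enc ?n \<and> (\<forall>r\<ge>mN. s2 r = s1 r)"
    define s3 where "s3 = s2(M + 1 := enc ?n)"
    have A3: "samples (Assign (M + 1) (Reg 0)) s2 (return_pmf ()) (\<lambda>_ s'. s' = s3) 2"
      by (rule samples_Assign) (use s2 in \<open>auto simp: s3_def\<close>)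
    have A4: "samples PL s3 (return_pmf ()) (\<lambda>_ s'. s' 0 = enc L \<and> (\<forall>r\<ge>mL. s' r = s3 r)) (uL ?n)"
      unfolding L by (rule samples_computes[OF PL]) (use s2 in \<open>auto simp: s3_def\<close>)
    show "samples (Seq (Assign (M + 1) (Reg 0)) (Seq PL
     (Seq (power_of_two 0 (M + 2) (M + 3)) (Seq (Assign (M + 6) LeafE)
     (Seq (While (Reg (M + 2)) (round_com J K P M)) (Assign 0 (Reg (M + 6)))))))) s2
     (iterate_pmf (2 ^ L) (round_pmf a J K D cls) []) (\<lambda>out s'. s' 0 = enc out)
     (2 + (uL ?n + ((6 + L * (11 + 2 ^ L * 11)) + (2 + ((2 + 2 ^ L * (T + 2)) + 2)))))"
    proof (rule samples_Seq_det[OF A3], simp only:, rule samples_Seq_det[OF A4])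
      fix s4 assume s4: "s4 0 = enc L \<and> (\<forall>r\<ge>mL. s4 r = s3 r)"
      have A5: "samples (power_of_two 0 (M + 2) (M + 3)) s4 (return_pmf ())
        (\<lambda>_ s'. s' (M + 2) = enc ((2::nat) ^ L) \<and> (\<forall>x. x \<notin> {0, M + 2, M + 3} \<longrightarrow> s' x = s4 x)) (6 + L * (11 + 2 ^ L * 11))"
        by (rule samples_power_of_two) (use s4 in auto)
      show "samples (Seq (power_of_two 0 (M + 2) (M + 3)) (Seq (Assign (M + 6) LeafE)
       (Seq (While (Reg (M + 2)) (round_com J K P M)) (Assign 0 (Reg (M + 6)))))) s4
       (iterate_pmf (2 ^ L) (round_pmf a J K D cls) []) (\<lambda>out s'. s' 0 = enc out)
       ((6 + L * (11 + 2 ^ L * 11)) + (2 + ((2 + 2 ^ L * (T + 2)) + 2)))"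
      proof (rule samples_Seq_det[OF A5])
        fix s5 assume s5: "s5 (M + 2) = enc ((2::nat) ^ L) \<and> (\<forall>x. x \<notin> {0, M + 2, M + 3} \<longrightarrow> s5 x = s4 x)"
        define s6 where "s6 = s5(M + 6 := Leaf)"
        have A6: "samples (Assign (M + 6) LeafE) s5 (return_pmf ()) (\<lambda>_ s'. s' = s6) 2"
          by (rule samples_Assign) (auto simp: s6_def)
        have "s5 M = enc cls" "s5 (M + 1) = enc ?n"
          using s5 s4 s2 M by (auto simp: s3_def s1_def)
        then have inv: "round_inv M cls (2 ^ L) [] s6"
          using s5 by (simp add: round_inv_def s6_def)
        have W: "samples (While (Reg (M + 2)) (round_com J K P M)) s6 (iterate_pmf (2 ^ L) (round_pmf a J K D cls) [])
          (\<lambda>out s'. round_inv M cls 0 out s') (2 + 2 ^ L * (T + 2))"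
        proof (rule samples_While[of "round_inv M cls", OF _ _ inv])
          show "s (M + 2) = enc j" if "round_inv M cls j out s" for j out s
            using that by (simp add: round_inv_def)
          show "samples (round_com J K P M) s (round_pmf a J K D cls out) (\<lambda>out s'. round_inv M cls j out s') T"
            if "round_inv M cls (Suc j) out s" for j out s
            unfolding T by (rule samples_round[OF P M(1,2) that]) (use B that in \<open>auto simp: round_inv_def\<close>)
        qed
        have "samples (Seq (While (Reg (M + 2)) (round_com J K P M)) (Assign 0 (Reg (M + 6)))) s6
          (bind_pmf (iterate_pmf (2 ^ L) (round_pmf a J K D cls) []) return_pmf) (\<lambda>out s'. s' 0 = enc out) ((2 + 2 ^ L * (T + 2)) + 2)"
        proof (rule samples_Seq[OF W])
          fix out s7 assume "round_inv M cls 0 out s7"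
          then show "samples (Assign 0 (Reg (M + 6))) s7 (return_pmf out) (\<lambda>out s'. s' 0 = enc out) 2"
            by (intro samples_Assign) (auto simp: round_inv_def)
        qed
        then have "samples (Seq (While (Reg (M + 2)) (round_com J K P M)) (Assign 0 (Reg (M + 6)))) s6
          (iterate_pmf (2 ^ L) (round_pmf a J K D cls) []) (\<lambda>out s'. s' 0 = enc out) ((2 + 2 ^ L * (T + 2)) + 2)"
          by (simp only: bind_return_pmf')
        then show "samples (Seq (Assign (M + 6) LeafE)
         (Seq (While (Reg (M + 2)) (round_com J K P M)) (Assign 0 (Reg (M + 6))))) s5
         (iterate_pmf (2 ^ L) (round_pmf a J K D cls) []) (\<lambda>out s'. s' 0 = enc out) (2 + ((2 + 2 ^ L * (T + 2)) + 2))"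
          by (intro samples_Seq_det[OF A6]) (simp only:)
      qed
    qed
  qed
  then show ?thesis by (simp only: s0_def)
qed

text \<open>Once reached, \<open>x\<close> is kept, so every round multiplies the bound on the
  probability of not having reached it by 1 - \<sigma>.\<close>

lemma iterate_pmf_ge:
  assumes \<sigma>: "\<And>out. \<sigma> \<le> pmf (f out) x" and stay: "f x = return_pmf x" and "0 \<le> \<sigma>" "\<sigma> \<le> 1"
  shows "1 - (1 - \<sigma>) ^ k \<le> pmf (iterate_pmf k f out) x"
proof (induction k arbitrary: out)
  case (Suc k)
  let ?c = "1 - (1 - \<sigma>) ^ k"
  have stay_k: "iterate_pmf k f x = return_pmf x"
    by (induction k) (simp_all add: stay bind_return_pmf)
  have c: "0 \<le> ?c" "?c \<le> 1" using assms(3,4) by (auto simp: power_le_one)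
  have ge: "?c + (1 - ?c) * indicator {x} y \<le> pmf (iterate_pmf k f y) x" for y
    using Suc[of y] stay_k by (cases "y = x") (auto simp: indicator_def)
  have int: "integrable (measure_pmf (f out)) (\<lambda>y. pmf (iterate_pmf k f y) x)"
    by (rule measure_pmf.integrable_const_bound[where B = 1]) (auto simp: pmf_le_1)
  have ind: "integrable (measure_pmf (f out)) (\<lambda>y. (1 - ?c) * indicator {x} y)"
    using c by (intro measure_pmf.integrable_const_bound[where B = 1]) (auto simp: indicator_def)
  have "?c + (1 - ?c) * pmf (f out) x = measure_pmf.expectation (f out) (\<lambda>y. ?c + (1 - ?c) * indicator {x} y)"
    by (subst Bochner_Integration.integral_add[OF _ ind]) (simp_all add: measure_pmf_single)
  also have "\<dots> \<le> measure_pmf.expectation (f out) (\<lambda>y. pmf (iterate_pmf k f y) x)"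
    by (rule integral_mono[OF Bochner_Integration.integrable_add[OF _ ind] int ge]) auto
  also have "\<dots> = pmf (iterate_pmf (Suc k) f out) x"
    by (simp add: pmf_bind)
  finally have "?c + (1 - ?c) * pmf (f out) x \<le> pmf (iterate_pmf (Suc k) f out) x" .
  moreover have "(1 - ?c) * \<sigma> \<le> (1 - ?c) * pmf (f out) x"
    using c \<sigma>[of out] by (intro mult_left_mono) auto
  ultimately show ?case by (simp add: algebra_simps)
qed simp

text \<open>After 1 / \<sigma> rounds the failure probability is at most 1 / e \<le> 1 / 2.\<close>

lemma iterate_pmf_half:
  assumes "\<And>out. \<sigma> \<le> pmf (f out) x" and "f x = return_pmf x" and "0 \<le> \<sigma>" "\<sigma> \<le> 1" "1 \<le> \<sigma> * real k"
  shows "1 / 2 \<le> pmf (iterate_pmf k f out) x"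
proof -
  have "(1 - \<sigma>) ^ k \<le> exp (- \<sigma>) ^ k"
    using assms(4) exp_ge_add_one_self[of "- \<sigma>"] by (intro power_mono) auto
  also have "\<dots> = exp (- (\<sigma> * real k))"
    by (simp add: exp_of_nat_mult[symmetric] mult.commute)
  also have "\<dots> \<le> exp (- 1)" using assms(5) by simp
  also have "\<dots> \<le> 1 / 2"
    using exp_ge_add_one_self[of "1::real"] by (simp add: exp_minus field_simps)
  finally show ?thesis using iterate_pmf_ge[where \<sigma> = \<sigma> and f = f and x = x, OF assms(1-4), of k out] by simp
qed

context one_critical_cnf
begin

lemma round_pmf_eq: "round_pmf a J K D cls out = map_pmf (\<lambda>(ts, gs). attempt a J K D cls ts gs out)
    (pmf_of_set (word_lists K n \<times> word_lists (Suc J) n))"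
  unfolding round_pmf_def num_vars_eq random_words
  by (simp add: pair_pmf_of_set[symmetric] finite_word_lists word_lists_nonempty pair_pmf_def map_bind_pmf)

lemma round_pmf_stay: "round_pmf a J K D cls (map \<alpha> [0..<n]) = return_pmf (map \<alpha> [0..<n])"
proof -
  have "attempt a J K D cls ts gs (map \<alpha> [0..<n]) = map \<alpha> [0..<n]" for ts gs
    using attempt_cases[of a J K D ts gs "map \<alpha> [0..<n]"] by simp
  then show ?thesis by (simp add: round_pmf_eq case_prod_beta')
qed

lemma round_pmf_success:
  "real (card (successes J D)) / real (card (word_lists K n \<times> word_lists (Suc J) n))
    \<le> pmf (round_pmf a J K D cls out) (map \<alpha> [0..<n])"
proof -
  let ?A = "word_lists K n \<times> word_lists (Suc J) n"
  have A: "finite ?A" "?A \<noteq> {}" by (simp_all add: finite_word_lists word_lists_nonempty)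
  have "real (card (successes J D)) / real (card ?A) = measure_pmf.prob (pmf_of_set ?A) (successes J D)"
    using A by (subst measure_pmf_of_set) (auto simp: successes_def intro!: arg_cong[of _ _ card])
  also have "\<dots> \<le> measure_pmf.prob (pmf_of_set ?A) ((\<lambda>(ts, gs). attempt a J K D cls ts gs out) -` {map \<alpha> [0..<n]})"
    by (rule measure_pmf.finite_measure_mono) (auto simp: successes_def)
  also have "\<dots> = pmf (round_pmf a J K D cls out) (map \<alpha> [0..<n])"
    by (simp add: round_pmf_eq pmf_map)
  finally show ?thesis .
qed

end

section \<open>Running time\<close>

text \<open>There are (2n)^i lists of i literals; together with the limit of three literals per
  clause this bounds the input size polynomially in n, so that time bounds in the input size become
  bounds in n.\<close>

definition cls_bound :: "nat \<Rightarrow> nat" where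
  "cls_bound n = 1 + (\<Sum>i\<le>3. (2 * n) ^ i) * (1 + 3 * (n + 2))"

lemma (in unique_cnf) esz_cls: "esz cls \<le> cls_bound n"
proof -
  let ?A = "{..<n} \<times> (UNIV :: bool set)"
  have "set cls \<subseteq> {xs. set xs \<subseteq> ?A \<and> length xs \<le> 3}"
    using vars_less le3 by fastforce
  then have "card (set cls) \<le> card {xs. set xs \<subseteq> ?A \<and> length xs \<le> 3}"
    by (intro card_mono finite_lists_length_le) auto
  also have "\<dots> = (\<Sum>i\<le>3. (2 * n) ^ i)"
    by (subst card_lists_length_le) (auto simp: card_cartesian_product mult.commute)
  finally have len: "length cls \<le> (\<Sum>i\<le>3. (2 * n) ^ i)"
    using distinct_card[OF distinct_cls] by simp
  have "esz c \<le> 1 + 3 * (n + 2)" if c: "c \<in> set cls" for c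
  proof -
    have "esz l \<le> n + 2" if "l \<in> set c" for l
      using vars_less[OF c that] esz_bool[of "snd l"] by (cases l) auto
    then have "esz c \<le> 1 + length c * (n + 2)" by (rule esz_list_le)
    also have "length c * (n + 2) \<le> 3 * (n + 2)" using le3[OF c] by (rule mult_le_mono1)
    finally show ?thesis by simp
  qed
  then have "esz cls \<le> 1 + length cls * (1 + 3 * (n + 2))" by (rule esz_list_le)
  also have "length cls * (1 + 3 * (n + 2)) \<le> (\<Sum>i\<le>3. (2 * n) ^ i) * (1 + 3 * (n + 2))"
    using len by (rule mult_le_mono1)
  finally show ?thesis by (simp add: cls_bound_def)
qed

lemma esz_bools: "esz (w :: bool list) \<le> 1 + length w * 2"
  by (rule esz_list_le) (rule esz_bool)

lemma esz_word_lists: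
  assumes "ts \<in> word_lists k n"
  shows "esz ts \<le> 1 + n * (1 + k * 2)"
proof -
  have "esz w \<le> 1 + k * 2" if "w \<in> set ts" for w
    using that assms esz_bools[of w] by (auto simp: word_lists_def in_set_conv_nth)
  then have "esz ts \<le> 1 + length ts * (1 + k * 2)" by (rule esz_list_le)
  then show ?thesis using assms by (simp add: word_lists_def)
qed

definition round_bound :: "nat \<Rightarrow> nat \<Rightarrow> nat \<Rightarrow> nat" where
  "round_bound J K n = cls_bound n + (1 + n * (1 + K * 2)) + (1 + n * (1 + Suc J * 2)) + (1 + n * 2)"

lemma polybounded_nat: "polybounded (\<lambda>n::nat. n)"
  by (rule polybounded_mono[OF polybounded_esz]) simp

lemma polybounded_cls_bound: "polybounded cls_bound"
proof -
  have "(\<Sum>i\<le>3. (2 * n) ^ i) = 1 + 2 * n + (2 * n) ^ 2 + (2 * n) ^ 3" for n :: nat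
    by (simp add: eval_nat_numeral)
  then have "cls_bound = (\<lambda>n. 1 + (1 + 2 * n + (2 * n) ^ 2 + (2 * n) ^ 3) * (1 + 3 * (n + 2)))"
    by (auto simp: cls_bound_def)
  moreover have "polybounded \<dots>"
    by (intro polybounded_add polybounded_mult polybounded_power polybounded_nat polybounded_const)
  ultimately show ?thesis by metis
qed

lemma polybounded_round_bound: "polybounded (round_bound J K)"
  unfolding round_bound_def
  by (intro polybounded_add polybounded_mult polybounded_nat polybounded_const polybounded_cls_bound)

lemma eventually_poly_overhead:
  fixes A B \<rho> base :: real
  assumes "\<rho> < base"
  shows "eventually (\<lambda>n. (A + B * log 2 (real n + 1)) / real n + \<rho> < base) at_top"
proof -
  have "((\<lambda>n. (A + B * log 2 (real n + 1)) / real n) \<longlongrightarrow> 0) at_top"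
    by real_asymp
  then have "((\<lambda>n. (A + B * log 2 (real n + 1)) / real n + \<rho>) \<longlongrightarrow> 0 + \<rho>) at_top"
    by (intro tendsto_intros)
  then show ?thesis using assms by (intro order_tendstoD(2)) auto
qed

text \<open>Renames the variables by their positions in \<open>vs\<close>, so that the analysis
  depends neither on the variables nor on the order in which clauses and literals are
  listed.\<close>

lemma positional_instance:
  assumes F: "one_critical_unique_le3_cnf F" and n: "n = card (vars F)" and cls: "lists_cnf vs cls F"
    and a: "0 < a" "2 * a \<le> K"
  shows "one_critical_cnf cls n (\<lambda>i. the (the_assignment F (vs ! i))) K a" "length vs = n"
proof -
  let ?\<phi> = "\<lambda>(i, b). (vs ! i, b)" and ?\<alpha> = "\<lambda>i. the (the_assignment F (vs ! i))"
  have vs: "distinct vs" "set vs = vars F"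
    and lit: "\<And>c. c \<in> set cls \<Longrightarrow> distinct c" "\<And>c l. c \<in> set cls \<Longrightarrow> l \<in> set c \<Longrightarrow> fst l < length vs"
    and dist: "distinct (map set cls)" and F_eq: "F = (\<lambda>c. ?\<phi> ` set c) ` set cls"
    using cls by (auto simp: lists_cnf_def)
  show len: "length vs = n" using n vs distinct_card[of vs] by simp
  have nth_vars: "vs ! i \<in> vars F" if "i < n" for i
    using nth_mem[of i vs] that unfolding vs(2) len by blast
  have inj_vs: "vs ! i = vs ! j \<longleftrightarrow> i = j" if "i < n" "j < n" for i j
    using that vs(1) len by (simp add: nth_eq_iff_index_eq)
  have inj_\<phi>: "inj_on ?\<phi> {l. fst l < n}"
    using inj_vs by (auto simp: inj_on_def)
  have lits: "set c \<subseteq> {l. fst l < n}" if "c \<in> set cls" for c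
    using lit(2)[OF that] len by auto
  have cl: "is_clause (?\<phi> ` set c)" "card (?\<phi> ` set c) \<le> 3" if "c \<in> set cls" for c
    using F that unfolding one_critical_unique_le3_cnf_def is_le3_cnf_def is_cnf_def F_eq by auto
  have ex1: "\<exists>!\<beta>. satisfying_assignment F \<beta>"
    using F by (simp add: one_critical_unique_le3_cnf_def uniquely_satisfiable_def)
  then have A: "satisfying_assignment F (the_assignment F)"
    unfolding the_assignment_def by (rule theI')
  then have dom: "\<And>x. x \<in> vars F \<Longrightarrow> the_assignment F x = Some (the (the_assignment F x))"
    unfolding satisfying_assignment_def by (metis domD option.sel)
  have sat_iff: "sat_literal (the_assignment F) (?\<phi> l) \<longleftrightarrow> ?\<alpha> (fst l) = snd l" if l: "fst l < n" for l
  proof -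
    obtain v where "the_assignment F (vs ! fst l) = Some v"
      using dom[OF nth_vars[OF l]] by (rule that)
    then show ?thesis unfolding sat_literal_def by (simp only: case_prod_beta' fst_conv snd_conv option.inject option.sel)
  qed
  have "unique_cnf cls n ?\<alpha>"
  proof
    show "distinct (map fst c)" if c: "c \<in> set cls" for c
    proof -
      have "inj_on fst (set c)"
      proof (rule inj_onI)
        fix l l' assume l: "l \<in> set c" "l' \<in> set c" "fst l = fst l'"
        then have "fst (?\<phi> l) = fst (?\<phi> l')" by (simp add: case_prod_beta')
        then have "?\<phi> l = ?\<phi> l'"
          using cl(1)[OF c] l unfolding is_clause_def inj_on_def by blast
        then show "l = l'" using l(3) by (simp add: case_prod_beta' prod_eq_iff)
      qed
      then show ?thesis using lit(1)[OF c] by (simp add: distinct_map)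
    qed
    show "fst l < n" if "c \<in> set cls" "l \<in> set c" for c l using lit(2)[OF that] len by simp
    show "\<exists>c\<in>set cls. \<exists>l\<in>set c. fst l = i" if i: "i < n" for i
    proof -
      have "vs ! i \<in> vars F" using i by (rule nth_vars)
      then obtain c l where c: "c \<in> set cls" "l \<in> set c" "vs ! i = fst (?\<phi> l)"
        unfolding vars_def F_eq by blast
      then have "vs ! i = vs ! fst l" by (simp add: case_prod_beta')
      then have "i = fst l" using inj_vs[OF i] lits[OF c(1)] c(2) by auto
      then show ?thesis using c by auto
    qed
    show "length c \<le> 3" if c: "c \<in> set cls" for c
    proof -
      have "card (?\<phi> ` set c) = card (set c)"
        by (rule card_image) (rule inj_on_subset[OF inj_\<phi> lits[OF c]])
      then show ?thesis using cl(2)[OF c] distinct_card[OF lit(1)[OF c]] by simp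
    qed
    show "distinct cls" using dist by (simp add: distinct_map)
    show "\<exists>l\<in>set c. ?\<alpha> (fst l) = snd l" if c: "c \<in> set cls" for c
    proof -
      have "?\<phi> ` set c \<in> F" using c unfolding F_eq by blast
      then obtain l where l: "l \<in> set c" "sat_literal (the_assignment F) (?\<phi> l)"
        using A unfolding satisfying_assignment_def by blast
      then show ?thesis using sat_iff[of l] lits[OF c] by auto
    qed
    fix \<beta> i assume \<beta>: "\<And>c. c \<in> set cls \<Longrightarrow> \<exists>l\<in>set c. \<beta> (fst l) = snd l" and i: "i < n"
    define idx where "idx = inv_into {..<n} ((!) vs)"
    have idx: "idx (vs ! j) = j" if "j < n" for j
      unfolding idx_def by (rule inv_into_f_f) (use that inj_vs in \<open>auto simp: inj_on_def\<close>)
    \<comment> \<open>An assignment of positions is carried back to the variables of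
      \<open>F\<close>; outside of them it has to be undefined to count as a satisfying
      assignment.\<close>
    define \<gamma> where "\<gamma> x = (if x \<in> vars F then Some (\<beta> (idx x)) else None)" for x
    have "satisfying_assignment F \<gamma>"
      unfolding satisfying_assignment_def
    proof
      show "dom \<gamma> = vars F" by (auto simp: \<gamma>_def dom_def)
      show "\<forall>C\<in>F. \<exists>l\<in>C. sat_literal \<gamma> l"
      proof
        fix C assume "C \<in> F"
        then obtain c where c: "c \<in> set cls" "C = ?\<phi> ` set c" unfolding F_eq by blast
        obtain l where l: "l \<in> set c" "\<beta> (fst l) = snd l" using \<beta>[OF c(1)] by auto
        have "fst l < n" using lits[OF c(1)] l by auto
        then have "sat_literal \<gamma> (?\<phi> l)"
          using l(2) idx nth_vars by (auto simp: sat_literal_def \<gamma>_def case_prod_beta')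
        then show "\<exists>l\<in>C. sat_literal \<gamma> l" using l(1) c(2) by blast
      qed
    qed
    then have "\<gamma> = the_assignment F" using ex1 A by blast
    moreover have "vs ! i \<in> vars F" using i by (rule nth_vars)
    ultimately show "\<beta> i = ?\<alpha> i" using idx[OF i] by (metis \<gamma>_def option.sel)
  qed
  then interpret unique_cnf cls n ?\<alpha> .
  show "one_critical_cnf cls n ?\<alpha> K a"
  proof
    fix c c' assume c: "c \<in> set cls" "c' \<in> set cls" "length (tlits c) = 1" "tlits c = tlits c'"
    obtain l where l: "tlits c = [l]" using c(3) by (auto simp: length_Suc_conv)
    have "l \<in> set (tlits c)" unfolding l by simp
    then have l_in: "l \<in> set c" "?\<alpha> (fst l) = snd l"
      unfolding tlits_def by auto
    let ?x = "vs ! fst l"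
    \<comment> \<open>A clause whose only true literal is \<open>l\<close> becomes a clause of
      \<open>F\<close> critical for the variable at the position of \<open>l\<close>; two such
      clauses must coincide in \<open>F\<close>, hence also in \<open>cls\<close>.\<close>
    have crit: "critical (the_assignment F) (?\<phi> ` set d) ?x" if d: "d \<in> set cls" "tlits d = [l]" for d
      unfolding critical_def
    proof (intro exI conjI)
      have "{l' \<in> ?\<phi> ` set d. sat_literal (the_assignment F) l'}
          = ?\<phi> ` {l' \<in> set d. sat_literal (the_assignment F) (?\<phi> l')}"
        by blast
      also have "{l' \<in> set d. sat_literal (the_assignment F) (?\<phi> l')} = set (tlits d)"
        unfolding tlits_def set_filter using sat_iff lits[OF d(1)] by blast
      finally show "{l' \<in> ?\<phi> ` set d. sat_literal (the_assignment F) l'} = {?\<phi> l}" using d(2) by simp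
      show "fst (?\<phi> l) = ?x" by (simp add: case_prod_beta')
    qed
    let ?S = "{C \<in> F. critical (the_assignment F) C ?x}"
    have "fst l < n" using lits[OF c(1)] l_in by auto
    then have "card ?S \<le> 1"
      using F nth_vars unfolding one_critical_unique_le3_cnf_def by blast
    moreover have "finite ?S" unfolding F_eq by simp
    moreover have "?\<phi> ` set c \<in> ?S" "?\<phi> ` set c' \<in> ?S"
      using crit[OF c(1) l] crit[OF c(2)] c l unfolding F_eq by auto
    ultimately have "?\<phi> ` set c = ?\<phi> ` set c'"
      by (metis (no_types, lifting) One_nat_def card_le_Suc0_iff_eq)
    then have "set c = set c'"
      using inj_on_image_eq_iff[OF inj_\<phi> lits[OF c(1)] lits[OF c(2)]] by blast
    then show "c = c'" using dist c by (auto simp: distinct_map inj_on_def)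
  qed (use a in auto)
qed

lemma enc_clauses: "enc cls = tree_of_clauses cls"
proof -
  have "(enc :: nat \<times> bool \<Rightarrow> tree) = tree_of_literal"
    by (auto simp: fun_eq_iff tree_of_literal_def enc_prod_def enc_nat_def enc_bool_def)
  then show ?thesis by (simp add: tree_of_clauses_def enc_list_def)
qed

lemma enc_assignment:
  "length vs = n \<Longrightarrow> enc (map (\<lambda>i. the (\<alpha> (vs ! i))) [0..<n]) = tree_of_assignment vs \<alpha>"
proof -
  assume n: "length vs = n"
  have "tree_of_list f (map g xs) = tree_of_list (\<lambda>x. f (g x)) xs" for f :: "bool \<Rightarrow> tree" and g :: "'a \<Rightarrow> bool" and xs
    by (induction xs) auto
  then have "tree_of_assignment vs \<alpha> = enc (map (\<lambda>x. the (\<alpha> x)) vs)"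
    by (simp add: tree_of_assignment_def enc_list_def enc_bool_def)
  also have "map (\<lambda>x. the (\<alpha> x)) vs = map (\<lambda>i. the (\<alpha> (vs ! i))) [0..<n]"
    using n by (auto intro!: nth_equalityI)
  finally show ?thesis ..
qed

text \<open>The gain is about 2.07 * 10^-17, the third-order loss about 0.69 * 10^-17 and the error
  of the integral 10^-18, so the required 10^-19 is left with ample room.\<close>

lemma rate_bound:
  fixes p q \<theta> S :: real
  defines "p \<equiv> 1 / 2 ^ 20" and "q \<equiv> 1 - 2 * p" and "\<theta> \<equiv> 1 / 2 ^ 11"
  shows "S + 8 * p ^ 3 / (1 - 2 * p)\<^sup>2 + 1 / 10 ^ 18 - p\<^sup>2 * q * ((\<theta> - 8 * \<theta>\<^sup>2) / 16 - 32 * \<theta>\<^sup>2) < S - 1 / 10 ^ 19"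
  by (simp add: p_def q_def \<theta>_def power2_eq_square power3_eq_cube)

text \<open>A maximal packing decides the case: if it covers at most n/16 variables, the linear
  candidate succeeds at rate 3/8, otherwise the biased run succeeds at the reduced PPSZ
  rate.\<close>

lemma (in one_critical_cnf) round_pmf_rate:
  fixes J D :: nat and S0 \<rho> :: real
  defines "\<theta> \<equiv> 1 / 2 ^ J"
  assumes J: "3 \<le> J" and \<theta>: "32 * \<theta>\<^sup>2 \<le> (\<theta> - 8 * \<theta>\<^sup>2) / 16"
    and base: "2 * p + (\<Sum>v | v < 2 ^ K \<and> 2 * 2 ^ (K - a) \<le> v. 1 - cut_prob D (real v / real (2 ^ K))) / real (2 ^ K) \<le> S0"
    and \<rho>: "3 / 8 \<le> \<rho>" "S0 - p\<^sup>2 * q * ((\<theta> - 8 * \<theta>\<^sup>2) / 16 - 32 * \<theta>\<^sup>2) \<le> \<rho>"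
  shows "2 powr (- \<rho> * real n) \<le> pmf (round_pmf a J K D cls out) (map \<alpha> [0..<n])"
proof -
  let ?W = "real (card (word_lists K n \<times> word_lists (Suc J) n))"
  have W: "0 < ?W" by (simp add: card_cartesian_product card_word_lists)
  obtain P where P: "packing P"
    "\<And>c. c \<in> set cls \<Longrightarrow> length (tlits c) = 2 \<Longrightarrow> \<exists>l\<in>set (tlits c). fst l \<in> covered P"
    using maximal_packing by metis
  have "?W * 2 powr (- \<rho> * real n) \<le> real (card (successes J D))"
  proof (cases "real (card (covered P)) \<le> real n / 16")
    case True
    have "?W * 2 powr (- \<rho> * real n) \<le> ?W * 2 powr (- (3 / 8) * real n)"
      using mult_right_mono[OF \<rho>(1), of "real n"] by (intro mult_left_mono powr_mono) auto
    also have "\<dots> \<le> real (card (successes J D))"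
      by (rule card_successes_sparse[OF J P(1) True P(2)])
    finally show ?thesis .
  next
    case False
    have "\<theta> \<le> 1 / 2 ^ 3"
      unfolding \<theta>_def using J by (intro divide_left_mono power_increasing) auto
    then have "E (\<lambda>\<tau>. \<Sum>x<n. cost \<theta> D \<tau> x) \<le> real n * (S0 - p\<^sup>2 * q * ((\<theta> - 8 * \<theta>\<^sup>2) / 16 - 32 * \<theta>\<^sup>2))"
      using False by (intro expected_cost[OF _ _ \<theta> base P(1)]) (auto simp: \<theta>_def)
    also have "\<dots> \<le> real n * \<rho>" using \<rho>(2) by (rule mult_left_mono) simp
    finally have "2 powr (- \<rho> * real n) \<le> 2 powr (- E (\<lambda>\<tau>. \<Sum>x<n. cost \<theta> D \<tau> x))"
      by (intro powr_mono) (auto simp: mult.commute)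
    then have "?W * 2 powr (- \<rho> * real n) \<le> ?W * 2 powr (- E (\<lambda>\<tau>. \<Sum>x<n. cost \<theta> D \<tau> x))"
      by (rule mult_left_mono) simp
    also have "\<dots> \<le> real (card (successes J D))"
      unfolding \<theta>_def by (rule card_successes_dense[OF J])
    finally show ?thesis .
  qed
  then have "2 powr (- \<rho> * real n) \<le> real (card (successes J D)) / ?W"
    using W by (simp add: pos_le_divide_eq mult.commute)
  also have "\<dots> \<le> pmf (round_pmf a J K D cls out) (map \<alpha> [0..<n])" by (rule round_pmf_success)
  finally show ?thesis .
qed

lemma search_time_le:
  fixes e :: nat
  assumes "1 \<le> e"
  shows "2 + (x + (2 + (y + ((6 + L * (11 + e * 11)) + (2 + ((2 + e * (T + 2)) + 2)))))) \<le> (18 + x + y + 22 * L + T) * e"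
proof -
  obtain d where "e = Suc d" using assms by (cases e) auto
  then show ?thesis by (simp add: algebra_simps)
qed

text \<open>The strict gap between \<rho> and \<open>base\<close> absorbs every polynomial factor
  for large n, so \<open>f\<close> is eventually 0; for the finitely many other n it is whatever the
  time requires.\<close>

lemma powr_overhead:
  fixes c k :: nat and l :: "nat \<Rightarrow> nat" and \<rho> base :: real
  defines "f \<equiv> \<lambda>n. max 0 (log 2 (real ((c + 1) * Suc n ^ k * 2 ^ l n)) / real n - base)"
  assumes l: "\<And>n. real (l n) \<le> \<rho> * real n + 1" and \<rho>: "\<rho> < base"
  shows "f \<in> o(\<lambda>_. 1)" "0 < n \<Longrightarrow> real ((c + 1) * Suc n ^ k * 2 ^ l n) \<le> 2 powr ((base + f n) * real n)"
proof -
  have log: "log 2 (real ((c + 1) * Suc n ^ k * 2 ^ l n)) = log 2 (real (c + 1)) + real k * log 2 (real n + 1) + real (l n)" for n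
  proof -
    have "real ((c + 1) * Suc n ^ k * 2 ^ l n) = real (c + 1) * (real n + 1) ^ k * 2 ^ l n"
      by (simp only: of_nat_mult of_nat_power of_nat_Suc of_nat_numeral add.commute[of 1])
    also have "log 2 \<dots> = log 2 (real (c + 1)) + log 2 ((real n + 1) ^ k) + log 2 (2 ^ l n)"
      by (subst log_mult_pos, simp_all del: of_nat_add of_nat_Suc)+
    finally show ?thesis by (simp add: log_nat_power)
  qed
  have "eventually (\<lambda>n. (log 2 (real (c + 1)) + 1 + real k * log 2 (real n + 1)) / real n + \<rho> < base) at_top"
    by (rule eventually_poly_overhead[OF \<rho>])
  then have "eventually (\<lambda>n. f n = 0) at_top"
    using eventually_gt_at_top[of 0]
  proof eventually_elim
    case (elim n)
    have "(log 2 (real (c + 1)) + real k * log 2 (real n + 1) + real (l n)) / real n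
      \<le> (log 2 (real (c + 1)) + 1 + real k * log 2 (real n + 1) + \<rho> * real n) / real n"
      using l[of n] by (intro divide_right_mono) auto
    also have "\<dots> < base" using elim by (simp add: add_divide_distrib)
    finally show ?case unfolding f_def log by simp
  qed
  then show "f \<in> o(\<lambda>_. 1)" by (subst landau_o.small.in_cong) auto
  assume n: "0 < n"
  let ?X = "real ((c + 1) * Suc n ^ k * 2 ^ l n)"
  have "0 < ?X" by (simp only: of_nat_0_less_iff) simp
  then have "?X = 2 powr (log 2 ?X)" by simp
  also have "\<dots> \<le> 2 powr ((base + f n) * real n)"
  proof (intro powr_mono)
    have "log 2 ?X / real n \<le> base + f n" unfolding f_def by linarith
    then show "log 2 ?X \<le> (base + f n) * real n" using n by (simp add: pos_divide_le_eq)
  qed simp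
  finally show "?X \<le> 2 powr ((base + f n) * real n)" .
qed

theorem theorem20:
  shows "\<exists>(P :: com) (f :: nat \<Rightarrow> real) (g :: nat \<Rightarrow> real).
    f \<in> o(\<lambda>_. 1) \<and> g \<in> o(\<lambda>n. real n) \<and>
    (\<forall>(F :: nat cnf) vs cls n.
       one_critical_unique_le3_cnf F \<and> n = card (vars F) \<and> lists_cnf vs cls F \<longrightarrow>
         (n > 0 \<longrightarrow>
            expected_time P (tree_of_clauses cls)
              \<le> ennreal (2 powr (((2 * ln 2 - 1) - 1 / 10 ^ 19 + f n) * real n))) \<and>
         output_prob P (tree_of_clauses cls) (tree_of_assignment vs (the_assignment F))
           \<ge> 2 powr (- g n))"
proof -
  define a J :: nat where "a = 20" and "J = 11"
  define p :: real where "p = 1 / 2 ^ a"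
  define q \<theta> :: real where "q = 1 - 2 * p" and "\<theta> = 1 / 2 ^ J"
  define S base :: real where "S = 2 * ln 2 - 1" and "base = S - 1 / 10 ^ 19"
  define S0 where "S0 = S + 8 * p ^ 3 / (1 - 2 * p)\<^sup>2 + 1 / 10 ^ 18"
  have aJ: "2 \<le> a" "3 \<le> J" by (simp_all add: a_def J_def)
  obtain K D where KD: "2 * a \<le> K"
    "2 * p + (\<Sum>v | v < 2 ^ K \<and> 2 * 2 ^ (K - a) \<le> v. 1 - cut_prob D (real v / real (2 ^ K))) / real (2 ^ K) \<le> S0"
    using baseline_cost[OF aJ(1), of "1 / 10 ^ 18"] unfolding S0_def S_def p_def by auto
  have "S0 - p\<^sup>2 * q * ((\<theta> - 8 * \<theta>\<^sup>2) / 16 - 32 * \<theta>\<^sup>2) < base"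
    unfolding S0_def q_def p_def \<theta>_def base_def a_def J_def by (rule rate_bound)
  moreover have "3 / 8 < base" using ln2_lower by (simp add: base_def S_def)
  \<comment> \<open>The rate is rounded up to a rational number still below \<open>base\<close>, so
    that the exponent of the number of rounds can be computed by integer arithmetic.\<close>
  ultimately obtain r where r: "r \<in> \<rat>" "max (3 / 8) (S0 - p\<^sup>2 * q * ((\<theta> - 8 * \<theta>\<^sup>2) / 16 - 32 * \<theta>\<^sup>2)) < r" "r < base"
    using Rats_dense_in_real[of "max (3 / 8) (S0 - p\<^sup>2 * q * ((\<theta> - 8 * \<theta>\<^sup>2) / 16 - 32 * \<theta>\<^sup>2))" base] by auto
  obtain u v :: nat where uv: "v \<noteq> 0" "\<bar>r\<bar> = real u / real v"
    using Rats_abs_nat_div_natE[OF r(1)] by metis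
  have r_eq: "r = real u / real v" using r(2) uv(2) by linarith
  \<comment> \<open>Adding 1 after rounding down ensures r m \<le> \<open>Lf m\<close>, enough
    rounds for a constant success probability.\<close>
  define Lf where "Lf m = (u * m) div v + 1" for m
  have Lf: "r * real m \<le> real (Lf m)" "real (Lf m) \<le> r * real m + 1" for m
  proof -
    have "real (u * m) = real v * real (u * m div v) + real (u * m mod v)"
      by (metis div_mult_mod_eq mult.commute of_nat_add of_nat_mult)
    moreover have "real (u * m mod v) < real v" using uv(1) by simp
    ultimately have "real (u * m) / real v \<le> real (u * m div v) + 1" "real (u * m div v) \<le> real (u * m) / real v"
      using uv(1) by (auto simp: field_simps)
    then show "r * real m \<le> real (Lf m)" "real (Lf m) \<le> r * real m + 1"
      by (simp_all add: Lf_def r_eq)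
  qed
  have "polytime Lf" unfolding Lf_def Suc_eq_plus1[symmetric] by (intro polytime_intros) (use uv in simp)
  then obtain PL mL uL where PL: "computes PL mL uL Lf" "polybounded uL" "polybounded (\<lambda>x. esz (Lf x))"
    by (rule polytimeE)
  have "polytime num_vars" by (intro polytime_intros)
  then obtain PN mN uN where PN: "computes PN mN uN num_vars" "polybounded uN"
    by (rule polytimeE)
  obtain P m uP where P: "computes P m uP (\<lambda>p. attempt a J K D (fst p) (fst (snd p)) (fst (snd (snd p))) (snd (snd (snd p))))"
      "polybounded uP"
    by (rule polytimeE[OF polytime_attempt])
  define M where "M = Suc (m + mN + mL)"
  have M: "0 < M" "m \<le> M" "mN \<le> M" "mL \<le> M" by (simp_all add: M_def)
  obtain cN kN where cN: "\<And>x. uN x \<le> cN * esz x ^ kN" using PN(2) by (auto simp: polybounded_def)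
  obtain cP kP where cP: "\<And>x. uP x \<le> cP * esz x ^ kP" using P(2) unfolding polybounded_def by blast
  define B where "B n = cP * round_bound J K n ^ kP" for n
  define T where "T n = (6 + n * (11 + K * 5)) + ((6 + n * (11 + Suc J * 5)) + (8 + (B n + (2 + 3))))" for n
  define A where "A n = 18 + cN * cls_bound n ^ kN + uL n + 22 * Lf n + T n" for n
  have "polybounded Lf" by (rule polybounded_mono[OF PL(3)]) simp
  then have "polybounded A"
    unfolding A_def T_def B_def
    by (intro polybounded_add polybounded_mult polybounded_power polybounded_const polybounded_nat
        polybounded_cls_bound polybounded_round_bound PL(2))
  then obtain c k where ck: "\<And>n. A n \<le> c * Suc n ^ k" by (auto simp: polybounded_def)
  define f where "f = (\<lambda>n. max 0 (log 2 (real ((c + 1) * Suc n ^ k * 2 ^ Lf n)) / real n - base))"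
  define prog where "prog = search_com J K PN PL P M"
  show ?thesis
  \<comment> \<open>The number of rounds is at least the inverse of the lower bound on the success
    probability of a round, so the overall success probability is at least 1/2 and the constant 1
    serves as the o(n) term.\<close>
  proof (rule exI[of _ prog], rule exI[of _ f], rule exI[of _ "\<lambda>_ :: nat. 1 :: real"], intro conjI allI impI)
    show "f \<in> o(\<lambda>_. 1)" unfolding f_def by (rule powr_overhead(1)[OF Lf(2) r(3)])
    show "(\<lambda>_. 1 :: real) \<in> o(\<lambda>n. real n)" by real_asymp
    fix F :: "nat cnf" and vs cls n
    assume *: "one_critical_unique_le3_cnf F \<and> n = card (vars F) \<and> lists_cnf vs cls F"
    define \<alpha> where "\<alpha> i = the (the_assignment F (vs ! i))" for i
    have "0 < a" by (simp add: a_def)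
    note positional = positional_instance[of F n vs cls a K]
    have inst: "one_critical_cnf cls n \<alpha> K a" and len: "length vs = n"
      unfolding \<alpha>_def using positional * KD(1) \<open>0 < a\<close> by blast+
    interpret C: one_critical_cnf cls n \<alpha> K a by (rule inst)
    have C_pq: "C.p = p" "C.q = q" by (simp_all add: C.p_def C.q_def p_def q_def)
    let ?\<mu> = "iterate_pmf (2 ^ Lf n) (round_pmf a J K D cls) []"
    let ?T = "2 + (uN cls + (2 + (uL n + ((6 + Lf n * (11 + 2 ^ Lf n * 11)) + (2 + ((2 + 2 ^ Lf n * (T n + 2)) + 2))))))"
    have B: "uP (round_input cls ts gs out) \<le> B n"
      if "ts \<in> word_lists K n" "gs \<in> word_lists (Suc J) n" "length out \<le> n" for ts gs out
    proof -
      have "esz (round_input cls ts gs out) \<le> round_bound J K n"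
        using C.esz_cls esz_word_lists[OF that(1)] esz_word_lists[OF that(2)] esz_bools[of out] that(3)
        by (simp add: round_input_def round_bound_def)
      then show ?thesis unfolding B_def using cP[of "round_input cls ts gs out"]
        by (meson mult_le_mono2 order_trans power_mono zero_le)
    qed
    have "samples prog ((\<lambda>_. Leaf)(0 := enc cls)) ?\<mu> (\<lambda>out s'. s' 0 = enc out) ?T"
      unfolding prog_def
      by (rule samples_search[OF PN(1) PL(1) P(1) M, of cls "B n" "T n" "Lf n", unfolded C.num_vars_eq])
        (use B in \<open>auto simp: T_def\<close>)
    note run = samples_output_prob[OF this, unfolded enc_clauses]
    show "2 powr - 1 \<le> output_prob prog (tree_of_clauses cls) (tree_of_assignment vs (the_assignment F))"
    proof -
      have rate: "2 powr (- r * real n) \<le> pmf (round_pmf a J K D cls out) (map \<alpha> [0..<n])" for out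
      proof (rule C.round_pmf_rate[OF aJ(2), unfolded C_pq, OF _ KD(2), folded \<theta>_def])
        show "32 * \<theta>\<^sup>2 \<le> (\<theta> - 8 * \<theta>\<^sup>2) / 16" by (simp add: \<theta>_def J_def power2_eq_square)
      qed (use r(2) in auto)
      have "2 powr (- r * real n) * real (2 ^ Lf n) = 2 powr (real (Lf n) - r * real n)"
        by (simp add: powr_realpow[symmetric] powr_add[symmetric])
      moreover have "1 \<le> 2 powr (real (Lf n) - r * real n)"
        using Lf(1)[of n] by (intro ge_one_powr_ge_zero) auto
      ultimately have "1 \<le> 2 powr (- r * real n) * real (2 ^ Lf n)" by simp
      moreover have "2 powr (- r * real n) \<le> 1"
        using powr_mono[of "- r * real n" 0 2] r(2) by simp
      ultimately have "1 / 2 \<le> pmf ?\<mu> (map \<alpha> [0..<n])"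
        by (intro iterate_pmf_half[where \<sigma> = "2 powr (- r * real n)"] rate C.round_pmf_stay) auto
      also have "\<dots> \<le> output_prob prog (tree_of_clauses cls) (enc (map \<alpha> [0..<n]))" by (rule run(1))
      also have "enc (map \<alpha> [0..<n]) = tree_of_assignment vs (the_assignment F)"
        unfolding \<alpha>_def by (rule enc_assignment[OF len])
      finally show ?thesis by (simp add: powr_minus_divide)
    qed
    assume n: "0 < n"
    have "uN cls \<le> cN * cls_bound n ^ kN"
      using cN[of cls] C.esz_cls by (meson mult_le_mono2 order_trans power_mono zero_le)
    then have "18 + uN cls + uL n + 22 * Lf n + T n \<le> A n" by (simp add: A_def)
    also have "\<dots> \<le> (c + 1) * Suc n ^ k" using ck[of n] by simp
    finally have "?T \<le> (c + 1) * Suc n ^ k * 2 ^ Lf n"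
      by (intro order_trans[OF search_time_le]) (simp, rule mult_le_mono1)
    then have "real ?T \<le> real ((c + 1) * Suc n ^ k * 2 ^ Lf n)" by (rule of_nat_mono)
    also have "\<dots> \<le> 2 powr ((base + f n) * real n)" unfolding f_def by (rule powr_overhead(2)[OF Lf(2) r(3) n])
    finally have "ennreal (real ?T) \<le> ennreal (2 powr ((base + f n) * real n))" by (rule ennreal_leI)
    then have "of_nat ?T \<le> ennreal (2 powr ((base + f n) * real n))"
      by (simp only: ennreal_of_nat_eq_real_of_nat)
    then show "expected_time prog (tree_of_clauses cls)
        \<le> ennreal (2 powr (((2 * ln 2 - 1) - 1 / 10 ^ 19 + f n) * real n))"
      using run(2) unfolding base_def S_def by (rule order_trans[rotated])
  qed
qed

end
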